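(* Let $p\in[1,\infty)$, and let $(\Omega,\mathfrak{A},\mu)$ and $(\Gamma,\mathfrak{B},\nu)$ be arbitrary measure spaces. Suppose that $\Phi:L^p(\mu)_+^{\mathrm{sp}}\to L^p(\nu)_+^{\mathrm{sp}}$ is a metric preserving bijection, i.e. a bijection with $\|\Phi(f)-\Phi(g)\|_p=\|f-g\|_p$ for all $f,g\in L^p(\mu)_+^{\mathrm{sp}}$. Then: (a) $\Phi$ can be extended (uniquely) to an isometric order isomorphism from $L^p(\mu)$ onto $L^p(\nu)$. (b) There is a regular set isomorphism $\Lambda:\mathfrak{A}^\sigma\to\mathfrak{B}^\sigma$ such that for each $E\in\mathfrak{A}^\sigma$ one can find a $\mathfrak{B}^{\sigma c\sigma}$-measurable function $h^E:\Lambda(E)\to[0,\infty)$, satisfying $$h^F|_{\Lambda(E)}=h^E\quad\nu\text{-a.e.},\qquad\text{for all }E,F\in\mathfrak{A}^\sigma\text{ with }E\preceq F,$$ such that $$\Phi(g)=\widehat{\Lambda}(g)\,h^E\quad\nu\text{-a.e.},\qquad\text{for all }g\in L^p(\mu)_+^{\mathrm{sp}}\text{ and }E\in\mathfrak{A}^\sigma\text{ with }\mu(\{x\in\Omega: g(x)\neq 0\}\setminus E)=0.$$ (c) Let $\Lambda$ be as in (b). If $(\Gamma,\mathfrak{B},\nu)$ is localizable, then the Radon-Nikodym derivative $d\mu^\Lambda/d\nu$ exists, and $$\Phi(g)=\widehat{\Lambda}(g)\left(\frac{d\mu^\Lambda}{d\nu}\right)^{1/p}\quad\nu\text{-a.e.}\qquad(g\in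 L^p(\mu)_+^{\mathrm{sp}}).$$ If, in addition, $(\Omega,\mathfrak{A},\mu)$ is also localizable, then $\Lambda$ extends to a regular set isomorphism from $\mathfrak{A}$ to $\mathfrak{B}$.
   Context: Measures are countably additive, $[0,\infty]$-valued, defined on $\sigma$-algebras. $L^p(\mu)$ is the Banach space of $\mu$-a.e. classes of complex-valued $p$-integrable measurable functions, and $L^p(\mu)_+^{\mathrm{sp}}:=\{f\in L^p(\mu):\|f\|_p=1,\ f\geq 0\ \mu\text{-a.e.}\}$. An isometric order isomorphism is a surjective linear isometry mapping the cone of (a.e.) non-negative functions onto the cone of non-negative functions. For a measure space $(\Omega,\mathfrak{A},\mu)$: $\mathfrak{A}^0:=\{A\in\mathfrak{A}:\mu(A)=0\}$; $\mathfrak{A}^{\mathbf f}:=\{A\in\mathfrak{A}:\mu(A)<\infty\}$; $\mathfrak{A}^\sigma$ is the collection of countable unions of elements of $\mathfrak{A}^{\mathbf f}$ (a $\sigma$-ring); $\mathfrak{A}^{\sigma c\sigma}:=\mathfrak{A}^\sigma\cup\{\Omega\setminus A:A\in\mathfrak{A}^\sigma\}$ (a $\sigma$-algebra). Similarly for $(\Gamma,\mathfrak{B},\nu)$. For $E,F\in\mathfrak{A}$ write $E\preceq F$ if $\mu(E\setminus F)=0$, and $E\equiv F$ if $E\preceq F$ and $F\preceq E$. The measure space is semi-finite if every $E\in\mathfrak{A}\setminus\mathfrak{A}^0$ contains some $A\in\mathfrak{A}^{\mathbf f}\setminus\mathfrak{A}^0$. It is localizable if it is semi-finite and every family $\{E_i\}$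 in $\mathfrak{A}$ has an essential supremum, i.e. an $E\in\mathfrak{A}$ with $E_i\preceq E$ for all $i$, and $E\preceq F$ whenever $F\in\mathfrak{A}$ satisfies $E_i\preceq F$ for all $i$. If $\mathfrak{P}\subseteq\mathfrak{A}$ and $\mathfrak{Q}\subseteq\mathfrak{B}$ are subrings, a map $\Lambda:\mathfrak{P}\to\mathfrak{Q}$ is a regular set isomorphism if: $\Lambda(A)\equiv\emptyset$ if and only if $A\equiv\emptyset$ ($A\in\mathfrak{P}$); $\Lambda(A_1\setminus A_2)\equiv\Lambda(A_1)\setminus\Lambda(A_2)$ ($A_1,A_2\in\mathfrak{P}$); and for any $B\in\mathfrak{Q}$ there is $A\in\mathfrak{P}$ with $\Lambda(A)\equiv B$. Given a regular set isomorphism $\Lambda:\mathfrak{A}^\sigma\to\mathfrak{B}^\sigma$, the measure $\mu^\Lambda$ on the $\sigma$-algebra $\mathfrak{B}^{\sigma c\sigma}$ is defined by $\mu^\Lambda(B):=\mu(A)$ if $B\in\mathfrak{B}^\sigma$ and $A\in\mathfrak{A}^\sigma$ satisfies $\Lambda(A)\equiv B$ (this is independent of the choice of $A$), and $\mu^\Lambda(F):=\infty$ for $F\in\mathfrak{B}^{\sigma c\sigma}\setminus\mathfrak{B}^\sigma$. (A set in $\mathfrak{B}^{\sigma c\sigma}$ is $\mu^\Lambda$-null if and only if it is $\nu$-null.) Then $\widehat{\Lambda}:L^p(\mu)\to L^p(\mu^\Lambda)$ denotes the isometric order isomorphism determined by $\widehat{\Lambda}(\mathbf 1_A)=\mathbf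 1_{\Lambda(A)}$ for $A\in\mathfrak{A}^{\mathbf f}$. In (b), the product $\widehat{\Lambda}(g)h^E$ is understood as $0$ outside $\Lambda(E)$ (where $\widehat\Lambda(g)$ vanishes a.e.), and, since $E\preceq F$ implies $\Lambda(E)\preceq\Lambda(F)$, the restriction $h^F|_{\Lambda(E)}$ is defined up to a $\nu$-null set. In (c), $d\mu^\Lambda/d\nu$ denotes the $\mathfrak{B}$-measurable function $k:\Gamma\to[0,\infty)$, unique up to $\nu$-null sets, such that $\mu^\Lambda(E)=\int_E k\,d\nu$ for every $E$ that is a countable union of sets in $\mathfrak{B}^{\sigma c\sigma}$ of finite $\mu^\Lambda$-measure; "exists" means that such a function exists and is unique up to $\nu$-null sets. *)

theory Defs
  imports "HOL-Analysis.Analysis"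
begin

text \<open>A class is the set of all measurable functions that agree a.e. with a given one; values
  outside \<^term>\<open>space M\<close> play no role. Operations on classes go through a
  chosen representative, on which they do not depend.\<close>

definition ae_class :: "'a measure \<Rightarrow> ('a \<Rightarrow> complex) \<Rightarrow> ('a \<Rightarrow> complex) set" where
  "ae_class M f = {g \<in> borel_measurable M. AE x in M. g x = f x}"

definition rep :: "('a \<Rightarrow> complex) set \<Rightarrow> 'a \<Rightarrow> complex" where
  "rep u = (SOME f. f \<in> u)"

lemma rep_ae_class:
  assumes "f \<in> borel_measurable M"
  shows "rep (ae_class M f) \<in> borel_measurable M" "AE x in M. rep (ae_class M f) x = f x"
proof -
  have "f \<in> ae_class M f" using assms by (simp add: ae_class_def)
  then have "rep (ae_class M f) \<in> ae_class M f" unfolding rep_def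
    by (rule someI[of "\<lambda>g. g \<in> ae_class M f"])
  then show "rep (ae_class M f) \<in> borel_measurable M" "AE x in M. rep (ae_class M f) x = f x"
    by (simp_all add: ae_class_def)
qed

definition Lp :: "real \<Rightarrow> 'a measure \<Rightarrow> ('a \<Rightarrow> complex) set set" where
  "Lp p M = ae_class M ` {f \<in> borel_measurable M. integrable M (\<lambda>x. cmod (f x) powr p)}"

definition Lp_norm :: "real \<Rightarrow> 'a measure \<Rightarrow> ('a \<Rightarrow> complex) set \<Rightarrow> real" where
  "Lp_norm p M u = (\<integral>x. cmod (rep u x) powr p \<partial>M) powr (1 / p)"

definition Lp_add :: "'a measure \<Rightarrow> ('a \<Rightarrow> complex) set \<Rightarrow> ('a \<Rightarrow> complex) set \<Rightarrow> ('a \<Rightarrow> complex) set" where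
  "Lp_add M u v = ae_class M (\<lambda>x. rep u x + rep v x)"

definition Lp_diff :: "'a measure \<Rightarrow> ('a \<Rightarrow> complex) set \<Rightarrow> ('a \<Rightarrow> complex) set \<Rightarrow> ('a \<Rightarrow> complex) set" where
  "Lp_diff M u v = ae_class M (\<lambda>x. rep u x - rep v x)"

definition Lp_scale :: "'a measure \<Rightarrow> complex \<Rightarrow> ('a \<Rightarrow> complex) set \<Rightarrow> ('a \<Rightarrow> complex) set" where
  "Lp_scale M c u = ae_class M (\<lambda>x. c * rep u x)"

definition Lp_cone :: "real \<Rightarrow> 'a measure \<Rightarrow> ('a \<Rightarrow> complex) set set" where
  "Lp_cone p M = {u \<in> Lp p M. AE x in M. rep u x \<in> \<real>\<^sub>\<ge>\<^sub>0}"

definition Lp_pos_sphere :: "real \<Rightarrow> 'a measure \<Rightarrow> ('a \<Rightarrow> complex) set set" where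
  "Lp_pos_sphere p M = {u \<in> Lp_cone p M. Lp_norm p M u = 1}"

definition isometric_order_iso ::
  "real \<Rightarrow> 'a measure \<Rightarrow> 'b measure \<Rightarrow> (('a \<Rightarrow> complex) set \<Rightarrow> ('b \<Rightarrow> complex) set) \<Rightarrow> bool" where
  "isometric_order_iso p M N T \<longleftrightarrow>
     T ` Lp p M = Lp p N \<and>
     (\<forall>u\<in>Lp p M. \<forall>v\<in>Lp p M. T (Lp_add M u v) = Lp_add N (T u) (T v)) \<and>
     (\<forall>c. \<forall>u\<in>Lp p M. T (Lp_scale M c u) = Lp_scale N c (T u)) \<and>
     (\<forall>u\<in>Lp p M. Lp_norm p N (T u) = Lp_norm p M u) \<and>
     T ` Lp_cone p M = Lp_cone p N"

definition fin_sets :: "'a measure \<Rightarrow> 'a set set" where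
  "fin_sets M = {A \<in> sets M. emeasure M A < \<infinity>}"

definition sigma_fin_sets :: "'a measure \<Rightarrow> 'a set set" where
  "sigma_fin_sets M = {\<Union>n. A n | A :: nat \<Rightarrow> 'a set. range A \<subseteq> fin_sets M}"

definition sigma_co_sets :: "'a measure \<Rightarrow> 'a set set" where
  "sigma_co_sets M = sigma_fin_sets M \<union> {space M - A | A. A \<in> sigma_fin_sets M}"

definition ess_subset :: "'a measure \<Rightarrow> 'a set \<Rightarrow> 'a set \<Rightarrow> bool" where
  "ess_subset M E F \<longleftrightarrow> emeasure M (E - F) = 0"

definition ess_eq :: "'a measure \<Rightarrow> 'a set \<Rightarrow> 'a set \<Rightarrow> bool" where
  "ess_eq M E F \<longleftrightarrow> ess_subset M E F \<and> ess_subset M F E"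

definition semi_finite :: "'a measure \<Rightarrow> bool" where
  "semi_finite M \<longleftrightarrow>
     (\<forall>E\<in>sets M. emeasure M E \<noteq> 0 \<longrightarrow> (\<exists>A\<in>fin_sets M. A \<subseteq> E \<and> emeasure M A \<noteq> 0))"

definition ess_supremum :: "'a measure \<Rightarrow> 'a set set \<Rightarrow> 'a set \<Rightarrow> bool" where
  "ess_supremum M \<E> E \<longleftrightarrow> E \<in> sets M \<and> (\<forall>D\<in>\<E>. ess_subset M D E) \<and>
     (\<forall>F\<in>sets M. (\<forall>D\<in>\<E>. ess_subset M D F) \<longrightarrow> ess_subset M E F)"

definition localizable :: "'a measure \<Rightarrow> bool" where
  "localizable M \<longleftrightarrow> semi_finite M \<and> (\<forall>\<E>\<subseteq>sets M. \<exists>E. ess_supremum M \<E> E)"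

definition regular_set_iso ::
  "'a measure \<Rightarrow> 'b measure \<Rightarrow> 'a set set \<Rightarrow> 'b set set \<Rightarrow> ('a set \<Rightarrow> 'b set) \<Rightarrow> bool" where
  "regular_set_iso M N \<PP> \<QQ> \<Lambda> \<longleftrightarrow>
     ring_of_sets (space M) \<PP> \<and> \<PP> \<subseteq> sets M \<and>
     ring_of_sets (space N) \<QQ> \<and> \<QQ> \<subseteq> sets N \<and>
     \<Lambda> \<in> \<PP> \<rightarrow> \<QQ> \<and>
     (\<forall>A\<in>\<PP>. ess_eq N (\<Lambda> A) {} \<longleftrightarrow> ess_eq M A {}) \<and>
     (\<forall>A\<^sub>1\<in>\<PP>. \<forall>A\<^sub>2\<in>\<PP>. ess_eq N (\<Lambda> (A\<^sub>1 - A\<^sub>2)) (\<Lambda> A\<^sub>1 - \<Lambda> A\<^sub>2)) \<and>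
     (\<forall>B\<in>\<QQ>. \<exists>A\<in>\<PP>. ess_eq N (\<Lambda> A) B)"

text \<open>The transported measure. That the set function below is a measure, so that it
  is indeed the \<^const>\<open>emeasure\<close> of \<open>transport M N \<Lambda>\<close>, is shown in \<open>emeasure_transport\<close>.\<close>

definition transport :: "'a measure \<Rightarrow> 'b measure \<Rightarrow> ('a set \<Rightarrow> 'b set) \<Rightarrow> 'b measure" where
  "transport M N \<Lambda> = measure_of (space N) (sigma_co_sets N)
     (\<lambda>B. if B \<in> sigma_fin_sets N
          then emeasure M (SOME A. A \<in> sigma_fin_sets M \<and> ess_eq N (\<Lambda> A) B) else \<infinity>)"

definition induced_iso ::
  "real \<Rightarrow> 'a measure \<Rightarrow> 'b measure \<Rightarrow> ('a set \<Rightarrow> 'b set) \<Rightarrow> ('a \<Rightarrow> complex) set \<Rightarrow> ('b \<Rightarrow> complex) set" where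
  "induced_iso p M N \<Lambda> = (THE T. T \<in> extensional (Lp p M) \<and>
     isometric_order_iso p M (transport M N \<Lambda>) T \<and>
     (\<forall>A\<in>fin_sets M. T (ae_class M (indicator A)) = ae_class (transport M N \<Lambda>) (indicator (\<Lambda> A))))"

text \<open>\<open>h E\<close> is only relevant on \<open>\<Lambda> E\<close>.\<close>

definition local_weights ::
  "'a measure \<Rightarrow> 'b measure \<Rightarrow> ('a set \<Rightarrow> 'b set) \<Rightarrow> ('a set \<Rightarrow> 'b \<Rightarrow> real) \<Rightarrow> bool" where
  "local_weights M N \<Lambda> h \<longleftrightarrow>
     (\<forall>E\<in>sigma_fin_sets M.
        h E \<in> borel_measurable (restrict_space (sigma (space N) (sigma_co_sets N)) (\<Lambda> E)) \<and>
        (\<forall>y\<in>\<Lambda> E. 0 \<le> h E y)) \<and>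
     (\<forall>E\<in>sigma_fin_sets M. \<forall>F\<in>sigma_fin_sets M. ess_subset M E F \<longrightarrow>
        (AE y in N. y \<in> \<Lambda> E \<inter> \<Lambda> F \<longrightarrow> h F y = h E y))"

definition represents ::
  "real \<Rightarrow> 'a measure \<Rightarrow> 'b measure \<Rightarrow> (('a \<Rightarrow> complex) set \<Rightarrow> ('b \<Rightarrow> complex) set) \<Rightarrow> ('a set \<Rightarrow> 'b set) \<Rightarrow> bool" where
  "represents p M N \<Phi> \<Lambda> \<longleftrightarrow>
     regular_set_iso M N (sigma_fin_sets M) (sigma_fin_sets N) \<Lambda> \<and>
     (\<exists>h. local_weights M N \<Lambda> h \<and>
        (\<forall>g\<in>Lp_pos_sphere p M. \<forall>E\<in>sigma_fin_sets M.
           emeasure M ({x \<in> space M. rep g x \<noteq> 0} - E) = 0 \<longrightarrow>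
           \<Phi> g = ae_class N (\<lambda>y. if y \<in> \<Lambda> E
                   then rep (induced_iso p M N \<Lambda> g) y * complex_of_real (h E y) else 0)))"

text \<open>Neither measure is assumed sigma-finite, and \<open>K\<close> may live on a smaller sigma-algebra
  than \<open>N\<close>; only sets that are sigma-finite for \<open>K\<close> are tested.\<close>

definition is_RN_derivative :: "'b measure \<Rightarrow> 'b measure \<Rightarrow> ('b \<Rightarrow> real) \<Rightarrow> bool" where
  "is_RN_derivative N K k \<longleftrightarrow>
     k \<in> borel_measurable N \<and> (\<forall>y\<in>space N. 0 \<le> k y) \<and>
     (\<forall>E\<in>sigma_fin_sets K. emeasure K E = (\<integral>\<^sup>+y\<in>E. ennreal (k y) \<partial>N))"

lemma sigma_fin_sets_sets: "A \<in> sigma_fin_sets M \<Longrightarrow> A \<in> sets M"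
  by (auto simp: sigma_fin_sets_def fin_sets_def)

lemma sigma_fin_sets_subset:
  assumes "A \<in> sigma_fin_sets M" "B \<in> sets M" "B \<subseteq> A"
  shows "B \<in> sigma_fin_sets M"
proof -
  obtain F :: "nat \<Rightarrow> 'a set" where F: "A = (\<Union>n. F n)" "range F \<subseteq> fin_sets M"
    using assms(1) unfolding sigma_fin_sets_def by blast
  have "B \<inter> F n \<in> fin_sets M" for n
  proof -
    have *: "F n \<in> sets M" "emeasure M (F n) < \<infinity>" using F(2) by (auto simp: fin_sets_def)
    have "emeasure M (B \<inter> F n) \<le> emeasure M (F n)" by (rule emeasure_mono) (use * in auto)
    with * assms(2) show ?thesis by (auto simp: fin_sets_def intro: le_less_trans)
  qed
  moreover have "B = (\<Union>n. B \<inter> F n)" using assms(3) F(1) by auto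
  ultimately show ?thesis unfolding sigma_fin_sets_def by blast
qed

lemma sigma_fin_sets_UN:
  fixes A :: "nat \<Rightarrow> 'a set"
  assumes "\<And>n. A n \<in> sigma_fin_sets M"
  shows "(\<Union>n. A n) \<in> sigma_fin_sets M"
proof -
  have "\<forall>n. \<exists>F :: nat \<Rightarrow> 'a set. A n = (\<Union>k. F k) \<and> range F \<subseteq> fin_sets M"
    using assms by (auto simp: sigma_fin_sets_def)
  then obtain F :: "nat \<Rightarrow> nat \<Rightarrow> 'a set"
    where F: "\<And>n. A n = (\<Union>k. F n k)" "\<And>n. range (F n) \<subseteq> fin_sets M" by metis
  define G where "G i = (case prod_decode i of (n, k) \<Rightarrow> F n k)" for i
  have "(\<Union>n. A n) = (\<Union>i. G i)"
  proof (intro subset_antisym subsetI)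
    fix x assume "x \<in> (\<Union>n. A n)"
    then obtain n k where "x \<in> F n k" using F(1) by auto
    then have "x \<in> G (prod_encode (n, k))" by (simp add: G_def)
    then show "x \<in> (\<Union>i. G i)" by blast
  next
    fix x assume "x \<in> (\<Union>i. G i)"
    then obtain i where i: "x \<in> G i" by blast
    obtain n k where "prod_decode i = (n, k)" by (cases "prod_decode i")
    then have "x \<in> F n k" using i by (simp add: G_def)
    then show "x \<in> (\<Union>n. A n)" using F(1) by auto
  qed
  moreover have "range G \<subseteq> fin_sets M" using F(2) by (fastforce simp: G_def split: prod.splits)
  ultimately show ?thesis unfolding sigma_fin_sets_def by blast
qed

lemma sigma_fin_sets_empty: "{} \<in> sigma_fin_sets M"
  unfolding sigma_fin_sets_def
  by (rule CollectI, rule exI[of _ "\<lambda>_. {}"]) (auto simp: fin_sets_def)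

lemma sigma_fin_sets_Un:
  assumes "A \<in> sigma_fin_sets M" "B \<in> sigma_fin_sets M"
  shows "A \<union> B \<in> sigma_fin_sets M"
proof -
  have "(\<Union>n::nat. if n = 0 then A else B) \<in> sigma_fin_sets M"
    using assms by (intro sigma_fin_sets_UN) auto
  moreover have "(\<Union>n::nat. if n = 0 then A else B) = A \<union> B" by auto
  ultimately show ?thesis by simp
qed

lemma sigma_fin_sets_Diff:
  "A \<in> sigma_fin_sets M \<Longrightarrow> B \<in> sets M \<Longrightarrow> A - B \<in> sigma_fin_sets M"
  using sigma_fin_sets_subset sigma_fin_sets_sets by (metis Diff_subset sets.Diff)

lemma ring_of_sets_sigma_fin_sets: "ring_of_sets (space M) (sigma_fin_sets M)"
  by (rule ring_of_setsI)
    (auto simp: sigma_fin_sets_empty sigma_fin_sets_Un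
      intro: sigma_fin_sets_Diff dest: sigma_fin_sets_sets sets.sets_into_space)

lemma sigma_co_sets_sets: "A \<in> sigma_co_sets M \<Longrightarrow> A \<in> sets M"
  by (auto simp: sigma_co_sets_def dest: sigma_fin_sets_sets)

lemma sigma_algebra_sigma_co_sets: "sigma_algebra (space M) (sigma_co_sets M)"
  unfolding sigma_algebra_iff2
proof (intro conjI ballI allI impI)
  show "sigma_co_sets M \<subseteq> Pow (space M)"
    using sigma_co_sets_sets sets.sets_into_space by fastforce
  show "{} \<in> sigma_co_sets M" by (simp add: sigma_co_sets_def sigma_fin_sets_empty)
next
  fix A assume "A \<in> sigma_co_sets M"
  then consider "A \<in> sigma_fin_sets M"
    | C where "C \<in> sigma_fin_sets M" "A = space M - C"
    by (auto simp: sigma_co_sets_def)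
  then show "space M - A \<in> sigma_co_sets M"
  proof cases
    case 1
    then show ?thesis unfolding sigma_co_sets_def by blast
  next
    case 2
    have "C \<subseteq> space M" by (rule sets.sets_into_space[OF sigma_fin_sets_sets[OF 2(1)]])
    then have "space M - A = C" using 2(2) by blast
    then show ?thesis using 2(1) by (simp add: sigma_co_sets_def)
  qed
next
  fix A :: "nat \<Rightarrow> 'a set" assume A: "range A \<subseteq> sigma_co_sets M"
  show "(\<Union>i. A i) \<in> sigma_co_sets M"
  proof (cases "\<forall>i. A i \<in> sigma_fin_sets M")
    case True
    then show ?thesis by (simp add: sigma_co_sets_def sigma_fin_sets_UN)
  next
    case False
    then obtain i C where C: "C \<in> sigma_fin_sets M" "A i = space M - C"
      using A by (auto simp: sigma_co_sets_def image_subset_iff)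
    have s: "A j \<in> sets M" for j using A sigma_co_sets_sets by blast
    have "space M - (\<Union>i. A i) \<in> sigma_fin_sets M"
      by (rule sigma_fin_sets_subset[OF C(1)]) (use s C(2) in auto)
    moreover have "(\<Union>i. A i) = space M - (space M - (\<Union>i. A i))"
      using s sets.sets_into_space by fastforce
    ultimately show ?thesis unfolding sigma_co_sets_def by blast
  qed
qed

lemma ess_subset_iff_AE:
  assumes "E \<in> sets M" "F \<in> sets M"
  shows "ess_subset M E F \<longleftrightarrow> (AE x in M. x \<in> E \<longrightarrow> x \<in> F)"
proof -
  have "ess_subset M E F \<longleftrightarrow> E - F \<in> null_sets M"
    using assms by (auto simp: ess_subset_def null_sets_def)
  also have "\<dots> \<longleftrightarrow> (AE x in M. x \<notin> E - F)"
    using assms by (intro AE_iff_null_sets) auto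
  finally show ?thesis by simp
qed

lemma ess_eq_iff_AE:
  assumes "E \<in> sets M" "F \<in> sets M"
  shows "ess_eq M E F \<longleftrightarrow> (AE x in M. x \<in> E \<longleftrightarrow> x \<in> F)"
  unfolding ess_eq_def ess_subset_iff_AE[OF assms] ess_subset_iff_AE[OF assms(2,1)]
  by (auto simp flip: AE_conj_iff elim: eventually_mono)

lemma sets_transport: "sets (transport M N \<Lambda>) = sigma_co_sets N"
  and space_transport: "space (transport M N \<Lambda>) = space N"
proof -
  interpret sigma_algebra "space N" "sigma_co_sets N" by (rule sigma_algebra_sigma_co_sets)
  show "sets (transport M N \<Lambda>) = sigma_co_sets N" "space (transport M N \<Lambda>) = space N"
    by (simp_all add: transport_def)
qed

context
  fixes M :: "'a measure" and N :: "'b measure" and \<Lambda>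
  assumes iso: "regular_set_iso M N (sigma_fin_sets M) (sigma_fin_sets N) \<Lambda>"
begin

private lemma \<Lambda>_in: "A \<in> sigma_fin_sets M \<Longrightarrow> \<Lambda> A \<in> sigma_fin_sets N"
  using iso by (auto simp: regular_set_iso_def)

private lemma \<Lambda>_le_iff:
  assumes "A \<in> sigma_fin_sets M" "B \<in> sigma_fin_sets M"
  shows "ess_subset N (\<Lambda> A) (\<Lambda> B) \<longleftrightarrow> ess_subset M A B"
proof -
  have D: "A - B \<in> sigma_fin_sets M"
    using assms by (blast intro: sigma_fin_sets_Diff sigma_fin_sets_sets)
  note s = \<Lambda>_in[OF assms(1), THEN sigma_fin_sets_sets]
    \<Lambda>_in[OF assms(2), THEN sigma_fin_sets_sets] \<Lambda>_in[OF D, THEN sigma_fin_sets_sets]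
  have "ess_eq N (\<Lambda> (A - B)) (\<Lambda> A - \<Lambda> B)" using iso assms by (auto simp: regular_set_iso_def)
  then have *: "AE x in N. x \<in> \<Lambda> (A - B) \<longleftrightarrow> x \<in> \<Lambda> A - \<Lambda> B"
    using s by (subst (asm) ess_eq_iff_AE) auto
  have "ess_subset N (\<Lambda> A) (\<Lambda> B) \<longleftrightarrow> (AE x in N. x \<in> \<Lambda> A \<longrightarrow> x \<in> \<Lambda> B)"
    by (rule ess_subset_iff_AE) (use s in auto)
  also have "\<dots> \<longleftrightarrow> (AE x in N. x \<in> \<Lambda> (A - B) \<longleftrightarrow> x \<in> {})"
    using * by (intro iffI; elim AE_mp) (auto intro!: AE_I2)
  also have "\<dots> \<longleftrightarrow> ess_eq N (\<Lambda> (A - B)) {}" by (rule ess_eq_iff_AE[symmetric]) (use s in auto)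
  also have "\<dots> \<longleftrightarrow> ess_eq M (A - B) {}" using iso D by (auto simp: regular_set_iso_def)
  also have "\<dots> \<longleftrightarrow> ess_subset M A B" by (simp add: ess_eq_def ess_subset_def)
  finally show ?thesis .
qed

private lemma \<Lambda>_eq_iff:
  assumes "A \<in> sigma_fin_sets M" "B \<in> sigma_fin_sets M"
  shows "ess_eq N (\<Lambda> A) (\<Lambda> B) \<longleftrightarrow> ess_eq M A B"
  using assms by (simp add: ess_eq_def \<Lambda>_le_iff)

private lemma chosen_eq:
  assumes A: "A \<in> sigma_fin_sets M" and B: "B \<in> sigma_fin_sets N" and eq: "ess_eq N (\<Lambda> A) B"
  shows "emeasure M (SOME A. A \<in> sigma_fin_sets M \<and> ess_eq N (\<Lambda> A) B) = emeasure M A"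
proof -
  define C where "C = (SOME A. A \<in> sigma_fin_sets M \<and> ess_eq N (\<Lambda> A) B)"
  have C: "C \<in> sigma_fin_sets M" "ess_eq N (\<Lambda> C) B"
    using someI[of "\<lambda>A. A \<in> sigma_fin_sets M \<and> ess_eq N (\<Lambda> A) B"] A eq unfolding C_def by auto
  note s = \<Lambda>_in[OF A, THEN sigma_fin_sets_sets] \<Lambda>_in[OF C(1), THEN sigma_fin_sets_sets]
    sigma_fin_sets_sets[OF B]
  have "AE x in N. x \<in> \<Lambda> A \<longleftrightarrow> x \<in> B" "AE x in N. x \<in> \<Lambda> C \<longleftrightarrow> x \<in> B"
    using eq C(2) s by (simp_all add: ess_eq_iff_AE)
  then have "AE x in N. x \<in> \<Lambda> A \<longleftrightarrow> x \<in> \<Lambda> C" by eventually_elim auto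
  then have "ess_eq N (\<Lambda> A) (\<Lambda> C)" using s by (simp add: ess_eq_iff_AE)
  then have "ess_eq M A C" using A C(1) by (simp add: \<Lambda>_eq_iff)
  then have "AE x in M. x \<in> A \<longleftrightarrow> x \<in> C"
    using A C(1) by (simp add: ess_eq_iff_AE sigma_fin_sets_sets)
  then show ?thesis unfolding C_def[symmetric]
    using A C(1) by (intro emeasure_eq_AE) (auto simp: sigma_fin_sets_sets)
qed

private lemma transport_measure:
  defines "m \<equiv> (\<lambda>B. if B \<in> sigma_fin_sets N
          then emeasure M (SOME A. A \<in> sigma_fin_sets M \<and> ess_eq N (\<Lambda> A) B) else \<infinity>)"
  shows "countably_additive (sigma_co_sets N) m" "positive (sigma_co_sets N) m"
proof -
  have e: "ess_eq N (\<Lambda> {}) {}"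
    using iso by (auto simp: regular_set_iso_def sigma_fin_sets_empty ess_eq_def ess_subset_def)
  show "positive (sigma_co_sets N) m"
    using chosen_eq[OF sigma_fin_sets_empty sigma_fin_sets_empty e]
    by (simp add: positive_def m_def sigma_fin_sets_empty)
  show "countably_additive (sigma_co_sets N) m"
  proof (rule countably_additiveI)
    fix B :: "nat \<Rightarrow> 'b set"
    assume B: "range B \<subseteq> sigma_co_sets N" "disjoint_family B" "\<Union> (range B) \<in> sigma_co_sets N"
    show "(\<Sum>i. m (B i)) = m (\<Union> (range B))"
    proof (cases "\<forall>i. B i \<in> sigma_fin_sets N")
      case False
      then obtain i where i: "B i \<notin> sigma_fin_sets N" by blast
      have "\<Union> (range B) \<notin> sigma_fin_sets N"
        using i B(1) sigma_fin_sets_subset[of "\<Union> (range B)" N "B i"] sigma_co_sets_sets by blast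
      moreover have "m (B i) \<le> (\<Sum>i. m (B i))"
        using sum_le_suminf[of "\<lambda>i. m (B i)" "{i}"] by auto
      ultimately show ?thesis using i by (simp add: m_def top_unique)
    next
      case True
      then have U: "(\<Union>i. B i) \<in> sigma_fin_sets N" by (intro sigma_fin_sets_UN) auto
      have "\<forall>i. \<exists>A\<in>sigma_fin_sets M. ess_eq N (\<Lambda> A) (B i)"
        using True iso by (auto simp: regular_set_iso_def)
      then obtain A where A: "\<And>i. A i \<in> sigma_fin_sets M" "\<And>i. ess_eq N (\<Lambda> (A i)) (B i)" by metis
      obtain C where C: "C \<in> sigma_fin_sets M" "ess_eq N (\<Lambda> C) (\<Union>i. B i)"
        using U iso unfolding regular_set_iso_def by blast
      have UA: "(\<Union>i. A i) \<in> sigma_fin_sets M" using A(1) by (rule sigma_fin_sets_UN)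
      note sM = A(1)[THEN sigma_fin_sets_sets] C(1)[THEN sigma_fin_sets_sets] UA[THEN sigma_fin_sets_sets]
      note sN = \<Lambda>_in[OF A(1), THEN sigma_fin_sets_sets] \<Lambda>_in[OF C(1), THEN sigma_fin_sets_sets]
        \<Lambda>_in[OF UA, THEN sigma_fin_sets_sets] True[rule_format, THEN sigma_fin_sets_sets]
        U[THEN sigma_fin_sets_sets]
      have AB: "AE x in N. x \<in> \<Lambda> (A i) \<longleftrightarrow> x \<in> B i" for i
        using A(2)[of i] sN by (simp add: ess_eq_iff_AE)
      have CB: "AE x in N. x \<in> \<Lambda> C \<longleftrightarrow> x \<in> (\<Union>i. B i)"
        using C(2) sN by (simp add: ess_eq_iff_AE)
      have AU: "AE x in N. x \<in> \<Lambda> (A i) \<longrightarrow> x \<in> \<Lambda> (\<Union>i. A i)" for i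
      proof -
        have "ess_subset M (A i) (\<Union>i. A i)" using sM by (subst ess_subset_iff_AE) auto
        then show ?thesis using \<Lambda>_le_iff[OF A(1) UA] sN by (simp add: ess_subset_iff_AE)
      qed
      have "ess_subset M (A i) C" for i
      proof -
        have "AE x in N. x \<in> \<Lambda> (A i) \<longrightarrow> x \<in> \<Lambda> C" using AB[of i] CB by eventually_elim auto
        then show ?thesis using \<Lambda>_le_iff[OF A(1) C(1)] sN by (simp add: ess_subset_iff_AE)
      qed
      then have "\<And>i. AE x in M. x \<in> A i \<longrightarrow> x \<in> C" using sM by (simp add: ess_subset_iff_AE)
      then have "AE x in M. \<forall>i. x \<in> A i \<longrightarrow> x \<in> C" by (subst AE_all_countable) blast
      then have "AE x in M. x \<in> (\<Union>i. A i) \<longrightarrow> x \<in> C" by eventually_elim auto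
      then have "ess_subset M (\<Union>i. A i) C" using sM by (simp add: ess_subset_iff_AE)
      then have UC: "AE x in N. x \<in> \<Lambda> (\<Union>i. A i) \<longrightarrow> x \<in> \<Lambda> C"
        using \<Lambda>_le_iff[OF UA C(1)] sN by (simp add: ess_subset_iff_AE)
      have "AE x in N. \<forall>i. (x \<in> \<Lambda> (A i) \<longleftrightarrow> x \<in> B i) \<and> (x \<in> \<Lambda> (A i) \<longrightarrow> x \<in> \<Lambda> (\<Union>i. A i))"
        using AB AU by (subst AE_all_countable) (auto intro: AE_conjI)
      then have "AE x in N. x \<in> \<Lambda> (\<Union>i. A i) \<longleftrightarrow> x \<in> (\<Union>i. B i)"
        using CB UC by eventually_elim auto
      then have "ess_eq N (\<Lambda> (\<Union>i. A i)) (\<Union>i. B i)" using sN by (simp add: ess_eq_iff_AE)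
      then have mU: "m (\<Union>i. B i) = emeasure M (\<Union>i. A i)"
        using chosen_eq[OF UA U] U by (simp add: m_def)
      have mB: "m (B i) = emeasure M (A i)" for i
        using chosen_eq[OF A(1) True[rule_format] A(2)] True by (simp add: m_def)
      have dis: "AE x in M. x \<in> A i \<longrightarrow> x \<notin> A j" if "i \<noteq> j" for i j
      proof -
        have D: "A i - A j \<in> sigma_fin_sets M" using A(1) sM(1) by (rule sigma_fin_sets_Diff)
        have "ess_eq N (\<Lambda> (A i - A j)) (\<Lambda> (A i) - \<Lambda> (A j))"
          using iso A(1) by (auto simp: regular_set_iso_def)
        then have "AE x in N. x \<in> \<Lambda> (A i - A j) \<longleftrightarrow> x \<in> \<Lambda> (A i) - \<Lambda> (A j)"
          using sN \<Lambda>_in[OF D, THEN sigma_fin_sets_sets] by (subst (asm) ess_eq_iff_AE) auto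
        then have "AE x in N. x \<in> \<Lambda> (A i) \<longrightarrow> x \<in> \<Lambda> (A i - A j)"
          using AB[of i] AB[of j]
        proof eventually_elim
          case (elim x)
          then show ?case using B(2) that by (auto simp: disjoint_family_on_def)
        qed
        then have "ess_subset M (A i) (A i - A j)"
          using sN \<Lambda>_in[OF D, THEN sigma_fin_sets_sets] \<Lambda>_le_iff[OF A(1) D]
          by (simp add: ess_subset_iff_AE)
        then have "AE x in M. x \<in> A i \<longrightarrow> x \<in> A i - A j"
          using sM by (subst (asm) ess_subset_iff_AE) auto
        then show ?thesis by eventually_elim auto
      qed
      have "emeasure M (A i) = emeasure M (disjointed A i)" for i
      proof (rule emeasure_eq_AE)
        have "AE x in M. \<forall>j\<in>{..<i}. x \<in> A i \<longrightarrow> x \<notin> A j"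
          using dis by (intro AE_ball_countable') auto
        then show "AE x in M. x \<in> A i \<longleftrightarrow> x \<in> disjointed A i"
          by eventually_elim (auto simp: disjointed_def)
      qed (use sM in \<open>auto simp: disjointed_def\<close>)
      then have "(\<Sum>i. emeasure M (A i)) = (\<Sum>i. emeasure M (disjointed A i))" by simp
      also have "\<dots> = emeasure M (\<Union>i. disjointed A i)"
        by (intro suminf_emeasure disjoint_family_disjointed) (use sM in \<open>auto simp: disjointed_def\<close>)
      finally show ?thesis by (simp add: mB mU UN_disjointed_eq)
    qed
  qed
qed

lemma emeasure_transport:
  assumes "A \<in> sigma_fin_sets M" "B \<in> sigma_fin_sets N" "ess_eq N (\<Lambda> A) B"
  shows "emeasure (transport M N \<Lambda>) B = emeasure M A"
proof -
  interpret sigma_algebra "space N" "sigma_co_sets N" by (rule sigma_algebra_sigma_co_sets)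
  show ?thesis
    unfolding transport_def
    by (subst emeasure_measure_of_sigma)
      (use transport_measure sigma_algebra_sigma_co_sets assms chosen_eq
        in \<open>auto simp: sigma_co_sets_def\<close>)
qed

lemma emeasure_transport_infinite:
  assumes "B \<in> sigma_co_sets N" "B \<notin> sigma_fin_sets N"
  shows "emeasure (transport M N \<Lambda>) B = \<infinity>"
  unfolding transport_def
  by (subst emeasure_measure_of_sigma)
    (use transport_measure sigma_algebra_sigma_co_sets assms in auto)

end

end

theory Submission
  imports Defs
begin

text \<open>Two unit vectors \<open>f, g \<ge> 0\<close> satisfy \<open>\<parallel>f - g\<parallel>\<^sup>p \<le> 2\<close>, with equality exactly if they are
  disjoint. Hence \<open>\<Phi>\<close> preserves disjointness in both directions, so it induces an order isomorphism
  \<open>\<Lambda>\<close> between the supports, that is, between the \<open>\<sigma>\<close>-finite sets modulo null sets. The distance from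
  \<open>f\<close> to the unit vectors supported in \<open>A\<close> is a strictly decreasing function of the mass of \<open>f\<^sup>p\<close> on
  \<open>A\<close>; therefore \<open>f\<^sup>p\<close> has the same mass on \<open>A\<close> as \<open>(\<Phi> f)\<^sup>p\<close> on \<open>\<Lambda> A\<close>. This determines \<open>\<Phi> f\<close>, and
  it exhibits the transported measure locally as \<open>\<nu>\<close> with a density \<open>w\<close>. Transporting functions along
  \<open>\<Lambda>\<close> and multiplying by \<open>w powr (1 / p)\<close> is then a linear isometric order isomorphism extending \<open>\<Phi>\<close>.
  If \<open>\<nu>\<close> is localizable, essential suprema glue the local densities together, and extend \<open>\<Lambda>\<close> to
  all measurable sets when \<open>\<mu>\<close> is localizable as well.\<close>

section \<open>Function classes\<close>

text \<open>Neither measure is assumed \<sigma>-finite, and no point map need stand behind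
  \<Lambda>. Functions are therefore moved by their level sets, which works because a function in
  L^p lives on a \<sigma>-finite set and is determined by countably many level sets. For the same
  reason the densities form a family indexed by the sets \<open>E\<close>, which in general does not
  come from a single function. If \<open>f\<close> has mass \<open>s > 0\<close> on
  \<open>A\<close>, its nearest unit vector supported in \<open>A\<close> is the normalised
  restriction of \<open>f\<close>: it lies at distance 1 - s^(1/p) from the restriction, and the
  part of \<open>f\<close> off \<open>A\<close> adds 1 - s to the p-th power of the distance. That
  nothing lies closer follows from convexity of x^p, where \<open>1 \<le> p\<close> enters. Weighted
  transport is used twice: with the densities found from \<Phi> it extends \<Phi>, and with weight 1
  into the transported measure it is the induced isomorphism. The localizable case concerns every
  representing \<Lambda>, not only the one constructed here. There the densities are recovered from
  the formula for \<Phi> by inserting normalised indicators.\<close>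

lemma ae_class_eq_iff:
  assumes "f \<in> borel_measurable M" "g \<in> borel_measurable M"
  shows "ae_class M f = ae_class M g \<longleftrightarrow> (AE x in M. f x = g x)"
proof
  assume "ae_class M f = ae_class M g"
  moreover have "f \<in> ae_class M f" using assms by (simp add: ae_class_def)
  ultimately show "AE x in M. f x = g x" by (simp add: ae_class_def)
next
  assume *: "AE x in M. f x = g x"
  have "(AE x in M. h x = f x) \<longleftrightarrow> (AE x in M. h x = g x)" for h
    using * by (auto)
  then show "ae_class M f = ae_class M g" by (simp add: ae_class_def)
qed

text \<open>The p-th power of the norm, with values in \<open>ennreal\<close> so that estimates need
  no integrability hypotheses; membership in L^p becomes finiteness.\<close>

definition pint :: "real \<Rightarrow> 'a measure \<Rightarrow> ('a \<Rightarrow> complex) \<Rightarrow> ennreal" where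
  "pint p M f = (\<integral>\<^sup>+x. ennreal (cmod (f x) powr p) \<partial>M)"

lemma pint_cong_AE: "AE x in M. f x = g x \<Longrightarrow> pint p M f = pint p M g"
  unfolding pint_def by (rule nn_integral_cong_AE) auto

lemma pint_rep [simp]:
  assumes "f \<in> borel_measurable M"
  shows "pint p M (rep (ae_class M f)) = pint p M f"
  by (rule pint_cong_AE) (rule rep_ae_class[OF assms])

lemma integrable_iff_pint:
  assumes "f \<in> borel_measurable M"
  shows "integrable M (\<lambda>x. cmod (f x) powr p) \<longleftrightarrow> pint p M f < \<infinity>"
  using assms by (simp add: integrable_iff_bounded pint_def)

lemma Lp_iff_rep:
  "u \<in> Lp p M \<longleftrightarrow> rep u \<in> borel_measurable M \<and> pint p M (rep u) < \<infinity> \<and> u = ae_class M (rep u)"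
proof
  assume "u \<in> Lp p M"
  then obtain f where f: "f \<in> borel_measurable M" "pint p M f < \<infinity>" "u = ae_class M f"
    by (auto simp: Lp_def integrable_iff_pint)
  have "u = ae_class M (rep u)"
    unfolding f(3) using f(1) rep_ae_class[OF f(1)] by (subst ae_class_eq_iff) (auto)
  then show "rep u \<in> borel_measurable M \<and> pint p M (rep u) < \<infinity> \<and> u = ae_class M (rep u)"
    using f rep_ae_class[OF f(1)] by auto
next
  assume "rep u \<in> borel_measurable M \<and> pint p M (rep u) < \<infinity> \<and> u = ae_class M (rep u)"
  then show "u \<in> Lp p M" unfolding Lp_def
    by (intro image_eqI[of _ _ "rep u"]) (auto simp: integrable_iff_pint)
qed

lemma LpD:
  assumes "u \<in> Lp p M"
  shows "rep u \<in> borel_measurable M" "pint p M (rep u) < \<infinity>" "ae_class M (rep u) = u"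
  using assms Lp_iff_rep[of u p M] by auto

lemma ae_class_in_Lp_iff:
  assumes "f \<in> borel_measurable M"
  shows "ae_class M f \<in> Lp p M \<longleftrightarrow> pint p M f < \<infinity>"
proof
  assume "ae_class M f \<in> Lp p M"
  then show "pint p M f < \<infinity>" using LpD(2)[of "ae_class M f" p M] assms by simp
next
  assume "pint p M f < \<infinity>"
  then show "ae_class M f \<in> Lp p M" using assms by (auto simp: Lp_def integrable_iff_pint)
qed

lemma Lp_norm_ae_class:
  assumes "f \<in> borel_measurable M"
  shows "Lp_norm p M (ae_class M f) = enn2real (pint p M f) powr (1 / p)"
proof -
  note [measurable] = rep_ae_class(1)[OF assms]
  have "(\<integral>x. cmod (rep (ae_class M f) x) powr p \<partial>M) = enn2real (pint p M (rep (ae_class M f)))"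
    unfolding pint_def by (rule integral_eq_nn_integral) auto
  then show ?thesis using assms by (simp add: Lp_norm_def)
qed

lemma ae_class_in_cone_iff:
  assumes "f \<in> borel_measurable M"
  shows "ae_class M f \<in> Lp_cone p M \<longleftrightarrow> pint p M f < \<infinity> \<and> (AE x in M. f x \<in> \<real>\<^sub>\<ge>\<^sub>0)"
proof -
  have "(AE x in M. rep (ae_class M f) x \<in> \<real>\<^sub>\<ge>\<^sub>0) \<longleftrightarrow> (AE x in M. f x \<in> \<real>\<^sub>\<ge>\<^sub>0)"
    using rep_ae_class(2)[OF assms] by (auto)
  then show ?thesis using ae_class_in_Lp_iff[OF assms] by (simp add: Lp_cone_def)
qed

lemma ae_class_in_sphere_iff:
  assumes "f \<in> borel_measurable M" "p > 0"
  shows "ae_class M f \<in> Lp_pos_sphere p M \<longleftrightarrow> pint p M f = 1 \<and> (AE x in M. f x \<in> \<real>\<^sub>\<ge>\<^sub>0)"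
proof -
  have "a < \<infinity> \<and> enn2real a powr (1 / p) = 1 \<longleftrightarrow> a = 1" for a :: ennreal
  proof (cases a)
    case (real r)
    have "r powr (1 / p) = 1 \<longleftrightarrow> r = 1"
    proof
      assume *: "r powr (1 / p) = 1"
      have "(r powr (1 / p)) powr p = r" using real assms(2) by (simp add: powr_powr)
      then show "r = 1" unfolding * by simp
    qed simp
    then show ?thesis using real by simp
  qed auto
  then show ?thesis
    using ae_class_in_cone_iff[OF assms(1), of p] Lp_norm_ae_class[OF assms(1), of p]
    by (auto simp: Lp_pos_sphere_def)
qed

lemma Lp_add_ae_class:
  assumes [measurable]: "f \<in> borel_measurable M" "g \<in> borel_measurable M"
  shows "Lp_add M (ae_class M f) (ae_class M g) = ae_class M (\<lambda>x. f x + g x)"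
  unfolding Lp_add_def
  using rep_ae_class[OF assms(1)] rep_ae_class[OF assms(2)]
  by (subst ae_class_eq_iff) (auto)

lemma Lp_scale_ae_class:
  assumes [measurable]: "f \<in> borel_measurable M"
  shows "Lp_scale M c (ae_class M f) = ae_class M (\<lambda>x. c * f x)"
  unfolding Lp_scale_def
  using rep_ae_class[OF assms(1)] by (subst ae_class_eq_iff) (auto)

lemma cone_subset_Lp: "Lp_cone p M \<subseteq> Lp p M"
  and sphere_subset_cone: "Lp_pos_sphere p M \<subseteq> Lp_cone p M"
  by (auto simp: Lp_cone_def Lp_pos_sphere_def)

lemma sphereD:
  assumes "u \<in> Lp_pos_sphere p M" "p > 0"
  shows "rep u \<in> borel_measurable M" "pint p M (rep u) = 1" "AE x in M. rep u x \<in> \<real>\<^sub>\<ge>\<^sub>0"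
    "ae_class M (rep u) = u" "u \<in> Lp p M"
proof -
  show u: "u \<in> Lp p M" using assms cone_subset_Lp sphere_subset_cone by blast
  show m: "rep u \<in> borel_measurable M" and e: "ae_class M (rep u) = u" using LpD[OF u] by auto
  show "pint p M (rep u) = 1" "AE x in M. rep u x \<in> \<real>\<^sub>\<ge>\<^sub>0"
    using ae_class_in_sphere_iff[OF m assms(2)] assms(1) e by auto
qed

text \<open>A sum is at most twice the maximum. The crude constant suffices for closure of L^p under
  sums and for passing to limits.\<close>

lemma powr_add_le:
  fixes a b p :: real
  assumes "0 \<le> a" "0 \<le> b" "0 < p"
  shows "(a + b) powr p \<le> 2 powr p * (a powr p + b powr p)"
proof -
  have "(a + b) powr p \<le> (2 * max a b) powr p" using assms by (intro powr_mono2) auto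
  also have "\<dots> = 2 powr p * (max a b) powr p" using assms by (simp add: powr_mult)
  also have "\<dots> \<le> 2 powr p * (a powr p + b powr p)"
    by (intro mult_left_mono) (auto simp: max_def)
  finally show ?thesis .
qed

lemma pint_add_le:
  assumes [measurable]: "f \<in> borel_measurable M" "g \<in> borel_measurable M" and p: "p > 0"
  shows "pint p M (\<lambda>x. f x + g x) \<le> ennreal (2 powr p) * (pint p M f + pint p M g)"
proof -
  have "cmod (f x + g x) powr p \<le> 2 powr p * (cmod (f x) powr p + cmod (g x) powr p)" for x
  proof -
    have "cmod (f x + g x) powr p \<le> (cmod (f x) + cmod (g x)) powr p"
      using p by (intro powr_mono2 norm_triangle_ineq) auto
    also have "\<dots> \<le> 2 powr p * (cmod (f x) powr p + cmod (g x) powr p)"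
      by (rule powr_add_le) (use p in auto)
    finally show ?thesis .
  qed
  then have "pint p M (\<lambda>x. f x + g x)
      \<le> (\<integral>\<^sup>+x. ennreal (2 powr p) * (ennreal (cmod (f x) powr p) + ennreal (cmod (g x) powr p)) \<partial>M)"
    unfolding pint_def
    by (intro nn_integral_mono) (simp flip: ennreal_plus ennreal_mult add: ennreal_leI)
  also have "\<dots> = ennreal (2 powr p) * (pint p M f + pint p M g)"
    unfolding pint_def by (simp add: nn_integral_cmult nn_integral_add)
  finally show ?thesis .
qed

lemma pint_scale:
  assumes [measurable]: "f \<in> borel_measurable M"
  shows "pint p M (\<lambda>x. c * f x) = ennreal (cmod c powr p) * pint p M f"
  unfolding pint_def by (simp add: norm_mult powr_mult ennreal_mult' nn_integral_cmult)

lemma pint_diff_le: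
  assumes [measurable]: "f \<in> borel_measurable M" "g \<in> borel_measurable M" and p: "p > 0"
  shows "pint p M (\<lambda>x. f x - g x) \<le> ennreal (2 powr p) * (pint p M f + pint p M g)"
  using pint_add_le[of f M "\<lambda>x. - g x" p] p by (simp add: pint_def)

lemma Lp_add_closed:
  assumes "u \<in> Lp p M" "v \<in> Lp p M" "p > 0"
  shows "Lp_add M u v \<in> Lp p M"
proof -
  note u = LpD[OF assms(1)] and v = LpD[OF assms(2)]
  have "pint p M (\<lambda>x. rep u x + rep v x) < \<infinity>"
    by (rule le_less_trans[OF pint_add_le[OF u(1) v(1) assms(3)]])
      (use u(2) v(2) in \<open>simp add: ennreal_mult_less_top\<close>)
  then show ?thesis
    unfolding Lp_add_def using u(1) v(1) by (subst ae_class_in_Lp_iff) auto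
qed

lemma Lp_scale_closed:
  assumes "u \<in> Lp p M"
  shows "Lp_scale M c u \<in> Lp p M"
proof -
  note u = LpD[OF assms(1)]
  have "pint p M (\<lambda>x. c * rep u x) < \<infinity>"
    using pint_scale[OF u(1)] u(2) by (simp add: ennreal_mult_less_top)
  then show ?thesis
    unfolding Lp_scale_def using u(1) by (subst ae_class_in_Lp_iff) auto
qed

lemma pint_eq_0_iff:
  assumes [measurable]: "f \<in> borel_measurable M"
  shows "pint p M f = 0 \<longleftrightarrow> (AE x in M. f x = 0)"
  unfolding pint_def by (subst nn_integral_0_iff_AE) auto

text \<open>By Markov's inequality the norm to the power \<open>p\<close> is at least 1/(n+1) only
  on a set of finite measure, and these sets exhaust the support. Hence a map defined on
  \<sigma>-finite sets is enough to treat all of L^p.\<close>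

lemma support_sigma_fin:
  fixes f :: "'a \<Rightarrow> 'b :: real_normed_vector"
  assumes [measurable]: "f \<in> borel_measurable M"
    and fin: "(\<integral>\<^sup>+x. ennreal (norm (f x) powr p) \<partial>M) < \<infinity>" and p: "0 < p"
  shows "{x \<in> space M. f x \<noteq> 0} \<in> sigma_fin_sets M"
proof -
  define A where "A n = {x \<in> space M. 1 \<le> ennreal (real (Suc n)) * ennreal (norm (f x) powr p)}" for n
  have "emeasure M (A n) < \<infinity>" for n
  proof -
    have "emeasure M (A n)
        \<le> ennreal (real (Suc n)) * (\<integral>\<^sup>+x. ennreal (norm (f x) powr p) * indicator (space M) x \<partial>M)"
      using nn_integral_Markov_inequality[of "\<lambda>x. ennreal (norm (f x) powr p)" "space M" M "ennreal (real (Suc n))"]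
      by (simp add: A_def)
    also have "(\<integral>\<^sup>+x. ennreal (norm (f x) powr p) * indicator (space M) x \<partial>M) = (\<integral>\<^sup>+x. ennreal (norm (f x) powr p) \<partial>M)"
      by (intro nn_integral_cong) simp
    also have "ennreal (real (Suc n)) * \<dots> < \<infinity>" using fin by (simp add: ennreal_mult_less_top del: of_nat_Suc)
    finally show ?thesis .
  qed
  then have "range A \<subseteq> fin_sets M" by (auto simp: fin_sets_def A_def)
  moreover have "{x \<in> space M. f x \<noteq> 0} = (\<Union>n. A n)"
  proof (intro subset_antisym subsetI)
    fix x assume x: "x \<in> {x \<in> space M. f x \<noteq> 0}"
    then have "0 < norm (f x) powr p" by simp
    then obtain n where "1 / (norm (f x) powr p) < real (Suc n)"
      using reals_Archimedean2 less_trans of_nat_less_iff lessI by metis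
    then have "1 \<le> real (Suc n) * norm (f x) powr p"
      using \<open>0 < norm (f x) powr p\<close> by (simp add: field_simps del: of_nat_Suc)
    then have "x \<in> A n" using x
      by (auto simp: A_def ennreal_mult'[symmetric] simp del: of_nat_Suc)
    then show "x \<in> (\<Union>n. A n)" by blast
  qed (use p in \<open>auto simp: A_def\<close>)
  ultimately show ?thesis unfolding sigma_fin_sets_def by blast
qed

section \<open>Transport of functions along a regular set isomorphism\<close>

text \<open>Provides thresholds: an \<open>ennreal\<close> function is rebuilt from countably many
  superlevel sets, once to transport it along \<Lambda> and once to glue local densities.\<close>

lemma ennreal_dense_sequence: "\<exists>q :: nat \<Rightarrow> ennreal. \<forall>a b. a < b \<longrightarrow> (\<exists>n. a < q n \<and> q n < b)"
proof -
  obtain D :: "ennreal set" where D: "countable D" "\<And>X. open X \<Longrightarrow> X \<noteq> {} \<Longrightarrow> \<exists>d\<in>D. d \<in> X"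
    by (rule countable_dense_setE) blast
  have Dne: "D \<noteq> {}" using D(2)[of UNIV] by auto
  define q where "q = from_nat_into D"
  have "\<exists>n. a < q n \<and> q n < b" if ab: "a < b" for a b
  proof -
    have "{a<..<b} \<noteq> {}" using dense[OF ab] by auto
    then obtain d where d: "d \<in> D" "d \<in> {a<..<b}" using D(2)[OF open_greaterThanLessThan] by blast
    then obtain n where "q n = d" using D(1) Dne unfolding q_def by (metis from_nat_into_to_nat_on)
    then show ?thesis using d(2) by auto
  qed
  then show ?thesis by blast
qed

lemma AE_mem_eq_cong:
  "E \<in> sets M \<Longrightarrow> F \<in> sets M \<Longrightarrow> (AE x in M. x \<in> E \<longleftrightarrow> x \<in> F) \<Longrightarrow>
   (\<integral>\<^sup>+x\<in>E. u x \<partial>M) = (\<integral>\<^sup>+x\<in>F. u x \<partial>M)"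
  by (rule nn_integral_cong_AE) (auto simp: indicator_def)

lemma AE_iff_AE:
  assumes "AE x in M. P x \<longleftrightarrow> Q x"
  shows "(AE x in M. P x) \<longleftrightarrow> (AE x in M. Q x)"
proof
  assume "AE x in M. P x" with assms show "AE x in M. Q x" by eventually_elim auto
next
  assume "AE x in M. Q x" with assms show "AE x in M. P x" by eventually_elim auto
qed

lemma null_sigma_fin: "A \<in> null_sets M \<Longrightarrow> A \<in> sigma_fin_sets M"
  unfolding sigma_fin_sets_def
  by (rule CollectI, rule exI[of _ "\<lambda>_. A"]) (auto simp: fin_sets_def null_sets_def)

lemma fin_sigma_fin: "A \<in> fin_sets M \<Longrightarrow> A \<in> sigma_fin_sets M"
  unfolding sigma_fin_sets_def by (rule CollectI, rule exI[of _ "\<lambda>_. A"]) auto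

lemma sigma_fin_sets_Diff':
  "A \<in> sigma_fin_sets M \<Longrightarrow> B \<in> sigma_fin_sets M \<Longrightarrow> A - B \<in> sigma_fin_sets M"
  by (blast intro: sigma_fin_sets_Diff sigma_fin_sets_sets)

lemma AE_notin:
  "emeasure M A = 0 \<Longrightarrow> A \<in> sets M \<Longrightarrow> AE x in M. x \<notin> A"
  by (rule AE_not_in) (simp add: null_sets_def)

lemma sigma_fin_sets_Int:
  "A \<in> sigma_fin_sets M \<Longrightarrow> B \<in> sets M \<Longrightarrow> A \<inter> B \<in> sigma_fin_sets M"
  by (rule sigma_fin_sets_subset) (auto dest: sigma_fin_sets_sets)

lemma sigma_fin_vimage:
  assumes "E \<in> sigma_fin_sets M" "f \<in> M \<rightarrow>\<^sub>M S" "C \<in> sets S"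
  shows "E \<inter> f -` C \<in> sigma_fin_sets M"
proof -
  have "E \<inter> f -` C = E \<inter> (f -` C \<inter> space M)"
    using sigma_fin_sets_sets[OF assms(1)] sets.sets_into_space by blast
  then show ?thesis using assms(1) measurable_sets[OF assms(2,3)] by (simp add: sigma_fin_sets_Int)
qed

text \<open>The laws of \<Lambda> are restated as a.e. equivalences of membership, so that
  identities modulo null sets combine by \<open>eventually_elim\<close>. The locale is used for
  \<Lambda>, for its inverse, and for \<Lambda> into the transported measure.\<close>

locale set_iso =
  fixes M :: "'a measure" and N :: "'b measure" and \<Lambda> :: "'a set \<Rightarrow> 'b set"
  assumes iso: "regular_set_iso M N (sigma_fin_sets M) (sigma_fin_sets N) \<Lambda>"
begin

lemma \<Lambda>_in: "A \<in> sigma_fin_sets M \<Longrightarrow> \<Lambda> A \<in> sigma_fin_sets N"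
  using iso by (auto simp: regular_set_iso_def)

lemma \<Lambda>_sets: "A \<in> sigma_fin_sets M \<Longrightarrow> \<Lambda> A \<in> sets N"
  by (blast intro: \<Lambda>_in sigma_fin_sets_sets)

lemma \<Lambda>_diff:
  assumes "A \<in> sigma_fin_sets M" "B \<in> sigma_fin_sets M"
  shows "AE y in N. y \<in> \<Lambda> (A - B) \<longleftrightarrow> y \<in> \<Lambda> A \<and> y \<notin> \<Lambda> B"
proof -
  have "A - B \<in> sigma_fin_sets M" using assms by (rule sigma_fin_sets_Diff')
  moreover have "ess_eq N (\<Lambda> (A - B)) (\<Lambda> A - \<Lambda> B)" using iso assms by (auto simp: regular_set_iso_def)
  ultimately show ?thesis using assms \<Lambda>_sets by (simp add: ess_eq_iff_AE)
qed

lemma \<Lambda>_null_iff: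
  assumes "A \<in> sigma_fin_sets M"
  shows "(AE y in N. y \<notin> \<Lambda> A) \<longleftrightarrow> (AE x in M. x \<notin> A)"
proof -
  have "ess_eq N (\<Lambda> A) {} \<longleftrightarrow> ess_eq M A {}" using iso assms by (auto simp: regular_set_iso_def)
  then show ?thesis using \<Lambda>_sets[OF assms] sigma_fin_sets_sets[OF assms]
    by (simp add: ess_eq_iff_AE)
qed

text \<open>Essential inclusion means that the difference is null, and \<Lambda> respects
  differences and preserves and reflects null sets.\<close>

lemma \<Lambda>_le_iff:
  assumes "A \<in> sigma_fin_sets M" "B \<in> sigma_fin_sets M"
  shows "(AE y in N. y \<in> \<Lambda> A \<longrightarrow> y \<in> \<Lambda> B) \<longleftrightarrow> (AE x in M. x \<in> A \<longrightarrow> x \<in> B)"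
proof -
  have "A - B \<in> sigma_fin_sets M" using assms by (rule sigma_fin_sets_Diff')
  moreover have "(AE y in N. y \<in> \<Lambda> A \<longrightarrow> y \<in> \<Lambda> B) \<longleftrightarrow> (AE y in N. y \<notin> \<Lambda> (A - B))"
    by (rule AE_iff_AE) (use \<Lambda>_diff[OF assms] in \<open>eventually_elim, auto\<close>)
  moreover have "(AE x in M. x \<notin> A - B) \<longleftrightarrow> (AE x in M. x \<in> A \<longrightarrow> x \<in> B)"
    by (rule AE_iff_AE) auto
  ultimately show ?thesis using \<Lambda>_null_iff by blast
qed

lemma \<Lambda>_cong:
  assumes "A \<in> sigma_fin_sets M" "B \<in> sigma_fin_sets M" "AE x in M. x \<in> A \<longleftrightarrow> x \<in> B"
  shows "AE y in N. y \<in> \<Lambda> A \<longleftrightarrow> y \<in> \<Lambda> B"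
proof -
  have "AE y in N. y \<in> \<Lambda> A \<longrightarrow> y \<in> \<Lambda> B" "AE y in N. y \<in> \<Lambda> B \<longrightarrow> y \<in> \<Lambda> A"
    using assms by (subst \<Lambda>_le_iff; auto)+
  then show ?thesis by eventually_elim auto
qed

lemma \<Lambda>_mono:
  assumes "A \<in> sigma_fin_sets M" "B \<in> sigma_fin_sets M" "A \<subseteq> B"
  shows "AE y in N. y \<in> \<Lambda> A \<longrightarrow> y \<in> \<Lambda> B"
  using assms by (subst \<Lambda>_le_iff) auto

lemma \<Lambda>_surj:
  assumes "B \<in> sigma_fin_sets N"
  shows "\<exists>A\<in>sigma_fin_sets M. AE y in N. y \<in> \<Lambda> A \<longleftrightarrow> y \<in> B"
proof -
  obtain A where "A \<in> sigma_fin_sets M" "ess_eq N (\<Lambda> A) B"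
    using iso assms unfolding regular_set_iso_def by blast
  then show ?thesis
    using \<Lambda>_sets[of A] assms sigma_fin_sets_sets[of B] by (auto simp: ess_eq_iff_AE)
qed

text \<open>Order reflection puts any preimage of \<open>B\<close> inside \<open>E\<close> up to a
  null set, so it may be cut down to \<open>E\<close>.\<close>

lemma \<Lambda>_surj_sub:
  assumes "B \<in> sigma_fin_sets N" "E \<in> sigma_fin_sets M" "B \<subseteq> \<Lambda> E"
  shows "\<exists>A\<in>sigma_fin_sets M. A \<subseteq> E \<and> (AE y in N. y \<in> \<Lambda> A \<longleftrightarrow> y \<in> B)"
proof -
  obtain A where A: "A \<in> sigma_fin_sets M" "AE y in N. y \<in> \<Lambda> A \<longleftrightarrow> y \<in> B"
    using \<Lambda>_surj[OF assms(1)] by blast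
  have "AE y in N. y \<in> \<Lambda> A \<longrightarrow> y \<in> \<Lambda> E"
    using A(2) by eventually_elim (use assms(3) in auto)
  then have "AE x in M. x \<in> A \<longrightarrow> x \<in> E" using \<Lambda>_le_iff A assms by blast
  then have e: "AE x in M. x \<in> A \<inter> E \<longleftrightarrow> x \<in> A" by eventually_elim auto
  have AE: "A \<inter> E \<in> sigma_fin_sets M"
    using A(1) sigma_fin_sets_sets[OF assms(2)] by (rule sigma_fin_sets_Int)
  have "AE y in N. y \<in> \<Lambda> (A \<inter> E) \<longleftrightarrow> y \<in> B"
    using \<Lambda>_cong[OF AE A(1) e] A(2) by eventually_elim auto
  then show ?thesis using AE by blast
qed

lemma \<Lambda>_inter:
  assumes "A \<in> sigma_fin_sets M" "B \<in> sigma_fin_sets M"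
  shows "AE y in N. y \<in> \<Lambda> (A \<inter> B) \<longleftrightarrow> y \<in> \<Lambda> A \<and> y \<in> \<Lambda> B"
proof -
  have D: "A - B \<in> sigma_fin_sets M" using assms by (rule sigma_fin_sets_Diff')
  have "A \<inter> B = A - (A - B)" by auto
  show ?thesis
    using \<Lambda>_diff[OF assms(1) D, folded \<open>A \<inter> B = A - (A - B)\<close>] \<Lambda>_diff[OF assms]
    by eventually_elim auto
qed

text \<open>The axioms mention differences only. By surjectivity the union of the images is the
  image of some \<open>C\<close>; order reflection puts every \<open>A n\<close>, hence their union,
  below \<open>C\<close>. An order isomorphism thus preserves countable suprema.\<close>

lemma \<Lambda>_UN:
  fixes A :: "nat \<Rightarrow> 'a set"
  assumes A: "\<And>n. A n \<in> sigma_fin_sets M"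
  shows "AE y in N. y \<in> \<Lambda> (\<Union>n. A n) \<longleftrightarrow> (\<exists>n. y \<in> \<Lambda> (A n))"
proof -
  have U: "(\<Union>n. A n) \<in> sigma_fin_sets M" using A by (rule sigma_fin_sets_UN)
  have V: "(\<Union>n. \<Lambda> (A n)) \<in> sigma_fin_sets N" using A by (intro sigma_fin_sets_UN \<Lambda>_in)
  obtain C where C: "C \<in> sigma_fin_sets M" "AE y in N. y \<in> \<Lambda> C \<longleftrightarrow> y \<in> (\<Union>n. \<Lambda> (A n))"
    using \<Lambda>_surj[OF V] by blast
  have "AE x in M. x \<in> A n \<longrightarrow> x \<in> C" for n
  proof -
    have "AE y in N. y \<in> \<Lambda> (A n) \<longrightarrow> y \<in> \<Lambda> C" using C(2) by eventually_elim auto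
    then show ?thesis using \<Lambda>_le_iff A C(1) by blast
  qed
  then have "AE x in M. \<forall>n. x \<in> A n \<longrightarrow> x \<in> C" unfolding AE_all_countable by blast
  then have "AE x in M. x \<in> (\<Union>n. A n) \<longrightarrow> x \<in> C" by eventually_elim auto
  then have "AE y in N. y \<in> \<Lambda> (\<Union>n. A n) \<longrightarrow> y \<in> \<Lambda> C" using \<Lambda>_le_iff U C(1) by blast
  moreover have "AE y in N. \<forall>n. y \<in> \<Lambda> (A n) \<longrightarrow> y \<in> \<Lambda> (\<Union>n. A n)"
    unfolding AE_all_countable using \<Lambda>_mono[OF A U] by blast
  ultimately show ?thesis using C(2) by eventually_elim auto
qed

text \<open>\<open>corr S f g\<close> says that \<open>\<Lambda>\<close> takes level sets of \<open>f\<close> to level sets of \<open>g\<close>. If \<open>\<Lambda>\<close> is induced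
  by a point map \<open>T\<close> from \<open>N\<close> to \<open>M\<close>, this means \<open>g = f \<circ> T\<close> almost everywhere on \<open>\<sigma>\<close>-finite sets.\<close>

definition corr :: "'c measure \<Rightarrow> ('a \<Rightarrow> 'c) \<Rightarrow> ('b \<Rightarrow> 'c) \<Rightarrow> bool" where
  "corr S f g \<longleftrightarrow> f \<in> M \<rightarrow>\<^sub>M S \<and> g \<in> N \<rightarrow>\<^sub>M S \<and>
     (\<forall>E\<in>sigma_fin_sets M. \<forall>C\<in>sets S. AE y in N. y \<in> \<Lambda> (E \<inter> f -` C) \<longleftrightarrow> y \<in> \<Lambda> E \<and> g y \<in> C)"

lemma corrD:
  assumes "corr S f g"
  shows "f \<in> M \<rightarrow>\<^sub>M S" "g \<in> N \<rightarrow>\<^sub>M S"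
    "E \<in> sigma_fin_sets M \<Longrightarrow> C \<in> sets S \<Longrightarrow>
      AE y in N. y \<in> \<Lambda> (E \<inter> f -` C) \<longleftrightarrow> y \<in> \<Lambda> E \<and> g y \<in> C"
  using assms by (auto simp: corr_def)

lemma corr_compose:
  assumes "corr S f g" "h \<in> S \<rightarrow>\<^sub>M S'"
  shows "corr S' (\<lambda>x. h (f x)) (\<lambda>y. h (g y))"
  unfolding corr_def
proof (intro conjI ballI)
  note c = corrD[OF assms(1)]
  show "(\<lambda>x. h (f x)) \<in> M \<rightarrow>\<^sub>M S'" "(\<lambda>y. h (g y)) \<in> N \<rightarrow>\<^sub>M S'"
    using measurable_compose[OF _ assms(2)] c by auto
  fix E C assume E: "E \<in> sigma_fin_sets M" and C: "C \<in> sets S'"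
  have sp: "E \<subseteq> space M" using sigma_fin_sets_sets[OF E] by (rule sets.sets_into_space)
  have "E \<inter> (\<lambda>x. h (f x)) -` C = E \<inter> f -` (h -` C \<inter> space S)"
    using sp measurable_space[OF c(1)] by auto
  show "AE y in N. y \<in> \<Lambda> (E \<inter> (\<lambda>x. h (f x)) -` C) \<longleftrightarrow> y \<in> \<Lambda> E \<and> h (g y) \<in> C"
    using c(3)[OF E measurable_sets[OF assms(2) C]] AE_space unfolding \<open>E \<inter> _ = _\<close>
    by eventually_elim (use measurable_space[OF c(2)] in auto)
qed

text \<open>The value sets \<open>C\<close> for which the equivalence holds form a \<sigma>-algebra,
  because \<Lambda> commutes with differences and countable unions up to null sets.\<close>

lemma corr_generator:
  assumes f: "f \<in> M \<rightarrow>\<^sub>M S" and g: "g \<in> N \<rightarrow>\<^sub>M S" and S: "sets S = sigma_sets (space S) G"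
    and G: "\<And>E C. E \<in> sigma_fin_sets M \<Longrightarrow> C \<in> G \<Longrightarrow>
      AE y in N. y \<in> \<Lambda> (E \<inter> f -` C) \<longleftrightarrow> y \<in> \<Lambda> E \<and> g y \<in> C"
  shows "corr S f g"
  unfolding corr_def
proof (intro conjI ballI f g)
  fix E C assume E: "E \<in> sigma_fin_sets M" and C: "C \<in> sets S"
  have sp: "E \<subseteq> space M" using sigma_fin_sets_sets[OF E] by (rule sets.sets_into_space)
  have V: "E \<inter> f -` C \<in> sigma_fin_sets M" if "C \<in> sigma_sets (space S) G" for C
    using that f E S by (intro sigma_fin_vimage) auto
  from C have "C \<in> sigma_sets (space S) G" by (simp add: S)
  then show "AE y in N. y \<in> \<Lambda> (E \<inter> f -` C) \<longleftrightarrow> y \<in> \<Lambda> E \<and> g y \<in> C"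
  proof induction
    case (Basic C)
    then show ?case using G E by blast
  next
    case Empty
    have "AE y in N. y \<notin> \<Lambda> {}" by (subst \<Lambda>_null_iff) (auto simp: sigma_fin_sets_empty)
    then show ?case by simp
  next
    case (Compl C)
    have "E \<inter> f -` (space S - C) = E - (E \<inter> f -` C)"
      using sp measurable_space[OF f] by auto
    show ?case using Compl.IH \<Lambda>_diff[OF E V[OF Compl.hyps]] AE_space unfolding \<open>E \<inter> _ = _\<close>
      by eventually_elim (use measurable_space[OF g] in auto)
  next
    case (Union C)
    have *: "E \<inter> f -` (\<Union>n. C n) = (\<Union>n. E \<inter> f -` C n)" by auto
    have "AE y in N. \<forall>n. y \<in> \<Lambda> (E \<inter> f -` C n) \<longleftrightarrow> y \<in> \<Lambda> E \<and> g y \<in> C n"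
      using Union.IH unfolding AE_all_countable by blast
    then show ?case using \<Lambda>_UN[of "\<lambda>n. E \<inter> f -` C n", OF V[OF Union.hyps]] unfolding *
      by eventually_elim auto
  qed
qed

text \<open>Rectangles generate the product and reduce to two successive cuts of \<open>E\<close>.
  Followed by \<open>corr_compose\<close>, this transports sums, products and comparisons of
  functions.\<close>

lemma corr_pair:
  assumes "corr S f g" "corr S' f' g'"
  shows "corr (S \<Otimes>\<^sub>M S') (\<lambda>x. (f x, f' x)) (\<lambda>y. (g y, g' y))"
proof (rule corr_generator)
  note c = corrD[OF assms(1)] and c' = corrD[OF assms(2)]
  show "(\<lambda>x. (f x, f' x)) \<in> M \<rightarrow>\<^sub>M S \<Otimes>\<^sub>M S'" "(\<lambda>y. (g y, g' y)) \<in> N \<rightarrow>\<^sub>M S \<Otimes>\<^sub>M S'"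
    using c c' by (auto intro: measurable_Pair)
  show "sets (S \<Otimes>\<^sub>M S') = sigma_sets (space (S \<Otimes>\<^sub>M S')) {A \<times> B | A B. A \<in> sets S \<and> B \<in> sets S'}"
    by (simp add: sets_pair_measure space_pair_measure)
  fix E C assume E: "E \<in> sigma_fin_sets M" and "C \<in> {A \<times> B | A B. A \<in> sets S \<and> B \<in> sets S'}"
  then obtain A B where C: "C = A \<times> B" "A \<in> sets S" "B \<in> sets S'" by blast
  have E': "E \<inter> f -` A \<in> sigma_fin_sets M" by (rule sigma_fin_vimage[OF E c(1) C(2)])
  have "E \<inter> (\<lambda>x. (f x, f' x)) -` C = (E \<inter> f -` A) \<inter> f' -` B" using C(1) by auto
  show "AE y in N. y \<in> \<Lambda> (E \<inter> (\<lambda>x. (f x, f' x)) -` C) \<longleftrightarrow> y \<in> \<Lambda> E \<and> (g y, g' y) \<in> C"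
    using c(3)[OF E C(2)] c'(3)[OF E' C(3)] unfolding \<open>E \<inter> _ = _\<close>
    by eventually_elim (auto simp: C(1))
qed

lemma corr_indicator:
  assumes A: "A \<in> sigma_fin_sets M" "h False \<in> space S" "h True \<in> space S"
  shows "corr S (\<lambda>x. h (x \<in> A)) (\<lambda>y. h (y \<in> \<Lambda> A))"
proof (rule corr_compose[where h = h and S = "count_space UNIV"])
  note [measurable] = \<Lambda>_sets[OF A(1)] sigma_fin_sets_sets[OF A(1)]
  show "corr (count_space UNIV) (\<lambda>x. x \<in> A) (\<lambda>y. y \<in> \<Lambda> A)"
    unfolding corr_def
  proof (intro conjI ballI)
    fix E and C :: "bool set" assume E: "E \<in> sigma_fin_sets M"
    \<comment> \<open>A set of truth values has only four possibilities, and \<Lambda> is known on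
      each of the four resulting sets.\<close>
    have "E \<inter> (\<lambda>x. x \<in> A) -` C = (if True \<in> C then if False \<in> C then E else E \<inter> A
      else if False \<in> C then E - A else {})" (is "_ = ?R")
    proof (intro set_eqI)
      fix x show "x \<in> E \<inter> (\<lambda>x. x \<in> A) -` C \<longleftrightarrow> x \<in> ?R" by (cases "x \<in> A") auto
    qed
    have "AE y in N. y \<notin> \<Lambda> {}" by (subst \<Lambda>_null_iff) (auto simp: sigma_fin_sets_empty)
    then show "AE y in N. y \<in> \<Lambda> (E \<inter> (\<lambda>x. x \<in> A) -` C) \<longleftrightarrow> y \<in> \<Lambda> E \<and> (y \<in> \<Lambda> A) \<in> C"
      using \<Lambda>_inter[OF E A(1)] \<Lambda>_diff[OF E A(1)] unfolding \<open>E \<inter> _ = _\<close>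
    proof eventually_elim
      case (elim y)
      then show ?case by (cases "y \<in> \<Lambda> A") auto
    qed
  qed measurable
  have "h b \<in> space S" for b using A(2,3) by (cases b) auto
  then show "h \<in> count_space UNIV \<rightarrow>\<^sub>M S" by auto
qed

text \<open>The transfer principle for a.e. statements: both sides say that \<open>E\<close> is
  essentially contained in a level set, which \<Lambda> preserves and reflects.\<close>

lemma corr_AE_mem:
  assumes c: "corr S f g" and E: "E \<in> sigma_fin_sets M" and C: "C \<in> sets S"
  shows "(AE y in N. y \<in> \<Lambda> E \<longrightarrow> g y \<in> C) \<longleftrightarrow> (AE x in M. x \<in> E \<longrightarrow> f x \<in> C)"
proof -
  note V = sigma_fin_vimage[OF E corrD(1)[OF c] C]
  have "(AE y in N. y \<in> \<Lambda> E \<longrightarrow> g y \<in> C) \<longleftrightarrow> (AE y in N. y \<in> \<Lambda> E \<longrightarrow> y \<in> \<Lambda> (E \<inter> f -` C))"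
    by (rule AE_iff_AE) (use corrD(3)[OF c E C] in \<open>eventually_elim, auto\<close>)
  also have "\<dots> \<longleftrightarrow> (AE x in M. x \<in> E \<longrightarrow> x \<in> E \<inter> f -` C)" by (rule \<Lambda>_le_iff[OF E V])
  finally show ?thesis by (simp cong: imp_cong)
qed

text \<open>Transfer applied to the pair of functions and to the diagonal, which is measurable in
  the product by second countability.\<close>

lemma corr_unique:
  fixes f :: "'a \<Rightarrow> 'c :: {second_countable_topology, t2_space}"
  assumes "corr borel f g" "corr borel f' g'" and E: "E \<in> sigma_fin_sets M"
    and "AE x in M. x \<in> E \<longrightarrow> f x = f' x"
  shows "AE y in N. y \<in> \<Lambda> E \<longrightarrow> g y = g' y"
proof -
  have C: "{(a, b). a = b} \<in> sets (borel \<Otimes>\<^sub>M borel :: ('c \<times> 'c) measure)"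
  proof -
    have eq: "{(a, b). a = b} = {y :: 'c \<times> 'c. \<exists>x. y = (x, x)}" by auto
    show ?thesis unfolding eq borel_prod by (rule borel_closed[OF closed_diagonal])
  qed
  show ?thesis
    using corr_AE_mem[OF corr_pair[OF assms(1,2)] E C] assms(4) by simp
qed

text \<open>The idea is \<open>f = (SUP n. q n * indicator {x. q n < f x})\<close> for a dense sequence \<open>q\<close>.\<close>

lemma corr_exists_ennreal:
  fixes f :: "'a \<Rightarrow> ennreal"
  assumes f[measurable]: "f \<in> borel_measurable M" and s: "{x \<in> space M. f x \<noteq> 0} \<in> sigma_fin_sets M"
  shows "\<exists>g. corr borel f g"
proof -
  obtain q :: "nat \<Rightarrow> ennreal" where q: "\<And>a b. a < b \<Longrightarrow> \<exists>n. a < q n \<and> q n < b"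
    using ennreal_dense_sequence by blast
  define A where "A n = {x \<in> space M. q n < f x}" for n
  have A: "A n \<in> sigma_fin_sets M" for n
    by (rule sigma_fin_sets_subset[OF s]) (auto simp: A_def)
  note [measurable] = \<Lambda>_sets[OF A]
  define g where "g y = (SUP n. q n * indicator (\<Lambda> (A n)) y)" for y
  have g[measurable]: "g \<in> borel_measurable N" unfolding g_def by measurable
  have gt: "a < g y \<longleftrightarrow> (\<exists>n. a < q n \<and> y \<in> \<Lambda> (A n))" for a y
  proof -
    have "a < q n * indicator (\<Lambda> (A n)) y \<longleftrightarrow> a < q n \<and> y \<in> \<Lambda> (A n)" for n
      by (cases "y \<in> \<Lambda> (A n)") auto
    then show ?thesis by (simp add: g_def less_SUP_iff)
  qed
  have "corr borel f g"
  proof (rule corr_generator[OF f g])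
    show "sets borel = sigma_sets (space borel) (range (greaterThan :: ennreal \<Rightarrow> _))"
      by (simp add: borel_Ioi)
    fix E and C :: "ennreal set" assume E: "E \<in> sigma_fin_sets M" and "C \<in> range greaterThan"
    then obtain a where C: "C = {a<..}" by blast
    have sp: "E \<subseteq> space M" using sigma_fin_sets_sets[OF E] by (rule sets.sets_into_space)
    \<comment> \<open>Replacing unwanted pieces by the empty set keeps the index set all of
      \<open>nat\<close>, as \<open>\<Lambda>_UN\<close> requires.\<close>
    define B where "B n = (if a < q n then E \<inter> A n else {})" for n
    have B: "B n \<in> sigma_fin_sets M" for n
      using sigma_fin_sets_Int[OF E sigma_fin_sets_sets[OF A]] by (simp add: B_def sigma_fin_sets_empty)
    have eq: "E \<inter> f -` C = (\<Union>n. B n)"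
    proof (intro subset_antisym subsetI)
      fix x assume "x \<in> E \<inter> f -` C"
      then show "x \<in> (\<Union>n. B n)" using q[of a "f x"] sp by (auto simp: B_def A_def C)
    next
      fix x assume "x \<in> (\<Union>n. B n)"
      then show "x \<in> E \<inter> f -` C" by (auto simp: B_def A_def C split: if_splits)
    qed
    have "AE y in N. y \<notin> \<Lambda> {}" by (subst \<Lambda>_null_iff) (auto simp: sigma_fin_sets_empty)
    note null = this
    have "AE y in N. y \<in> \<Lambda> (B n) \<longleftrightarrow> a < q n \<and> y \<in> \<Lambda> E \<and> y \<in> \<Lambda> (A n)" for n
      using \<Lambda>_inter[OF E A[of n]] null
    proof eventually_elim
      case (elim y)
      then show ?case by (cases "a < q n") (auto simp: B_def)
    qed
    then have "AE y in N. \<forall>n. y \<in> \<Lambda> (B n) \<longleftrightarrow> a < q n \<and> y \<in> \<Lambda> E \<and> y \<in> \<Lambda> (A n)"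
      unfolding AE_all_countable by blast
    then show "AE y in N. y \<in> \<Lambda> (E \<inter> f -` C) \<longleftrightarrow> y \<in> \<Lambda> E \<and> g y \<in> C"
      using \<Lambda>_UN[of B, OF B] unfolding eq
    proof eventually_elim
      case (elim y)
      have "g y \<in> C \<longleftrightarrow> (\<exists>n. a < q n \<and> y \<in> \<Lambda> (A n))" by (simp add: gt C)
      then show ?case by (simp only: elim(2) elim(1)[rule_format]) auto
    qed
  qed
  then show ?thesis by blast
qed

text \<open>The real and imaginary parts are split into positive and negative parts
  (\<open>ennreal\<close> truncates negative reals to 0), transported separately and recombined by a
  measurable map.\<close>

lemma corr_exists:
  fixes f :: "'a \<Rightarrow> complex"
  assumes f[measurable]: "f \<in> borel_measurable M" and E: "E \<in> sigma_fin_sets M"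
    and f0: "\<And>x. x \<notin> E \<Longrightarrow> f x = 0"
  shows "\<exists>g. corr borel f g \<and> (\<forall>y. y \<notin> \<Lambda> E \<longrightarrow> g y = 0)"
proof -
  have *: "\<exists>g. corr borel (\<lambda>x. ennreal (h (f x))) g"
    if [measurable]: "h \<in> borel_measurable borel" and h0: "h 0 = 0" for h :: "complex \<Rightarrow> real"
  proof (rule corr_exists_ennreal)
    show "{x \<in> space M. ennreal (h (f x)) \<noteq> 0} \<in> sigma_fin_sets M"
    proof (rule sigma_fin_sets_subset[OF E])
      show "{x \<in> space M. ennreal (h (f x)) \<noteq> 0} \<subseteq> E" using f0 h0 by fastforce
    qed measurable
  qed measurable
  obtain a b c d where abcd: "corr borel (\<lambda>x. ennreal (Re (f x))) a" "corr borel (\<lambda>x. ennreal (- Re (f x))) b"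
    "corr borel (\<lambda>x. ennreal (Im (f x))) c" "corr borel (\<lambda>x. ennreal (- Im (f x))) d"
    using *[of Re] *[of "\<lambda>z. - Re z"] *[of Im] *[of "\<lambda>z. - Im z"] by auto
  define H :: "(ennreal \<times> ennreal) \<times> (ennreal \<times> ennreal) \<Rightarrow> complex" where
    "H = (\<lambda>z. of_real (enn2real (fst (fst z)) - enn2real (snd (fst z)))
      + \<i> * of_real (enn2real (fst (snd z)) - enn2real (snd (snd z))))"
  have [measurable]: "H \<in> (borel \<Otimes>\<^sub>M borel) \<Otimes>\<^sub>M (borel \<Otimes>\<^sub>M borel) \<rightarrow>\<^sub>M borel"
    unfolding H_def by measurable
  define g where "g y = H ((a y, b y), (c y, d y))" for y
  have "enn2real (ennreal r) - enn2real (ennreal (- r)) = r" for r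
    by (cases "0 \<le> r") (auto simp: ennreal_neg)
  then have "(\<lambda>x. H ((ennreal (Re (f x)), ennreal (- Re (f x))), (ennreal (Im (f x)), ennreal (- Im (f x))))) = f"
    by (auto simp: H_def complex_eq_iff)
  then have "corr borel f g"
    using corr_compose[OF corr_pair[OF corr_pair[OF abcd(1,2)] corr_pair[OF abcd(3,4)]], of H borel]
    by (simp add: g_def[abs_def])
  \<comment> \<open>Multiplying by the indicator of \<open>E\<close> leaves \<open>f\<close>
    unchanged but forces the image to vanish everywhere off \<open>\<Lambda> E\<close>.\<close>
  then have "corr borel (\<lambda>x. f x * of_bool (x \<in> E)) (\<lambda>y. g y * of_bool (y \<in> \<Lambda> E))"
    using corr_compose[OF corr_pair[OF _ corr_indicator[OF E, of of_bool borel]],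
        of borel f g "\<lambda>z. fst z * snd z" borel]
    by simp
  moreover have "(\<lambda>x. f x * of_bool (x \<in> E)) = f" by (rule ext) (use f0 in auto)
  ultimately show ?thesis by (intro exI[of _ "\<lambda>y. g y * of_bool (y \<in> \<Lambda> E)"]) simp
qed

text \<open>By hypothesis \<open>A\<close> and \<open>\<Lambda> A\<close> have equal measure for the
  densities \<open>u\<close> and \<open>v\<close>. Since preimages under \<open>f\<close> and
  \<open>g\<close> correspond, the two measures have the same image in \<open>S\<close>, against
  which \<open>F\<close> is integrated.\<close>

lemma nn_integral_transport:
  assumes c: "corr S f g" and E: "E \<in> sigma_fin_sets M"
    and u[measurable]: "u \<in> borel_measurable M" and v[measurable]: "v \<in> borel_measurable N"
    and uv: "\<And>A. A \<in> sigma_fin_sets M \<Longrightarrow> A \<subseteq> E \<Longrightarrow> (\<integral>\<^sup>+x\<in>A. u x \<partial>M) = (\<integral>\<^sup>+y\<in>\<Lambda> A. v y \<partial>N)"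
    and F[measurable]: "F \<in> borel_measurable S"
  shows "(\<integral>\<^sup>+x\<in>E. F (f x) * u x \<partial>M) = (\<integral>\<^sup>+y\<in>\<Lambda> E. F (g y) * v y \<partial>N)"
proof -
  note c' = corrD[OF c]
  note [measurable] = c'(1,2) \<Lambda>_sets[OF E] sigma_fin_sets_sets[OF E]
  define m where "m = density M (\<lambda>x. u x * indicator E x)"
  define n where "n = density N (\<lambda>y. v y * indicator (\<Lambda> E) y)"
  have [measurable]: "f \<in> m \<rightarrow>\<^sub>M S" "g \<in> n \<rightarrow>\<^sub>M S" by (simp_all add: m_def n_def)
  have "distr m S f = distr n S g"
  proof (rule measure_eqI)
    fix C assume "C \<in> sets (distr m S f)"
    then have C[measurable]: "C \<in> sets S" by simp
    have V: "E \<inter> f -` C \<in> sigma_fin_sets M" by (rule sigma_fin_vimage[OF E c'(1) C])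
    have "emeasure (distr m S f) C = (\<integral>\<^sup>+x. u x * indicator E x * indicator (f -` C \<inter> space M) x \<partial>M)"
      by (simp add: emeasure_distr) (simp add: m_def emeasure_density)
    also have "\<dots> = (\<integral>\<^sup>+x\<in>E \<inter> f -` C. u x \<partial>M)"
      by (intro nn_integral_cong) (auto simp: indicator_def)
    also have "\<dots> = (\<integral>\<^sup>+y\<in>\<Lambda> (E \<inter> f -` C). v y \<partial>N)" using V by (intro uv) auto
    also have "\<dots> = (\<integral>\<^sup>+y. v y * indicator (\<Lambda> E) y * indicator (g -` C \<inter> space N) y \<partial>N)"
      by (rule nn_integral_cong_AE)
        (use c'(3)[OF E C] AE_space in \<open>eventually_elim, auto simp: indicator_def\<close>)
    also have "\<dots> = emeasure (distr n S g) C"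
      by (simp add: emeasure_distr) (simp add: n_def emeasure_density)
    finally show "emeasure (distr m S f) C = emeasure (distr n S g) C" .
  qed simp
  then have "(\<integral>\<^sup>+x. F x \<partial>distr m S f) = (\<integral>\<^sup>+x. F x \<partial>distr n S g)" by simp
  then have "(\<integral>\<^sup>+x. F (f x) \<partial>m) = (\<integral>\<^sup>+y. F (g y) \<partial>n)" by (simp add: nn_integral_distr)
  then have "(\<integral>\<^sup>+x. u x * indicator E x * F (f x) \<partial>M) = (\<integral>\<^sup>+y. v y * indicator (\<Lambda> E) y * F (g y) \<partial>N)"
    unfolding m_def n_def by (simp add: nn_integral_density)
  then show ?thesis by (simp add: mult_ac)
qed

text \<open>Choose preimages. All laws are checked after applying \<Lambda>, which is injective
  modulo null sets.\<close>

lemma inverse_iso: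
  "\<exists>\<Lambda>'. set_iso N M \<Lambda>' \<and> (\<forall>B\<in>sigma_fin_sets N. AE y in N. y \<in> \<Lambda> (\<Lambda>' B) \<longleftrightarrow> y \<in> B)"
proof -
  have "\<forall>B. \<exists>A. B \<in> sigma_fin_sets N \<longrightarrow> A \<in> sigma_fin_sets M \<and> (AE y in N. y \<in> \<Lambda> A \<longleftrightarrow> y \<in> B)"
    using \<Lambda>_surj by blast
  then obtain L where L: "\<And>B. B \<in> sigma_fin_sets N \<Longrightarrow> L B \<in> sigma_fin_sets M"
    "\<And>B. B \<in> sigma_fin_sets N \<Longrightarrow> AE y in N. y \<in> \<Lambda> (L B) \<longleftrightarrow> y \<in> B" by metis
  have cong: "AE x in M. x \<in> A \<longleftrightarrow> x \<in> A'" if "A \<in> sigma_fin_sets M" "A' \<in> sigma_fin_sets M"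
    "AE y in N. y \<in> \<Lambda> A \<longleftrightarrow> y \<in> \<Lambda> A'" for A A'
  proof -
    have "AE y in N. y \<in> \<Lambda> A \<longrightarrow> y \<in> \<Lambda> A'" "AE y in N. y \<in> \<Lambda> A' \<longrightarrow> y \<in> \<Lambda> A"
      using that(3) by (eventually_elim, auto)+
    then have "AE x in M. x \<in> A \<longrightarrow> x \<in> A'" "AE x in M. x \<in> A' \<longrightarrow> x \<in> A"
      using \<Lambda>_le_iff that by blast+
    then show ?thesis by eventually_elim auto
  qed
  have "regular_set_iso N M (sigma_fin_sets N) (sigma_fin_sets M) L"
    unfolding regular_set_iso_def
  proof (intro conjI ballI)
    show "ring_of_sets (space N) (sigma_fin_sets N)" "ring_of_sets (space M) (sigma_fin_sets M)"
      by (rule ring_of_sets_sigma_fin_sets)+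
    show "sigma_fin_sets N \<subseteq> sets N" "sigma_fin_sets M \<subseteq> sets M" by (auto dest: sigma_fin_sets_sets)
    show "L \<in> sigma_fin_sets N \<rightarrow> sigma_fin_sets M" using L by auto
  next
    fix B assume B: "B \<in> sigma_fin_sets N"
    have "(AE x in M. x \<notin> L B) \<longleftrightarrow> (AE y in N. y \<notin> \<Lambda> (L B))" using \<Lambda>_null_iff L B by blast
    also have "\<dots> \<longleftrightarrow> (AE y in N. y \<notin> B)" by (rule AE_iff_AE) (use L(2)[OF B] in \<open>eventually_elim, auto\<close>)
    finally show "ess_eq M (L B) {} \<longleftrightarrow> ess_eq N B {}"
      using sigma_fin_sets_sets[OF B] sigma_fin_sets_sets[OF L(1)[OF B]] by (simp add: ess_eq_iff_AE)
  next
    fix A B assume AB: "A \<in> sigma_fin_sets N" "B \<in> sigma_fin_sets N"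
    have D: "A - B \<in> sigma_fin_sets N" "L A - L B \<in> sigma_fin_sets M"
      using AB L(1) by (blast intro: sigma_fin_sets_Diff')+
    have "AE y in N. y \<in> \<Lambda> (L (A - B)) \<longleftrightarrow> y \<in> \<Lambda> (L A - L B)"
      using L(2)[OF D(1)] L(2)[OF AB(1)] L(2)[OF AB(2)] \<Lambda>_diff[OF L(1)[OF AB(1)] L(1)[OF AB(2)]]
      by eventually_elim auto
    then have "AE x in M. x \<in> L (A - B) \<longleftrightarrow> x \<in> L A - L B" using cong L D by blast
    then show "ess_eq M (L (A - B)) (L A - L B)"
      using L(1)[OF D(1)] D(2) by (subst ess_eq_iff_AE) (auto intro: sigma_fin_sets_sets)
  next
    fix A assume A: "A \<in> sigma_fin_sets M"
    have "AE x in M. x \<in> L (\<Lambda> A) \<longleftrightarrow> x \<in> A"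
      using L(2)[OF \<Lambda>_in[OF A]] by (intro cong L \<Lambda>_in A)
    then show "\<exists>B\<in>sigma_fin_sets N. ess_eq M (L B) A"
      using L(1)[OF \<Lambda>_in[OF A]] A
      by (intro bexI[of _ "\<Lambda> A"]) (auto simp: ess_eq_iff_AE sigma_fin_sets_sets \<Lambda>_in)
  qed
  then show ?thesis using L(2) by (auto simp: set_iso_def)
qed

end

text \<open>Transport \<open>g\<close> along the inverse \<open>L\<close>. The resulting
  correspondence can be read backwards because \<open>L\<close> undoes \<Lambda> up to null
  sets.\<close>

lemma (in set_iso) corr_exists_inverse:
  fixes g :: "'b \<Rightarrow> complex"
  assumes g: "g \<in> borel_measurable N" and E: "E \<in> sigma_fin_sets M"
    and g0: "\<And>y. y \<notin> \<Lambda> E \<Longrightarrow> g y = 0"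
  shows "\<exists>f. corr borel f g \<and> (\<forall>x. x \<notin> E \<longrightarrow> f x = 0)"
proof -
  obtain L where "set_iso N M L" and L: "\<And>B. B \<in> sigma_fin_sets N \<Longrightarrow> AE y in N. y \<in> \<Lambda> (L B) \<longleftrightarrow> y \<in> B"
    using inverse_iso by blast
  interpret inv: set_iso N M L by fact
  obtain f where f: "inv.corr borel g f"
    using inv.corr_exists[OF g \<Lambda>_in[OF E] g0] by blast
  note c = inv.corrD[OF f]
  have "corr borel f g"
    unfolding corr_def
  proof (intro conjI ballI c)
    fix E' and C :: "complex set" assume E': "E' \<in> sigma_fin_sets M" and C: "C \<in> sets borel"
    have s: "\<Lambda> E' \<in> sigma_fin_sets N" "\<Lambda> E' \<inter> g -` C \<in> sigma_fin_sets N"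
      "E' \<inter> f -` C \<in> sigma_fin_sets M"
      using sigma_fin_vimage \<Lambda>_in[OF E'] c C E' by blast+
    have "AE x in M. x \<in> L (\<Lambda> E') \<longleftrightarrow> x \<in> E'"
    proof -
      have "AE y in N. y \<in> \<Lambda> (L (\<Lambda> E')) \<longrightarrow> y \<in> \<Lambda> E'" "AE y in N. y \<in> \<Lambda> E' \<longrightarrow> y \<in> \<Lambda> (L (\<Lambda> E'))"
        using L[OF s(1)] by (eventually_elim, auto)+
      then show ?thesis
        unfolding \<Lambda>_le_iff[OF inv.\<Lambda>_in[OF s(1)] E'] \<Lambda>_le_iff[OF E' inv.\<Lambda>_in[OF s(1)]]
        by eventually_elim auto
    qed
    then have "AE x in M. x \<in> L (\<Lambda> E' \<inter> g -` C) \<longleftrightarrow> x \<in> E' \<inter> f -` C"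
      using c(3)[OF s(1) C] by eventually_elim auto
    from \<Lambda>_cong[OF inv.\<Lambda>_in[OF s(2)] s(3) this]
    show "AE y in N. y \<in> \<Lambda> (E' \<inter> f -` C) \<longleftrightarrow> y \<in> \<Lambda> E' \<and> g y \<in> C"
      using L[OF s(2)] by eventually_elim auto
  qed
  then have "corr borel (\<lambda>x. f x * of_bool (x \<in> E)) (\<lambda>y. g y * of_bool (y \<in> \<Lambda> E))"
    using corr_compose[OF corr_pair[OF _ corr_indicator[OF E, of of_bool borel]],
        of borel f g "\<lambda>z. fst z * snd z" borel]
    by simp
  moreover have "(\<lambda>y. g y * of_bool (y \<in> \<Lambda> E)) = g" by (rule ext) (use g0 in auto)
  ultimately show ?thesis by (intro exI[of _ "\<lambda>x. f x * of_bool (x \<in> E)"]) simp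
qed

section \<open>Weighted transport as an isometric order isomorphism\<close>

text \<open>Cutting both densities off outside \<open>B\<close> makes one integral finite, so
  uniqueness of densities applies although \<open>N\<close> need not be \<sigma>-finite.\<close>

lemma set_density_unique:
  fixes u v :: "'b \<Rightarrow> ennreal"
  assumes [measurable]: "u \<in> borel_measurable N" "v \<in> borel_measurable N" "B \<in> sets N"
    and fin: "(\<integral>\<^sup>+y\<in>B. u y \<partial>N) < \<infinity>"
    and eq: "\<And>C. C \<in> sets N \<Longrightarrow> C \<subseteq> B \<Longrightarrow> (\<integral>\<^sup>+y\<in>C. u y \<partial>N) = (\<integral>\<^sup>+y\<in>C. v y \<partial>N)"
  shows "AE y in N. y \<in> B \<longrightarrow> u y = v y"
proof -
  have "density N (\<lambda>y. u y * indicator B y) = density N (\<lambda>y. v y * indicator B y)"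
  proof (rule measure_eqI)
    fix C assume "C \<in> sets (density N (\<lambda>y. u y * indicator B y))"
    then have [measurable]: "C \<in> sets N" by simp
    have *: "(\<integral>\<^sup>+y. t y * indicator B y * indicator C y \<partial>N) = (\<integral>\<^sup>+y\<in>B \<inter> C. t y \<partial>N)"
      for t :: "'b \<Rightarrow> ennreal"
      by (intro nn_integral_cong) (auto simp: indicator_def)
    show "emeasure (density N (\<lambda>y. u y * indicator B y)) C = emeasure (density N (\<lambda>y. v y * indicator B y)) C"
      by (simp add: emeasure_density * eq)
  qed simp
  then have "AE y in N. u y * indicator B y = v y * indicator B y"
    using fin by (subst (asm) finite_density_unique) auto
  then show ?thesis by eventually_elim (auto simp: indicator_def split: if_splits)
qed

context set_iso begin

text \<open>On a piece of finite measure the densities have equal integrals over every measurable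
  subset of its image, since each such subset is itself an image. Countably many pieces cover
  \<open>E\<close>.\<close>

lemma weights_unique:
  fixes u v :: "'b \<Rightarrow> ennreal"
  assumes E: "E \<in> sigma_fin_sets M" and [measurable]: "u \<in> borel_measurable N" "v \<in> borel_measurable N"
    and u: "\<And>A. A \<in> sigma_fin_sets M \<Longrightarrow> A \<subseteq> E \<Longrightarrow> (\<integral>\<^sup>+y\<in>\<Lambda> A. u y \<partial>N) = emeasure M A"
    and v: "\<And>A. A \<in> sigma_fin_sets M \<Longrightarrow> A \<subseteq> E \<Longrightarrow> (\<integral>\<^sup>+y\<in>\<Lambda> A. v y \<partial>N) = emeasure M A"
  shows "AE y in N. y \<in> \<Lambda> E \<longrightarrow> u y = v y"
proof -
  obtain F :: "nat \<Rightarrow> 'a set" where F: "E = (\<Union>n. F n)" "range F \<subseteq> fin_sets M"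
    using E unfolding sigma_fin_sets_def by blast
  have Fs: "F n \<in> sigma_fin_sets M" and Ff: "emeasure M (F n) < \<infinity>" and FE: "F n \<subseteq> E" for n
    using F fin_sigma_fin by (auto simp: fin_sets_def)
  have "AE y in N. y \<in> \<Lambda> (F n) \<longrightarrow> u y = v y" for n
  proof (rule set_density_unique)
    show "(\<integral>\<^sup>+y\<in>\<Lambda> (F n). u y \<partial>N) < \<infinity>" using u[OF Fs FE] Ff by simp
    fix C assume C: "C \<in> sets N" "C \<subseteq> \<Lambda> (F n)"
    have "C \<in> sigma_fin_sets N" by (rule sigma_fin_sets_subset[OF \<Lambda>_in[OF Fs] C])
    then obtain A where A: "A \<in> sigma_fin_sets M" "A \<subseteq> F n" "AE y in N. y \<in> \<Lambda> A \<longleftrightarrow> y \<in> C"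
      using \<Lambda>_surj_sub[OF _ Fs C(2)] by blast
    have AE: "A \<subseteq> E" using A(2) FE by blast
    show "(\<integral>\<^sup>+y\<in>C. u y \<partial>N) = (\<integral>\<^sup>+y\<in>C. v y \<partial>N)"
      using AE_mem_eq_cong[OF \<Lambda>_sets[OF A(1)] C(1) A(3), of u]
        AE_mem_eq_cong[OF \<Lambda>_sets[OF A(1)] C(1) A(3), of v] u[OF A(1) AE] v[OF A(1) AE] by simp
  qed (use \<Lambda>_sets[OF Fs] in auto)
  then have "AE y in N. \<forall>n. y \<in> \<Lambda> (F n) \<longrightarrow> u y = v y" unfolding AE_all_countable by blast
  then show ?thesis using \<Lambda>_UN[of F, OF Fs, folded F(1)] by eventually_elim auto
qed

text \<open>\<open>corr\<close> controls \<open>g\<close> only on images of \<sigma>-finite sets;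
  vanishing off \<open>\<Lambda> E\<close> is what determines \<open>g\<close> almost everywhere.
  The explicit \<open>E\<close> records which local weight is to be used.\<close>

definition carried :: "'a set \<Rightarrow> ('a \<Rightarrow> complex) \<Rightarrow> ('b \<Rightarrow> complex) \<Rightarrow> bool" where
  "carried E f g \<longleftrightarrow> E \<in> sigma_fin_sets M \<and> corr borel f g \<and>
     (AE x in M. x \<notin> E \<longrightarrow> f x = 0) \<and> (AE y in N. y \<notin> \<Lambda> E \<longrightarrow> g y = 0)"

lemma carriedD:
  assumes "carried E f g"
  shows "E \<in> sigma_fin_sets M" "corr borel f g" "AE x in M. x \<notin> E \<longrightarrow> f x = 0"
    "AE y in N. y \<notin> \<Lambda> E \<longrightarrow> g y = 0" "f \<in> borel_measurable M" "g \<in> borel_measurable N"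
  using assms corrD[of borel f g] by (auto simp: carried_def)

lemma carried_mono:
  assumes c: "carried E f g" and F: "F \<in> sigma_fin_sets M" "E \<subseteq> F"
  shows "carried F f g"
proof -
  note d = carriedD[OF c]
  have "AE x in M. x \<notin> F \<longrightarrow> f x = 0" using d(3) by eventually_elim (use F in auto)
  moreover have "AE y in N. y \<notin> \<Lambda> F \<longrightarrow> g y = 0"
    using d(4) \<Lambda>_mono[OF d(1) F] by eventually_elim auto
  ultimately show ?thesis using d F by (simp add: carried_def)
qed

lemma carried_combine:
  assumes f: "carried E f g" and f': "carried E f' g'"
    and h: "h \<in> borel \<Otimes>\<^sub>M borel \<rightarrow>\<^sub>M borel" "h (0, 0) = 0"
  shows "carried E (\<lambda>x. h (f x, f' x)) (\<lambda>y. h (g y, g' y))"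
proof -
  note d = carriedD[OF f] and d' = carriedD[OF f']
  have "corr borel (\<lambda>x. h (f x, f' x)) (\<lambda>y. h (g y, g' y))"
    by (rule corr_compose[OF corr_pair[OF d(2) d'(2)] h(1)])
  moreover have "AE x in M. x \<notin> E \<longrightarrow> h (f x, f' x) = 0"
    using d(3) d'(3) by eventually_elim (simp add: h(2))
  moreover have "AE y in N. y \<notin> \<Lambda> E \<longrightarrow> h (g y, g' y) = 0"
    using d(4) d'(4) by eventually_elim (simp add: h(2))
  ultimately show ?thesis using d(1) by (simp add: carried_def)
qed

lemma carried_unique:
  assumes f: "carried E f g" and f': "carried E f' g'" and eq: "AE x in M. f x = f' x"
  shows "AE y in N. g y = g' y"
proof -
  note d = carriedD[OF f] and d' = carriedD[OF f']
  have "AE x in M. x \<in> E \<longrightarrow> f x = f' x" using eq by eventually_elim auto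
  from corr_unique[OF d(2) d'(2) d(1) this] show ?thesis
    using d(4) d'(4) by eventually_elim auto
qed

lemma carried_exists:
  assumes f: "f \<in> borel_measurable M" and E: "E \<in> sigma_fin_sets M"
    and f0: "AE x in M. x \<notin> E \<longrightarrow> f x = 0"
  shows "\<exists>f' g. carried E f' g \<and> (AE x in M. f' x = f x)"
proof -
  note [measurable] = sigma_fin_sets_sets[OF E] f
  have "(\<lambda>x. f x * indicator E x) \<in> borel_measurable M" by measurable
  from corr_exists[OF this E] obtain g
    where "corr borel (\<lambda>x. f x * indicator E x) g" "\<forall>y. y \<notin> \<Lambda> E \<longrightarrow> g y = 0" by auto
  then have "carried E (\<lambda>x. f x * indicator E x) g" using E by (simp add: carried_def)
  moreover have "AE x in M. f x * indicator E x = f x"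
    using f0 by eventually_elim (auto simp: indicator_def)
  ultimately show ?thesis by blast
qed

lemma carried_indicator:
  assumes "A \<in> sigma_fin_sets M"
  shows "carried A (indicator A) (indicator (\<Lambda> A))"
proof -
  have "corr borel (\<lambda>x. of_bool (x \<in> A)) (\<lambda>y. of_bool (y \<in> \<Lambda> A) :: complex)"
    by (rule corr_indicator[OF assms]) auto
  then show ?thesis using assms by (simp add: carried_def indicator_def[abs_def] of_bool_def)
qed

end

text \<open>\<open>w E\<close> is a density, on \<open>\<Lambda> E\<close>, of the measure
  transported by \<Lambda>. A family is needed because local densities need not come from one global
  function.\<close>

locale weighted_iso = set_iso M N \<Lambda>
  for M :: "'a measure" and N :: "'b measure" and \<Lambda> +
  fixes p :: real and w :: "'a set \<Rightarrow> 'b \<Rightarrow> real"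
  assumes p: "0 < p"
    and w_meas: "\<And>E. E \<in> sigma_fin_sets M \<Longrightarrow> w E \<in> borel_measurable N"
    and w_nonneg: "\<And>E y. 0 \<le> w E y"
    and w_int: "\<And>E A. E \<in> sigma_fin_sets M \<Longrightarrow> A \<in> sigma_fin_sets M \<Longrightarrow> A \<subseteq> E \<Longrightarrow>
      (\<integral>\<^sup>+y\<in>\<Lambda> A. ennreal (w E y) \<partial>N) = emeasure M A"
begin

lemma w_cong:
  assumes E: "E \<in> sigma_fin_sets M" and F: "F \<in> sigma_fin_sets M"
  shows "AE y in N. y \<in> \<Lambda> E \<and> y \<in> \<Lambda> F \<longrightarrow> w E y = w F y"
proof -
  note [measurable] = w_meas[OF E] w_meas[OF F]
  have I: "E \<inter> F \<in> sigma_fin_sets M" using E F sigma_fin_sets_Int sigma_fin_sets_sets by blast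
  have "AE y in N. y \<in> \<Lambda> (E \<inter> F) \<longrightarrow> ennreal (w E y) = ennreal (w F y)"
    by (rule weights_unique[OF I]) (auto simp: w_int E F)
  then show ?thesis
    using \<Lambda>_inter[OF E F] by eventually_elim (auto simp: w_nonneg)
qed

text \<open>The zero set of \<open>w E\<close> inside \<open>\<Lambda> E\<close> is the image of
  some \<open>A\<close> whose measure is the integral of the density over that set, hence 0.
  Positivity permits division by the weight and makes multiplication reflect signs.\<close>

lemma w_pos:
  assumes E: "E \<in> sigma_fin_sets M"
  shows "AE y in N. y \<in> \<Lambda> E \<longrightarrow> 0 < w E y"
proof -
  note [measurable] = w_meas[OF E] \<Lambda>_sets[OF E]
  define Z where "Z = {y \<in> space N. y \<in> \<Lambda> E \<and> w E y = 0}"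
  have Z[measurable]: "Z \<in> sets N" unfolding Z_def by measurable
  have Zs: "Z \<in> sigma_fin_sets N"
    by (rule sigma_fin_sets_subset[OF \<Lambda>_in[OF E] Z]) (auto simp: Z_def)
  then obtain A where A: "A \<in> sigma_fin_sets M" "A \<subseteq> E" "AE y in N. y \<in> \<Lambda> A \<longleftrightarrow> y \<in> Z"
    using \<Lambda>_surj_sub[OF Zs E] by (auto simp: Z_def)
  have "emeasure M A = (\<integral>\<^sup>+y\<in>\<Lambda> A. ennreal (w E y) \<partial>N)" by (simp add: w_int E A)
  also have "\<dots> = (\<integral>\<^sup>+y\<in>Z. ennreal (w E y) \<partial>N)"
    by (rule AE_mem_eq_cong[OF \<Lambda>_sets[OF A(1)] Z A(3)])
  also have "\<dots> = (\<integral>\<^sup>+y. 0 \<partial>N)" by (intro nn_integral_cong) (auto simp: Z_def indicator_def)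
  finally have "A \<in> null_sets M" using sigma_fin_sets_sets[OF A(1)] by auto
  then have "AE y in N. y \<notin> \<Lambda> A" unfolding \<Lambda>_null_iff[OF A(1)] by (rule AE_not_in)
  then show ?thesis using A(3) AE_space
  proof eventually_elim
    case (elim y)
    then show ?case using w_nonneg[of E y] by (auto simp: Z_def)
  qed
qed

text \<open>The exponent \<open>1 / p\<close> makes the p-th power of the modulus acquire exactly
  the density \<open>w E\<close>.\<close>

definition wmult :: "'a set \<Rightarrow> ('b \<Rightarrow> complex) \<Rightarrow> 'b \<Rightarrow> complex" where
  "wmult E g = (\<lambda>y. g y * of_real (w E y powr (1 / p)))"

lemma wmult_meas:
  assumes "E \<in> sigma_fin_sets M" "g \<in> borel_measurable N"
  shows "wmult E g \<in> borel_measurable N"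
proof -
  note [measurable] = w_meas[OF assms(1)] assms(2)
  show ?thesis unfolding wmult_def by measurable
qed

lemma wmult_cong_sets:
  assumes c: "carried E f g" and F: "F \<in> sigma_fin_sets M" "E \<subseteq> F"
  shows "AE y in N. wmult F g y = wmult E g y"
  using w_cong[OF carriedD(1)[OF c] F(1)] carriedD(4)[OF c] \<Lambda>_mono[OF carriedD(1)[OF c] F]
  by eventually_elim (auto simp: wmult_def)

lemma wmult_unique:
  assumes f: "carried E f g" and f': "carried F f' g'" and eq: "AE x in M. f x = f' x"
  shows "AE y in N. wmult E g y = wmult F g' y"
proof -
  have H: "E \<union> F \<in> sigma_fin_sets M" using carriedD(1)[OF f] carriedD(1)[OF f'] by (rule sigma_fin_sets_Un)
  have "AE y in N. g y = g' y"
    by (rule carried_unique[OF carried_mono[OF f H] carried_mono[OF f' H] eq]) auto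
  then show ?thesis using wmult_cong_sets[OF f H Un_upper1] wmult_cong_sets[OF f' H Un_upper2]
    by eventually_elim (auto simp: wmult_def)
qed

text \<open>The density 1 on \<open>M\<close> corresponds to \<open>w E\<close> on \<open>N\<close>,
  so the p-th power of the modulus can be transported. The version over a set \<open>A\<close> is
  stronger than equality of norms: it later identifies \<phi>.\<close>

lemma nn_integral_wmult:
  assumes c: "carried E f g" and A: "A \<in> sigma_fin_sets M"
  shows "(\<integral>\<^sup>+y\<in>\<Lambda> A. ennreal (cmod (wmult E g y) powr p) \<partial>N) = (\<integral>\<^sup>+x\<in>A. ennreal (cmod (f x) powr p) \<partial>M)"
proof -
  note d = carriedD[OF c]
  note [measurable] = d(5,6) w_meas[OF d(1)]
  have I: "A \<inter> E \<in> sigma_fin_sets M" using A sigma_fin_sets_sets[OF d(1)] by (rule sigma_fin_sets_Int)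
  have wm: "cmod (wmult E g y) powr p = cmod (g y) powr p * w E y" for y
    using w_nonneg[of E y] p by (simp add: wmult_def norm_mult powr_mult powr_powr)
  have "(\<integral>\<^sup>+x\<in>A. ennreal (cmod (f x) powr p) \<partial>M) = (\<integral>\<^sup>+x\<in>A \<inter> E. ennreal (cmod (f x) powr p) * 1 \<partial>M)"
    by (rule nn_integral_cong_AE) (use d(3) in \<open>eventually_elim, use p in \<open>auto simp: indicator_def\<close>\<close>)
  also have "\<dots> = (\<integral>\<^sup>+y\<in>\<Lambda> (A \<inter> E). ennreal (cmod (g y) powr p) * ennreal (w E y) \<partial>N)"
  proof (rule nn_integral_transport[OF d(2) I])
    fix B assume B: "B \<in> sigma_fin_sets M" "B \<subseteq> A \<inter> E"
    then show "(\<integral>\<^sup>+x\<in>B. 1 \<partial>M) = (\<integral>\<^sup>+y\<in>\<Lambda> B. ennreal (w E y) \<partial>N)"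
      using sigma_fin_sets_sets[OF B(1)] by (simp add: w_int d(1))
  qed measurable
  also have "\<dots> = (\<integral>\<^sup>+y\<in>\<Lambda> A. ennreal (cmod (wmult E g y) powr p) \<partial>N)"
    by (rule nn_integral_cong_AE)
      (use d(4) \<Lambda>_inter[OF A d(1)] in \<open>eventually_elim,
        use p in \<open>auto simp: indicator_def wm ennreal_mult' w_nonneg\<close>\<close>)
  finally show ?thesis by simp
qed

lemma pint_wmult:
  assumes c: "carried E f g"
  shows "pint p N (wmult E g) = pint p M f"
proof -
  note d = carriedD[OF c]
  have "pint p N (wmult E g) = (\<integral>\<^sup>+y\<in>\<Lambda> E. ennreal (cmod (wmult E g y) powr p) \<partial>N)"
    unfolding pint_def
    by (rule nn_integral_cong_AE)
      (use d(4) in \<open>eventually_elim, use p in \<open>auto simp: indicator_def wmult_def\<close>\<close>)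
  also have "\<dots> = (\<integral>\<^sup>+x\<in>E. ennreal (cmod (f x) powr p) \<partial>M)" by (rule nn_integral_wmult[OF c d(1)])
  also have "\<dots> = pint p M f"
    unfolding pint_def
    by (rule nn_integral_cong_AE)
      (use d(3) in \<open>eventually_elim, use p in \<open>auto simp: indicator_def\<close>\<close>)
  finally show ?thesis .
qed

lemma wmult_nonneg_iff:
  assumes c: "carried E f g"
  shows "(AE y in N. wmult E g y \<in> \<real>\<^sub>\<ge>\<^sub>0) \<longleftrightarrow> (AE x in M. f x \<in> \<real>\<^sub>\<ge>\<^sub>0)"
proof -
  note d = carriedD[OF c]
  have **: "g y \<in> \<real>\<^sub>\<ge>\<^sub>0 \<longleftrightarrow> g y * of_real r \<in> \<real>\<^sub>\<ge>\<^sub>0" if "0 < r" for r y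
    using that by (auto simp: complex_nonneg_Reals_iff zero_le_mult_iff)
  have *: "g y \<in> \<real>\<^sub>\<ge>\<^sub>0 \<longleftrightarrow> wmult E g y \<in> \<real>\<^sub>\<ge>\<^sub>0" if "0 < w E y" for y
    using that unfolding wmult_def by (intro **) simp
  have "(AE y in N. wmult E g y \<in> \<real>\<^sub>\<ge>\<^sub>0) \<longleftrightarrow> (AE y in N. y \<in> \<Lambda> E \<longrightarrow> g y \<in> \<real>\<^sub>\<ge>\<^sub>0)"
    by (rule AE_iff_AE)
      (use d(4) w_pos[OF d(1)] in \<open>eventually_elim, use * in \<open>auto simp: wmult_def\<close>\<close>)
  also have "\<dots> \<longleftrightarrow> (AE x in M. x \<in> E \<longrightarrow> f x \<in> \<real>\<^sub>\<ge>\<^sub>0)"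
    by (rule corr_AE_mem[OF d(2) d(1)]) (simp add: borel_closed closed_nonneg_Reals_complex)
  also have "\<dots> \<longleftrightarrow> (AE x in M. f x \<in> \<real>\<^sub>\<ge>\<^sub>0)"
    by (rule AE_iff_AE) (use d(3) in \<open>eventually_elim, auto\<close>)
  finally show ?thesis .
qed

text \<open>The support of \<open>G\<close> is \<sigma>-finite and hence some
  \<open>\<Lambda> E\<close>; divide by the p-th root of the weight there and pull back along the
  inverse of \<Lambda>.\<close>

lemma wmult_surj:
  assumes [measurable]: "G \<in> borel_measurable N" and fin: "pint p N G < \<infinity>"
  shows "\<exists>E f g. carried E f g \<and> (AE y in N. wmult E g y = G y)"
proof -
  have "{y \<in> space N. G y \<noteq> 0} \<in> sigma_fin_sets N"
    by (rule support_sigma_fin[of _ _ p]) (use fin p in \<open>auto simp: pint_def\<close>)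
  then obtain E where E: "E \<in> sigma_fin_sets M" "AE y in N. y \<in> \<Lambda> E \<longleftrightarrow> y \<in> {y \<in> space N. G y \<noteq> 0}"
    using \<Lambda>_surj by blast
  note [measurable] = w_meas[OF E(1)] \<Lambda>_sets[OF E(1)]
  define g where "g y = (if y \<in> \<Lambda> E then G y / of_real (w E y powr (1 / p)) else 0)" for y
  have g: "g \<in> borel_measurable N" unfolding g_def by measurable
  obtain f where f: "corr borel f g" "\<forall>x. x \<notin> E \<longrightarrow> f x = 0"
    using corr_exists_inverse[OF g E(1)] by (auto simp: g_def)
  have "carried E f g" using f E(1) by (simp add: carried_def g_def)
  moreover have "AE y in N. wmult E g y = G y"
    using E(2) w_pos[OF E(1)] AE_space by eventually_elim (auto simp: wmult_def g_def)
  ultimately show ?thesis by blast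
qed

text \<open>The choice is harmless: \<open>wmult_unique\<close> gives the same class for every
  carried representative, even for different sets \<open>E\<close>. The restriction to
  \<open>Lp p M\<close> supplies the extensionality needed for uniqueness.\<close>

definition lift :: "('a \<Rightarrow> complex) set \<Rightarrow> ('b \<Rightarrow> complex) set" where
  "lift = restrict (\<lambda>u. SOME v. \<exists>E f g. carried E f g \<and> u = ae_class M f \<and> v = ae_class N (wmult E g)) (Lp p M)"

lemma lift_eq:
  assumes c: "carried E f g" and fin: "pint p M f < \<infinity>"
  shows "lift (ae_class M f) = ae_class N (wmult E g)"
proof -
  have "ae_class M f \<in> Lp p M" using carriedD(5)[OF c] fin by (simp add: ae_class_in_Lp_iff)
  then have "lift (ae_class M f) = (SOME v. \<exists>E' f' g'. carried E' f' g' \<and> ae_class M f = ae_class M f' \<and> v = ae_class N (wmult E' g'))"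
    by (simp add: lift_def)
  also have "\<dots> = ae_class N (wmult E g)"
  proof (rule some_equality)
    show "\<exists>E' f' g'. carried E' f' g' \<and> ae_class M f = ae_class M f' \<and> ae_class N (wmult E g) = ae_class N (wmult E' g')"
      using c by blast
  next
    fix v assume "\<exists>E' f' g'. carried E' f' g' \<and> ae_class M f = ae_class M f' \<and> v = ae_class N (wmult E' g')"
    then obtain E' f' g' where c': "carried E' f' g'" "ae_class M f = ae_class M f'" "v = ae_class N (wmult E' g')"
      by blast
    have "AE x in M. f' x = f x"
      using c'(2) carriedD(5)[OF c] carriedD(5)[OF c'(1)] ae_class_eq_iff by metis
    from wmult_unique[OF c'(1) c this] show "v = ae_class N (wmult E g)"
      unfolding c'(3) using wmult_meas carriedD(1,6)[OF c] carriedD(1,6)[OF c'(1)]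
      by (subst ae_class_eq_iff) auto
  qed
  finally show ?thesis .
qed

lemma Lp_carried:
  assumes u: "u \<in> Lp p M" and E: "E \<in> sigma_fin_sets M" and u0: "AE x in M. x \<notin> E \<longrightarrow> rep u x = 0"
  shows "\<exists>f g. carried E f g \<and> u = ae_class M f \<and> pint p M f < \<infinity> \<and> (AE x in M. f x = rep u x)"
proof -
  obtain f g where f: "carried E f g" "AE x in M. f x = rep u x"
    using carried_exists[OF LpD(1)[OF u] E u0] by blast
  have "u = ae_class M f"
    using f(2) LpD(1)[OF u] carriedD(5)[OF f(1)] LpD(3)[OF u] ae_class_eq_iff by metis
  moreover have "pint p M f < \<infinity>" using LpD(2)[OF u] pint_cong_AE[OF f(2)] by simp
  ultimately show ?thesis using f by blast
qed

lemma Lp_support: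
  assumes "u \<in> Lp p M"
  shows "{x \<in> space M. rep u x \<noteq> 0} \<in> sigma_fin_sets M"
  using LpD[OF assms] p by (intro support_sigma_fin[of _ _ p]) (auto simp: pint_def)

lemma Lp_carried':
  assumes u: "u \<in> Lp p M"
  shows "\<exists>E f g. carried E f g \<and> u = ae_class M f \<and> pint p M f < \<infinity>"
proof -
  have "AE x in M. x \<notin> {x \<in> space M. rep u x \<noteq> 0} \<longrightarrow> rep u x = 0" by (rule AE_I2) auto
  then show ?thesis using Lp_carried[OF u Lp_support[OF u]] by blast
qed

lemma lift_iso: "isometric_order_iso p M N lift"
  unfolding isometric_order_iso_def
proof (intro conjI ballI allI)
  have mem: "lift u \<in> Lp p N" if u: "u \<in> Lp p M" for u
  proof -
    obtain E f g where c: "carried E f g" "u = ae_class M f" "pint p M f < \<infinity>"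
      using Lp_carried'[OF u] by blast
    then show ?thesis using lift_eq[OF c(1,3)] pint_wmult[OF c(1)] wmult_meas carriedD[OF c(1)]
      by (simp add: ae_class_in_Lp_iff)
  qed
  \<comment> \<open>An equivalence, since mapping onto the cone requires that non-negativity is also
    reflected.\<close>
  have cone: "lift u \<in> Lp_cone p N \<longleftrightarrow> u \<in> Lp_cone p M" if u: "u \<in> Lp p M" for u
  proof -
    obtain E f g where c: "carried E f g" "u = ae_class M f" "pint p M f < \<infinity>"
      using Lp_carried'[OF u] by blast
    then show ?thesis
      using lift_eq[OF c(1,3)] pint_wmult[OF c(1)] wmult_meas carriedD[OF c(1)] wmult_nonneg_iff[OF c(1)]
      by (simp add: ae_class_in_cone_iff)
  qed
  have surj: "\<exists>u\<in>Lp p M. lift u = v" if v: "v \<in> Lp p N" for v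
  proof -
    obtain E f g where c: "carried E f g" "AE y in N. wmult E g y = rep v y"
      using wmult_surj LpD[OF v] by metis
    have fin: "pint p M f < \<infinity>" using pint_wmult[OF c(1)] pint_cong_AE[OF c(2), of p] LpD[OF v] by simp
    have "lift (ae_class M f) = v"
      using lift_eq[OF c(1) fin] c(2) LpD[OF v] wmult_meas carriedD[OF c(1)] ae_class_eq_iff by metis
    moreover have "ae_class M f \<in> Lp p M" using fin carriedD[OF c(1)] by (simp add: ae_class_in_Lp_iff)
    ultimately show ?thesis by blast
  qed
  show "lift ` Lp p M = Lp p N" using mem surj by blast
  show "lift ` Lp_cone p M = Lp_cone p N"
  proof (intro subset_antisym subsetI)
    fix v assume "v \<in> lift ` Lp_cone p M"
    then show "v \<in> Lp_cone p N" using cone subsetD[OF cone_subset_Lp] by auto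
  next
    fix v assume v: "v \<in> Lp_cone p N"
    then obtain u where "u \<in> Lp p M" "lift u = v" using surj subsetD[OF cone_subset_Lp] by blast
    then show "v \<in> lift ` Lp_cone p M" using cone v by blast
  qed
  fix u assume u: "u \<in> Lp p M"
  obtain E f g where c: "carried E f g" "u = ae_class M f" "pint p M f < \<infinity>"
    using Lp_carried'[OF u] by blast
  note d = carriedD[OF c(1)]
  note [measurable] = d(5,6)
  show "Lp_norm p N (lift u) = Lp_norm p M u"
    using lift_eq[OF c(1,3)] c(2) wmult_meas[OF d(1,6)] by (simp add: Lp_norm_ae_class pint_wmult[OF c(1)])
  {
    fix a :: complex
    have "carried E (\<lambda>x. (\<lambda>z. a * fst z) (f x, f x)) (\<lambda>y. (\<lambda>z. a * fst z) (g y, g y))"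
      by (rule carried_combine[OF c(1,1)]) auto
    then have c': "carried E (\<lambda>x. a * f x) (\<lambda>y. a * g y)" by simp
    have "pint p M (\<lambda>x. a * f x) < \<infinity>" using pint_scale[OF d(5)] c(3) by (simp add: ennreal_mult_less_top)
    then have "lift (Lp_scale M a u) = ae_class N (wmult E (\<lambda>y. a * g y))"
      unfolding c(2) using lift_eq[OF c'] by (simp add: Lp_scale_ae_class)
    also have "\<dots> = Lp_scale N a (lift u)"
      unfolding c(2) lift_eq[OF c(1,3)] using wmult_meas[OF d(1,6)]
      by (simp add: Lp_scale_ae_class) (simp add: wmult_def mult_ac)
    finally show "lift (Lp_scale M a u) = Lp_scale N a (lift u)" .
  }
  fix v assume v: "v \<in> Lp p M"
  obtain F f' g' where e: "carried F f' g'" "v = ae_class M f'" "pint p M f' < \<infinity>"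
    using Lp_carried'[OF v] by blast
  note d' = carriedD[OF e(1)]
  note [measurable] = d'(5,6)
  \<comment> \<open>Enlarging both carriers to the union lets the two summands use the same
    weight.\<close>
  have H: "E \<union> F \<in> sigma_fin_sets M" using d(1) d'(1) by (rule sigma_fin_sets_Un)
  note cH = carried_mono[OF c(1) H Un_upper1] and eH = carried_mono[OF e(1) H Un_upper2]
  have "carried (E \<union> F) (\<lambda>x. (\<lambda>z. fst z + snd z) (f x, f' x)) (\<lambda>y. (\<lambda>z. fst z + snd z) (g y, g' y))"
    by (rule carried_combine[OF cH eH]) auto
  then have s: "carried (E \<union> F) (\<lambda>x. f x + f' x) (\<lambda>y. g y + g' y)" by simp
  have "pint p M (\<lambda>x. f x + f' x) < \<infinity>"
    by (rule le_less_trans[OF pint_add_le[OF d(5) d'(5) p]])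
      (use c(3) e(3) in \<open>simp add: ennreal_mult_less_top\<close>)
  then have "lift (Lp_add M u v) = ae_class N (wmult (E \<union> F) (\<lambda>y. g y + g' y))"
    unfolding c(2) e(2) using lift_eq[OF s] by (simp add: Lp_add_ae_class)
  also have "\<dots> = Lp_add N (lift u) (lift v)"
    unfolding c(2) e(2) lift_eq[OF cH c(3)] lift_eq[OF eH e(3)]
    using wmult_meas[OF H d(6)] wmult_meas[OF H d'(6)]
    by (simp add: Lp_add_ae_class) (simp add: wmult_def ring_distribs)
  finally show "lift (Lp_add M u v) = Lp_add N (lift u) (lift v)" .
qed

lemma lift_extensional: "lift \<in> extensional (Lp p M)"
  by (simp add: lift_def)

lemma lift_indicator:
  assumes "A \<in> fin_sets M"
  shows "lift (ae_class M (indicator A)) = ae_class N (wmult A (indicator (\<Lambda> A)))"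
proof (rule lift_eq[OF carried_indicator])
  have "pint p M (indicator A) = emeasure M A"
  proof -
    have "ennreal (cmod (indicator A x) powr p) = indicator A x" for x
      using p by (auto simp: indicator_def)
    then show ?thesis using assms by (simp add: pint_def fin_sets_def)
  qed
  then show "pint p M (indicator A) < \<infinity>" using assms by (simp add: fin_sets_def)
qed (use assms fin_sigma_fin in blast)

end

section \<open>The induced isomorphism\<close>

lemma Lp_norm_eq_iff:
  assumes "u \<in> Lp p M" "v \<in> Lp p N" "0 < p"
  shows "Lp_norm p M u = Lp_norm p N v \<longleftrightarrow> pint p M (rep u) = pint p N (rep v)"
proof -
  note u = LpD[OF assms(1)] and v = LpD[OF assms(2)]
  have "a = b" if "enn2real a powr (1 / p) = enn2real b powr (1 / p)" "a < \<infinity>" "b < \<infinity>" for a b :: ennreal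
  proof -
    have "(enn2real a powr (1 / p)) powr p = (enn2real b powr (1 / p)) powr p" using that by simp
    then have "enn2real a = enn2real b" using assms(3) by (simp add: powr_powr)
    then show "a = b" using that(2,3) by (metis ennreal_enn2real infinity_ennreal_def)
  qed
  moreover have "Lp_norm p M u = enn2real (pint p M (rep u)) powr (1 / p)"
    "Lp_norm p N v = enn2real (pint p N (rep v)) powr (1 / p)"
    using Lp_norm_ae_class[OF u(1), of p] Lp_norm_ae_class[OF v(1), of p] u(3) v(3) by simp_all
  ultimately show ?thesis using u(2) v(2) by auto
qed

lemma isometric_order_isoD:
  assumes "isometric_order_iso p M K T"
  shows "u \<in> Lp p M \<Longrightarrow> T u \<in> Lp p K"
    "u \<in> Lp p M \<Longrightarrow> v \<in> Lp p M \<Longrightarrow> T (Lp_add M u v) = Lp_add K (T u) (T v)"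
    "u \<in> Lp p M \<Longrightarrow> T (Lp_scale M c u) = Lp_scale K c (T u)"
    "u \<in> Lp p M \<Longrightarrow> Lp_norm p K (T u) = Lp_norm p M u"
  using assms by (auto simp: isometric_order_iso_def)

lemma pint_iso_diff:
  assumes T: "isometric_order_iso p M K T" and p: "0 < p"
    and f: "f \<in> borel_measurable M" "pint p M f < \<infinity>"
    and g: "g \<in> borel_measurable M" "pint p M g < \<infinity>"
  shows "pint p K (\<lambda>y. rep (T (ae_class M f)) y - rep (T (ae_class M g)) y) = pint p M (\<lambda>x. f x - g x)"
proof -
  note D = isometric_order_isoD[OF T]
  note [measurable] = f(1) g(1)
  have F: "ae_class M f \<in> Lp p M" and G: "ae_class M g \<in> Lp p M" using f g by (simp_all add: ae_class_in_Lp_iff)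
  define a where "a = rep (T (ae_class M f))"
  define b where "b = rep (T (ae_class M g))"
  note La = LpD[OF D(1)[OF F]] and Lb = LpD[OF D(1)[OF G]]
  have [measurable]: "a \<in> borel_measurable K" "b \<in> borel_measurable K" using La Lb by (simp_all add: a_def b_def)
  have S: "Lp_scale M (- 1) (ae_class M g) \<in> Lp p M" by (rule Lp_scale_closed[OF G])
  have d: "Lp_add M (ae_class M f) (Lp_scale M (- 1) (ae_class M g)) = ae_class M (\<lambda>x. f x - g x)"
    by (simp add: Lp_scale_ae_class Lp_add_ae_class)
  have U: "ae_class M (\<lambda>x. f x - g x) \<in> Lp p M" using Lp_add_closed[OF F S p] d by simp
  have "T (ae_class M (\<lambda>x. f x - g x)) = Lp_add K (ae_class K a) (Lp_scale K (- 1) (ae_class K b))"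
    unfolding d[symmetric] D(2)[OF F S] D(3)[OF G] a_def b_def La(3) Lb(3) ..
  also have "\<dots> = ae_class K (\<lambda>y. a y - b y)" by (simp add: Lp_scale_ae_class Lp_add_ae_class)
  finally have e: "T (ae_class M (\<lambda>x. f x - g x)) = ae_class K (\<lambda>y. a y - b y)" .
  have "pint p K (rep (T (ae_class M (\<lambda>x. f x - g x)))) = pint p M (rep (ae_class M (\<lambda>x. f x - g x)))"
    using Lp_norm_eq_iff[OF D(1)[OF U] U p] D(4)[OF U] by simp
  then show ?thesis by (simp add: e a_def[symmetric] b_def[symmetric])
qed

text \<open>Pointwise approximation by simple functions dominated by a multiple of \<open>f\<close>,
  upgraded by dominated convergence.\<close>

lemma Lp_simple_approx:
  assumes f[measurable]: "f \<in> borel_measurable M" and fin: "pint p M f < \<infinity>" and p: "0 < p"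
  shows "\<exists>s. (\<forall>i. simple_function M (s i) \<and> pint p M (s i) < \<infinity>) \<and>
    (\<lambda>i. pint p M (\<lambda>x. s i x - f x)) \<longlonglongrightarrow> 0"
proof -
  obtain s where s: "\<And>i. simple_function M (s i)" "\<And>x. x \<in> space M \<Longrightarrow> (\<lambda>i. s i x) \<longlonglongrightarrow> f x"
    "\<And>i x. x \<in> space M \<Longrightarrow> dist (s i x) 0 \<le> 2 * dist (f x) 0"
    using borel_measurable_implies_sequence_metric[OF f, of 0] by blast
  have [measurable]: "s i \<in> borel_measurable M" for i using s(1) by (rule borel_measurable_simple_function)
  have bound: "pint p M (\<lambda>x. of_real c * f x) < \<infinity>" for c
    using pint_scale[OF f] fin by (simp add: ennreal_mult_less_top)
  have "pint p M (s i) \<le> pint p M (\<lambda>x. of_real 2 * f x)" for i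
    unfolding pint_def using s(3)[of _ i] p
    by (intro nn_integral_mono ennreal_leI powr_mono2) (auto simp: norm_mult)
  then have "pint p M (s i) < \<infinity>" for i using bound le_less_trans by blast
  moreover have "(\<lambda>i. pint p M (\<lambda>x. s i x - f x)) \<longlonglongrightarrow> (\<integral>\<^sup>+x. 0 \<partial>M)"
    unfolding pint_def
  \<comment> \<open>The factor 3 in the majorant is 2 + 1: \<open>s i\<close> is bounded by twice
    the modulus of \<open>f\<close>, and \<open>f\<close> itself is subtracted.\<close>
  proof (rule nn_integral_dominated_convergence)
    show "(\<integral>\<^sup>+x. ennreal (cmod (of_real 3 * f x) powr p) \<partial>M) < \<infinity>" using bound[of 3] by (simp add: pint_def)
    show "AE x in M. ennreal (cmod (s i x - f x) powr p) \<le> ennreal (cmod (of_real 3 * f x) powr p)" for i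
    proof (rule AE_I2)
      fix x assume x: "x \<in> space M"
      have "cmod (s i x - f x) \<le> cmod (s i x) + cmod (f x)" by (rule norm_triangle_ineq4)
      also have "\<dots> \<le> cmod (of_real 3 * f x)" using s(3)[OF x, of i] by (simp add: norm_mult)
      finally show "ennreal (cmod (s i x - f x) powr p) \<le> ennreal (cmod (of_real 3 * f x) powr p)"
        using p by (intro ennreal_leI powr_mono2) auto
    qed
    show "AE x in M. (\<lambda>i. ennreal (cmod (s i x - f x) powr p)) \<longlonglongrightarrow> 0"
    proof (rule AE_I2)
      fix x assume x: "x \<in> space M"
      have "(\<lambda>i. cmod (s i x - f x)) \<longlonglongrightarrow> 0"
        using s(2)[OF x] by (simp add: LIM_zero tendsto_norm_zero)
      then have "(\<lambda>i. cmod (s i x - f x) powr p) \<longlonglongrightarrow> 0 powr p"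
        using p by (intro tendsto_powr2 tendsto_const) auto
      then show "(\<lambda>i. ennreal (cmod (s i x - f x) powr p)) \<longlonglongrightarrow> 0"
        by (metis ennreal_0 powr_0 tendsto_ennrealI)
    qed
  qed auto
  ultimately show ?thesis using s(1) by (intro exI[of _ s]) simp
qed

text \<open>Agreement on indicators spreads to integrable simple functions by linearity, and then to
  L^p because both maps preserve distances and simple functions are dense.\<close>

lemma isometric_iso_eqI:
  assumes T: "isometric_order_iso p M K T" "isometric_order_iso p M K T'" and p: "0 < p"
    and ind: "\<And>A. A \<in> fin_sets M \<Longrightarrow> T (ae_class M (indicator A)) = T' (ae_class M (indicator A))"
    and u: "u \<in> Lp p M"
  shows "T u = T' u"
proof -
  note D = isometric_order_isoD[OF T(1)] and D' = isometric_order_isoD[OF T(2)]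
  define Q where "Q f \<longleftrightarrow> f \<in> borel_measurable M \<and> pint p M f < \<infinity> \<and> T (ae_class M f) = T' (ae_class M f)" for f
  have Q_add: "Q (\<lambda>x. f x + g x)" if f: "Q f" and g: "Q g" for f g
  proof -
    have [measurable]: "f \<in> borel_measurable M" "g \<in> borel_measurable M" using f g by (auto simp: Q_def)
    have F: "ae_class M f \<in> Lp p M" and G: "ae_class M g \<in> Lp p M" using f g by (auto simp: ae_class_in_Lp_iff Q_def)
    have e: "ae_class M (\<lambda>x. f x + g x) = Lp_add M (ae_class M f) (ae_class M g)" by (simp add: Lp_add_ae_class)
    have "ae_class M (\<lambda>x. f x + g x) \<in> Lp p M" unfolding e by (rule Lp_add_closed[OF F G p])
    moreover have "T (ae_class M (\<lambda>x. f x + g x)) = T' (ae_class M (\<lambda>x. f x + g x))"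
      unfolding e D(2)[OF F G] D'(2)[OF F G] using f g by (simp add: Q_def)
    ultimately show ?thesis by (simp add: Q_def ae_class_in_Lp_iff)
  qed
  have Q_scale: "Q (\<lambda>x. c * f x)" if f: "Q f" for f c
  proof -
    have [measurable]: "f \<in> borel_measurable M" using f by (auto simp: Q_def)
    have F: "ae_class M f \<in> Lp p M" using f by (auto simp: ae_class_in_Lp_iff Q_def)
    have e: "ae_class M (\<lambda>x. c * f x) = Lp_scale M c (ae_class M f)" by (simp add: Lp_scale_ae_class)
    have "ae_class M (\<lambda>x. c * f x) \<in> Lp p M" unfolding e by (rule Lp_scale_closed[OF F])
    moreover have "T (ae_class M (\<lambda>x. c * f x)) = T' (ae_class M (\<lambda>x. c * f x))"
      unfolding e D(3)[OF F] D'(3)[OF F] using f by (simp add: Q_def)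
    ultimately show ?thesis by (simp add: Q_def ae_class_in_Lp_iff)
  qed
  have Q_ind: "Q (indicator A)" if A: "A \<in> fin_sets M" for A
  proof -
    have "ennreal (cmod (indicator A x) powr p) = indicator A x" for x
      using p by (auto simp: indicator_def)
    then show ?thesis using A ind[OF A] by (auto simp: Q_def pint_def fin_sets_def)
  qed
  have Q_0: "Q (\<lambda>x. 0)" using Q_scale[OF Q_ind[of "{}"], of 0] by (simp add: fin_sets_def)
  have Q_sum: "Q (\<lambda>x. \<Sum>c\<in>S. c * indicator (A c) x)" if "finite S" "\<And>c. c \<in> S \<Longrightarrow> A c \<in> fin_sets M" for S A
    using that
  proof (induction S)
    case empty
    show ?case by (simp only: sum.empty Q_0)
  next
    case (insert a S)
    have "Q (\<lambda>x. a * indicator (A a) x + (\<Sum>c\<in>S. c * indicator (A c) x))"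
      by (rule Q_add[OF Q_scale[OF Q_ind] insert.IH]) (use insert.prems in auto)
    then show ?case by (simp only: sum.insert[OF insert.hyps])
  qed
  have Q_cong: "Q g" if "Q f" "\<And>x. x \<in> space M \<Longrightarrow> f x = g x" for f g
  proof -
    have "g \<in> borel_measurable M" using that measurable_cong[of M f g] by (auto simp: Q_def)
    moreover have "pint p M g = pint p M f"
      unfolding pint_def by (rule nn_integral_cong) (simp add: that(2))
    moreover have "ae_class M g = ae_class M f"
      using that \<open>g \<in> borel_measurable M\<close> by (subst ae_class_eq_iff) (auto simp: Q_def)
    ultimately show ?thesis using that(1) by (simp add: Q_def)
  qed
  have Q_simple: "Q s" if s: "simple_function M s" and fin: "pint p M s < \<infinity>" for s
  proof -
    have sm[measurable]: "s \<in> borel_measurable M" using s by (rule borel_measurable_simple_function)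
    \<comment> \<open>The value 0 is removed because its level set may have infinite measure; all
      other level sets have finite measure.\<close>
    define S where "S = s ` space M - {0}"
    have S: "finite S" using simple_functionD(1)[OF s] by (simp add: S_def)
    have "Q (\<lambda>x. \<Sum>c\<in>S. c * indicator (s -` {c} \<inter> space M) x)"
    proof (rule Q_sum[OF S])
      fix c assume c: "c \<in> S"
      have m: "s -` {c} \<inter> space M \<in> sets M" using simple_functionD(2)[OF s] .
      have "ennreal (cmod c powr p) * emeasure M (s -` {c} \<inter> space M)
          = (\<integral>\<^sup>+x. ennreal (cmod c powr p) * indicator (s -` {c} \<inter> space M) x \<partial>M)"
        using m by (simp add: nn_integral_cmult_indicator)
      also have "\<dots> \<le> pint p M s"
        unfolding pint_def by (intro nn_integral_mono) (auto simp: indicator_def)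
      finally have "ennreal (cmod c powr p) * emeasure M (s -` {c} \<inter> space M) < \<infinity>"
        using fin by (rule le_less_trans)
      moreover have "ennreal (cmod c powr p) \<noteq> 0" using c by (simp add: S_def)
      ultimately show "s -` {c} \<inter> space M \<in> fin_sets M"
        using m by (auto simp: fin_sets_def ennreal_mult_less_top)
    qed
    then show ?thesis
    proof (rule Q_cong)
      fix x assume x: "x \<in> space M"
      have "(\<Sum>c\<in>S. c * indicator (s -` {c} \<inter> space M) x) = (\<Sum>c\<in>S. if c = s x then c else 0)"
        using x by (intro sum.cong) (auto simp: indicator_def)
      also have "\<dots> = s x" using S x by (simp add: S_def)
      finally show "(\<Sum>c\<in>S. c * indicator (s -` {c} \<inter> space M) x) = s x" .
    qed
  qed
  define f where "f = rep u"
  have f[measurable]: "f \<in> borel_measurable M" and fin: "pint p M f < \<infinity>" and uf: "u = ae_class M f"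
    using LpD[OF u] by (auto simp: f_def)
  obtain s where s: "\<And>i. simple_function M (s i)" "\<And>i. pint p M (s i) < \<infinity>"
    and lim: "(\<lambda>i. pint p M (\<lambda>x. s i x - f x)) \<longlonglongrightarrow> 0"
    using Lp_simple_approx[OF f fin p] by blast
  have sm[measurable]: "s i \<in> borel_measurable M" for i using s(1) by (rule borel_measurable_simple_function)
  define a where "a = rep (T u)"
  define b where "b = rep (T' u)"
  define c where "c i = rep (T (ae_class M (s i)))" for i
  have [measurable]: "a \<in> borel_measurable K" "b \<in> borel_measurable K" "c i \<in> borel_measurable K" for i
    using LpD[OF D(1)[OF u]] LpD[OF D'(1)[OF u]] LpD[OF D(1)] s(2) sm
    by (auto simp: a_def b_def c_def ae_class_in_Lp_iff)
  have c': "c i = rep (T' (ae_class M (s i)))" for i using Q_simple[OF s(1,2)] by (simp add: c_def Q_def)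
  \<comment> \<open>The two images of \<open>u\<close> are compared through the common image
    \<open>c i\<close> of a simple function.\<close>
  have le: "pint p K (\<lambda>y. a y - b y) \<le> ennreal (2 powr p) * (pint p M (\<lambda>x. s i x - f x) + pint p M (\<lambda>x. s i x - f x))" for i
  proof -
    have ac: "pint p K (\<lambda>y. c i y - a y) = pint p M (\<lambda>x. s i x - f x)"
      unfolding a_def c_def uf by (rule pint_iso_diff[OF T(1) p sm s(2) f fin])
    have bc: "pint p K (\<lambda>y. c i y - b y) = pint p M (\<lambda>x. s i x - f x)"
      unfolding b_def c' uf by (rule pint_iso_diff[OF T(2) p sm s(2) f fin])
    have "pint p K (\<lambda>y. a y - b y) = pint p K (\<lambda>y. (c i y - b y) - (c i y - a y))" by simp
    also have "\<dots> \<le> ennreal (2 powr p) * (pint p K (\<lambda>y. c i y - b y) + pint p K (\<lambda>y. c i y - a y))"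
      by (rule pint_diff_le) (use p in auto)
    finally show ?thesis by (simp add: ac bc)
  qed
  have "(\<lambda>i. ennreal (2 powr p) * (pint p M (\<lambda>x. s i x - f x) + pint p M (\<lambda>x. s i x - f x))) \<longlonglongrightarrow> ennreal (2 powr p) * (0 + 0)"
    by (intro tendsto_intros lim ennreal_tendsto_cmult) auto
  then have "pint p K (\<lambda>y. a y - b y) \<le> 0"
    using le by (intro LIMSEQ_le_const[of _ 0]) auto
  then have "AE y in K. a y - b y = 0" by (subst (asm) le_zero_eq, subst (asm) pint_eq_0_iff) auto
  then have "AE y in K. a y = b y" by simp
  then have "ae_class K a = ae_class K b" by (subst ae_class_eq_iff) auto
  then show ?thesis using LpD(3)[OF D(1)[OF u]] LpD(3)[OF D'(1)[OF u]] by (simp add: a_def b_def)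
qed

context set_iso begin

abbreviation "K \<equiv> transport M N \<Lambda>"

lemma sets_K: "sets K \<subseteq> sets N"
  using sigma_co_sets_sets by (auto simp: sets_transport)

lemma sigma_fin_in_sets_K: "B \<in> sigma_fin_sets N \<Longrightarrow> B \<in> sets K"
  by (simp add: sets_transport sigma_co_sets_def)

lemma emeasure_K:
  assumes "A \<in> sigma_fin_sets M" "B \<in> sigma_fin_sets N" "AE y in N. y \<in> \<Lambda> A \<longleftrightarrow> y \<in> B"
  shows "emeasure K B = emeasure M A"
  by (rule emeasure_transport[OF iso assms(1,2)])
    (use assms \<Lambda>_sets[OF assms(1)] sigma_fin_sets_sets[OF assms(2)] in \<open>simp add: ess_eq_iff_AE\<close>)

text \<open>A null set for \<open>N\<close> is \<sigma>-finite and the image of a null set.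
  Conversely a null set for \<open>K\<close> must be \<sigma>-finite for \<open>N\<close>, since all
  other sets have infinite \<open>K\<close>-measure. Hence a.e. statements for \<open>K\<close> and
  \<open>N\<close> are interchangeable despite the different \<sigma>-algebras.\<close>

lemma null_sets_K: "null_sets K = null_sets N"
proof (intro subset_antisym subsetI)
  fix B assume B: "B \<in> null_sets N"
  then have Bs: "B \<in> sigma_fin_sets N" by (rule null_sigma_fin)
  have "AE y in N. y \<notin> \<Lambda> {}" by (subst \<Lambda>_null_iff) (auto simp: sigma_fin_sets_empty)
  then have "AE y in N. y \<in> \<Lambda> {} \<longleftrightarrow> y \<in> B" using AE_not_in[OF B] by eventually_elim auto
  then have "emeasure K B = emeasure M {}" by (intro emeasure_K sigma_fin_sets_empty Bs)
  then show "B \<in> null_sets K" using sigma_fin_in_sets_K[OF Bs] by (simp add: null_sets_def)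
next
  fix B assume B: "B \<in> null_sets K"
  then have Bs: "B \<in> sigma_fin_sets N"
    using emeasure_transport_infinite[OF iso, of B] by (auto simp: null_sets_def sets_transport)
  obtain A where A: "A \<in> sigma_fin_sets M" "AE y in N. y \<in> \<Lambda> A \<longleftrightarrow> y \<in> B" using \<Lambda>_surj[OF Bs] by blast
  have "emeasure M A = 0" using emeasure_K[OF A(1) Bs A(2)] B by (simp add: null_sets_def)
  then have "AE y in N. y \<notin> \<Lambda> A"
    using sigma_fin_sets_sets[OF A(1)] AE_not_in[of A M] unfolding \<Lambda>_null_iff[OF A(1)] by (simp add: null_sets_def)
  then have "AE y in N. y \<notin> B" using A(2) by eventually_elim auto
  then show "B \<in> null_sets N" using AE_iff_null_sets[OF sigma_fin_sets_sets[OF Bs]] by simp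
qed

lemma AE_K: "(AE y in K. P y) \<longleftrightarrow> (AE y in N. P y)"
  by (simp add: eventually_ae_filter null_sets_K space_transport)

text \<open>Sets outside \<open>sigma_fin_sets N\<close> have infinite \<open>K\<close>-measure.
  Conversely a \<sigma>-finite \<open>B\<close> is covered, up to a null set, by images of sets of
  finite measure.\<close>

lemma sigma_fin_sets_K: "sigma_fin_sets K = sigma_fin_sets N"
proof (intro subset_antisym subsetI)
  fix B assume "B \<in> sigma_fin_sets K"
  then obtain F :: "nat \<Rightarrow> 'b set" where F: "B = (\<Union>n. F n)" "range F \<subseteq> fin_sets K"
    unfolding sigma_fin_sets_def by blast
  have "F n \<in> sigma_fin_sets N" for n
  proof -
    have "F n \<in> sigma_co_sets N" "emeasure K (F n) < \<infinity>" using F(2) by (auto simp: fin_sets_def sets_transport)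
    then show ?thesis using emeasure_transport_infinite[OF iso, of "F n"] by (metis less_irrefl)
  qed
  then show "B \<in> sigma_fin_sets N" unfolding F(1) by (rule sigma_fin_sets_UN)
next
  fix B assume B: "B \<in> sigma_fin_sets N"
  obtain A where A: "A \<in> sigma_fin_sets M" "AE y in N. y \<in> \<Lambda> A \<longleftrightarrow> y \<in> B" using \<Lambda>_surj[OF B] by blast
  obtain F :: "nat \<Rightarrow> 'a set" where F: "A = (\<Union>n. F n)" "range F \<subseteq> fin_sets M"
    using A(1) unfolding sigma_fin_sets_def by blast
  have Fs: "F n \<in> sigma_fin_sets M" for n using F fin_sigma_fin by blast
  have "\<Lambda> (F n) \<in> fin_sets K" for n
    using emeasure_K[OF Fs \<Lambda>_in[OF Fs], of n n] F(2) sigma_fin_in_sets_K[OF \<Lambda>_in[OF Fs], of n]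
    by (auto simp: fin_sets_def)
  then have U: "(\<Union>n. \<Lambda> (F n)) \<in> sigma_fin_sets K" by (intro sigma_fin_sets_UN fin_sigma_fin)
  have Us: "(\<Union>n. \<Lambda> (F n)) \<in> sigma_fin_sets N" by (intro sigma_fin_sets_UN \<Lambda>_in Fs)
  have "AE y in N. y \<notin> B - (\<Union>n. \<Lambda> (F n))"
    using \<Lambda>_UN[of F, OF Fs, folded F(1)] A(2) by eventually_elim auto
  then have "B - (\<Union>n. \<Lambda> (F n)) \<in> null_sets N"
    using sigma_fin_sets_sets[OF B] sigma_fin_sets_sets[OF Us] by (subst AE_iff_null_sets) auto
  then have "B - (\<Union>n. \<Lambda> (F n)) \<in> sigma_fin_sets K" using null_sigma_fin null_sets_K by blast
  then have "(\<Union>n. \<Lambda> (F n)) \<union> (B - (\<Union>n. \<Lambda> (F n))) \<in> sigma_fin_sets K" by (rule sigma_fin_sets_Un[OF U])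
  then show "B \<in> sigma_fin_sets K"
    by (rule sigma_fin_sets_subset) (use sigma_fin_in_sets_K[OF B] in auto)
qed

lemma measurable_K: "f \<in> K \<rightarrow>\<^sub>M S \<Longrightarrow> f \<in> N \<rightarrow>\<^sub>M S"
  using sets_K by (auto simp: measurable_def space_transport)

lemma set_iso_K: "set_iso M K \<Lambda>"
proof
  have e: "ess_eq K A B \<longleftrightarrow> ess_eq N A B" if "A \<in> sigma_fin_sets N" "B \<in> sigma_fin_sets N" for A B
    using that by (simp add: ess_eq_iff_AE sigma_fin_in_sets_K sigma_fin_sets_sets AE_K)
  have sub: "sigma_fin_sets N \<subseteq> sets K" using sigma_fin_in_sets_K by blast
  have D: "A - B \<in> sigma_fin_sets N" if "A \<in> sigma_fin_sets N" "B \<in> sigma_fin_sets N" for A B using that by (rule sigma_fin_sets_Diff')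
  have D': "A - B \<in> sigma_fin_sets M" if "A \<in> sigma_fin_sets M" "B \<in> sigma_fin_sets M" for A B using that by (rule sigma_fin_sets_Diff')
  show "regular_set_iso M K (sigma_fin_sets M) (sigma_fin_sets K) \<Lambda>"
    using iso sub unfolding regular_set_iso_def sigma_fin_sets_K space_transport
    by (simp add: e \<Lambda>_in D D' sigma_fin_sets_empty)
qed

text \<open>Into the transported measure \<Lambda> preserves measure, so the density is 1 and the
  general transport becomes the induced isomorphism.\<close>

lemma weighted_iso_K: "0 < p \<Longrightarrow> weighted_iso M K \<Lambda> p (\<lambda>_ _. 1)"
proof (intro weighted_iso.intro set_iso_K weighted_iso_axioms.intro)
  fix A assume A: "A \<in> sigma_fin_sets M"
  show "(\<integral>\<^sup>+y\<in>\<Lambda> A. ennreal 1 \<partial>K) = emeasure M A"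
    using emeasure_K[OF A \<Lambda>_in[OF A]] sigma_fin_in_sets_K[OF \<Lambda>_in[OF A]] by simp
qed auto

text \<open>\<open>lift\<close> with weight 1 has the defining properties, and indicators determine
  an isometric isomorphism; so the definite description is well posed.\<close>

lemma induced_iso_eq:
  assumes "0 < p"
  shows "induced_iso p M N \<Lambda> = weighted_iso.lift M K \<Lambda> p (\<lambda>_ _. 1)"
proof -
  interpret WK: weighted_iso M K \<Lambda> p "\<lambda>_ _. 1" by (rule weighted_iso_K[OF assms])
  have w: "WK.wmult A g = g" for A g by (simp add: WK.wmult_def)
  show ?thesis unfolding induced_iso_def
  proof (rule the_equality)
    show "WK.lift \<in> extensional (Lp p M) \<and> isometric_order_iso p M K WK.lift \<and>
      (\<forall>A\<in>fin_sets M. WK.lift (ae_class M (indicator A)) = ae_class K (indicator (\<Lambda> A)))"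
      using WK.lift_extensional WK.lift_iso WK.lift_indicator by (simp add: w)
  next
    fix T assume T: "T \<in> extensional (Lp p M) \<and> isometric_order_iso p M K T \<and>
      (\<forall>A\<in>fin_sets M. T (ae_class M (indicator A)) = ae_class K (indicator (\<Lambda> A)))"
    show "T = WK.lift"
    proof (rule extensionalityI)
      show "T \<in> extensional (Lp p M)" "WK.lift \<in> extensional (Lp p M)" using T WK.lift_extensional by auto
      have *: "T (ae_class M (indicator A)) = WK.lift (ae_class M (indicator A))" if A: "A \<in> fin_sets M" for A
        unfolding WK.lift_indicator[OF A] w using T A by blast
      fix u assume "u \<in> Lp p M"
      then show "T u = WK.lift u"
        using isometric_iso_eqI[OF conjunct1[OF conjunct2[OF T]] WK.lift_iso assms *] by blast
    qed
  qed
qed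

text \<open>Moves the description of the induced isomorphism from \<open>K\<close> to
  \<open>N\<close>. Only a.e. statements and measurability are involved, and both pass from
  \<open>K\<close> to \<open>N\<close>.\<close>

lemma induced_iso_carried:
  assumes p: "0 < p" and u: "u \<in> Lp p M" and E: "E \<in> sigma_fin_sets M"
    and u0: "AE x in M. x \<notin> E \<longrightarrow> rep u x = 0"
  shows "\<exists>f g. carried E f g \<and> u = ae_class M f \<and> pint p M f < \<infinity> \<and> (AE x in M. f x = rep u x) \<and>
    rep (induced_iso p M N \<Lambda> u) \<in> borel_measurable N \<and>
    (AE y in N. rep (induced_iso p M N \<Lambda> u) y = g y)"
proof -
  interpret WK: weighted_iso M K \<Lambda> p "\<lambda>_ _. 1" by (rule weighted_iso_K[OF p])
  obtain f g where f: "WK.carried E f g" "u = ae_class M f" "pint p M f < \<infinity>" "AE x in M. f x = rep u x"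
    using WK.Lp_carried[OF u E u0] by blast
  note d = WK.carriedD[OF f(1)] and c = WK.corrD[OF WK.carriedD(2)[OF f(1)]]
  have "WK.wmult E g = g" by (simp add: WK.wmult_def)
  then have e: "induced_iso p M N \<Lambda> u = ae_class K g"
    using WK.lift_eq[OF f(1,3)] f(2) by (simp add: induced_iso_eq[OF p])
  have "corr borel f g"
    unfolding corr_def
  proof (intro conjI ballI)
    show "f \<in> borel_measurable M" "g \<in> borel_measurable N" using d(5) measurable_K[OF d(6)] by auto
    fix E C assume "E \<in> sigma_fin_sets M" "C \<in> sets (borel :: complex measure)"
    from c(3)[OF this, unfolded AE_K]
    show "AE y in N. y \<in> \<Lambda> (E \<inter> f -` C) \<longleftrightarrow> y \<in> \<Lambda> E \<and> g y \<in> C" .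
  qed
  then have "carried E f g" unfolding carried_def using d(1,3) d(4)[unfolded AE_K] by blast
  moreover have "AE y in N. rep (ae_class K g) y = g y" using rep_ae_class(2)[OF d(6)] by (simp add: AE_K)
  moreover have "rep (ae_class K g) \<in> borel_measurable N"
    using rep_ae_class(1)[OF d(6)] by (rule measurable_K)
  ultimately show ?thesis using f e by metis
qed

end

section \<open>Isometries of the positive unit sphere\<close>

text \<open>The difference is at most the larger number, and the p-th powers of maximum and minimum
  add up to the right-hand side. Equality therefore forces the minimum to vanish.\<close>

lemma abs_diff_powr_le:
  fixes a b p :: real
  assumes "0 \<le> a" "0 \<le> b" "0 < p"
  shows "\<bar>a - b\<bar> powr p \<le> a powr p + b powr p"
    and "\<bar>a - b\<bar> powr p = a powr p + b powr p \<longleftrightarrow> a = 0 \<or> b = 0"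
proof -
  have *: "\<bar>a - b\<bar> powr p \<le> max a b powr p" using assms by (intro powr_mono2) auto
  have m: "max a b powr p + min a b powr p = a powr p + b powr p" by (auto simp: max_def min_def)
  show "\<bar>a - b\<bar> powr p \<le> a powr p + b powr p"
    using * m powr_ge_zero[of "min a b" p] by linarith
  show "\<bar>a - b\<bar> powr p = a powr p + b powr p \<longleftrightarrow> a = 0 \<or> b = 0"
  proof
    assume "\<bar>a - b\<bar> powr p = a powr p + b powr p"
    then have "min a b powr p = 0" using * m powr_ge_zero[of "min a b" p] by linarith
    then show "a = 0 \<or> b = 0" by (auto simp: min_def split: if_splits)
  qed (use assms in auto)
qed

text \<open>Convexity of x^p for the points \<open>a / l\<close> and \<open>b / (1 - l)\<close> with
  weights \<open>l\<close> and \<open>1 - l\<close>. The free parameter is what later makes the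
  estimate sharp.\<close>

lemma powr_add_le_convex:
  fixes a b l p :: real
  assumes a: "0 \<le> a" and b: "0 \<le> b" and l: "0 < l" "l < 1" and p: "1 \<le> p"
  shows "(a + b) powr p \<le> l powr (1 - p) * a powr p + (1 - l) powr (1 - p) * b powr p"
proof -
  have ge1: "1 \<le> r powr (1 - p)" if "0 < r" "r < 1" for r :: real
  proof -
    have "1 powr (1 - p) \<le> r powr (1 - p)" using that p by (intro powr_mono2') auto
    then show ?thesis by simp
  qed
  have le: "x powr p \<le> r powr (1 - p) * x powr p" if "0 < r" "r < 1" for r x :: real
    using mult_right_mono[OF ge1[OF that], of "x powr p"] by simp
  consider "a = 0" | "b = 0" | "0 < a" "0 < b" using a b by linarith
  then show ?thesis
  proof cases
    case 3
    have split: "r * (x / r) powr p = r powr (1 - p) * x powr p" if "0 < r" "0 < x" for r x :: real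
      using that by (simp add: powr_divide powr_diff)
    have "((1 - (1 - l)) *\<^sub>R (a / l) + (1 - l) *\<^sub>R (b / (1 - l))) powr p
        \<le> (1 - (1 - l)) * (a / l) powr p + (1 - l) * (b / (1 - l)) powr p"
      by (rule convex_onD[OF powr_convex[OF p]]) (use 3 l in auto)
    then show ?thesis using 3 l split[of l a] split[of "1 - l" b] by simp
  qed (use le[of "1 - l" b] le[of l a] l p in auto)
qed

text \<open>A model of the positive unit sphere by real functions that are non-negative everywhere,
  so that pointwise inequalities need no exceptional sets.\<close>

definition psphere :: "real \<Rightarrow> 'a measure \<Rightarrow> ('a \<Rightarrow> real) set" where
  "psphere p M = {f \<in> borel_measurable M. (\<forall>x. 0 \<le> f x) \<and> (\<integral>\<^sup>+x. ennreal (f x powr p) \<partial>M) = 1}"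

lemma psphereD:
  assumes "f \<in> psphere p M"
  shows "f \<in> borel_measurable M" "0 \<le> f x" "(\<integral>\<^sup>+x. ennreal (f x powr p) \<partial>M) = 1"
  using assms by (auto simp: psphere_def)

definition disj :: "'a measure \<Rightarrow> ('a \<Rightarrow> real) \<Rightarrow> ('a \<Rightarrow> real) \<Rightarrow> bool" where
  "disj M f g \<longleftrightarrow> (AE x in M. f x = 0 \<or> g x = 0)"

definition pdist :: "real \<Rightarrow> 'a measure \<Rightarrow> ('a \<Rightarrow> real) \<Rightarrow> ('a \<Rightarrow> real) \<Rightarrow> ennreal" where
  "pdist p M f g = (\<integral>\<^sup>+x. ennreal (\<bar>f x - g x\<bar> powr p) \<partial>M)"

text \<open>The pointwise deficit \<open>d\<close> is non-negative, vanishes exactly where one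
  function does, and has an integral that adds up with \<open>pdist\<close> to 2.\<close>

lemma pdist_eq_2_iff:
  assumes f: "f \<in> psphere p M" and g: "g \<in> psphere p M" and p: "0 < p"
  shows "pdist p M f g = 2 \<longleftrightarrow> disj M f g"
proof -
  note F = psphereD[OF f] and G = psphereD[OF g]
  note [measurable] = F(1) G(1)
  define d where "d x = f x powr p + g x powr p - \<bar>f x - g x\<bar> powr p" for x
  have d0: "0 \<le> d x" for x using abs_diff_powr_le(1)[OF F(2) G(2) p, of x x] by (simp add: d_def)
  have [measurable]: "d \<in> borel_measurable M" unfolding d_def by measurable
  have "pdist p M f g + (\<integral>\<^sup>+x. ennreal (d x) \<partial>M) = (\<integral>\<^sup>+x. ennreal (f x powr p) + ennreal (g x powr p) \<partial>M)"
    unfolding pdist_def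
    by (subst nn_integral_add[symmetric])
      (auto intro!: nn_integral_cong simp: d0 simp flip: ennreal_plus, simp add: d_def)
  also have "\<dots> = 2" using F(3) G(3) by (simp add: nn_integral_add)
  finally have *: "pdist p M f g + (\<integral>\<^sup>+x. ennreal (d x) \<partial>M) = 2" .
  have "pdist p M f g = 2 \<longleftrightarrow> (\<integral>\<^sup>+x. ennreal (d x) \<partial>M) = 0"
  proof
    assume "pdist p M f g = 2"
    then have "2 + (\<integral>\<^sup>+x. ennreal (d x) \<partial>M) = 2 + 0" using * by simp
    then show "(\<integral>\<^sup>+x. ennreal (d x) \<partial>M) = 0" by (subst (asm) ennreal_add_left_cancel) auto
  qed (use * in simp)
  also have "\<dots> \<longleftrightarrow> (AE x in M. d x = 0)"
    by (subst nn_integral_0_iff_AE) (auto simp: d0 ennreal_eq_0_iff order_antisym_conv)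
  also have "\<dots> \<longleftrightarrow> disj M f g"
    unfolding disj_def
  proof (rule AE_iff_AE, rule AE_I2)
    fix x show "d x = 0 \<longleftrightarrow> f x = 0 \<or> g x = 0"
      using abs_diff_powr_le(2)[OF F(2) G(2) p, of x x] by (auto simp: d_def)
  qed
  finally show ?thesis .
qed

lemma psphere_normalize:
  assumes [measurable]: "u \<in> borel_measurable M" and u0: "\<And>x. 0 \<le> u x" and p: "0 < p"
    and c: "(\<integral>\<^sup>+x. ennreal (u x powr p) \<partial>M) = ennreal c" "0 < c"
  shows "(\<lambda>x. u x / c powr (1 / p)) \<in> psphere p M"
proof -
  have "(\<integral>\<^sup>+x. ennreal ((u x / c powr (1 / p)) powr p) \<partial>M) = (\<integral>\<^sup>+x. ennreal (1 / c) * ennreal (u x powr p) \<partial>M)"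
    using u0 c(2) p
    by (intro nn_integral_cong) (simp add: powr_divide powr_powr ennreal_mult'[symmetric])
  also have "\<dots> = ennreal (1 / c) * ennreal c" by (simp add: nn_integral_cmult c)
  also have "\<dots> = 1" using c(2) by (simp add: ennreal_mult'[symmetric])
  finally show ?thesis using u0 by (simp add: psphere_def)
qed

abbreviation mass :: "real \<Rightarrow> 'a measure \<Rightarrow> ('a \<Rightarrow> real) \<Rightarrow> 'a set \<Rightarrow> ennreal" where
  "mass p M f A \<equiv> (\<integral>\<^sup>+x\<in>A. ennreal (f x powr p) \<partial>M)"

lemma psphere_part:
  assumes f: "f \<in> psphere p M" and A: "A \<in> sets M"
  shows "\<exists>s. 0 \<le> s \<and> s \<le> 1 \<and> mass p M f A = ennreal s \<and>
    mass p M f (space M - A) = ennreal (1 - s)"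
proof -
  note F = psphereD[OF f]
  note [measurable] = F(1) A
  let ?a = "mass p M f A" and ?b = "mass p M f (space M - A)"
  have "?a + ?b = (\<integral>\<^sup>+x. ennreal (f x powr p) \<partial>M)"
    by (subst nn_integral_add[symmetric]) (auto intro!: nn_integral_cong simp: indicator_def)
  then have s: "?a + ?b = 1" using F(3) by simp
  then have "?a \<noteq> \<infinity>" "?b \<noteq> \<infinity>" by auto
  then obtain a b where ab: "?a = ennreal a" "?b = ennreal b" "0 \<le> a" "0 \<le> b"
    by (cases ?a; cases ?b) auto
  have "ennreal (a + b) = ennreal 1" using s ab by (simp add: ennreal_plus)
  then have "a + b = 1" using ab by (subst (asm) ennreal_inj) auto
  then show ?thesis using ab by (intro exI[of _ a]) (auto simp: eq_diff_eq[symmetric] add.commute)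
qed

text \<open>Expresses inclusion of supports through disjointness, which an isometry preserves. If
  \<open>f\<close> has mass where \<open>g\<close> vanishes, its normalised restriction there is
  disjoint from \<open>g\<close> but not from \<open>f\<close>.\<close>

lemma support_le_iff:
  assumes f: "f \<in> psphere p M" and g: "g \<in> psphere p M" and p: "0 < p"
  shows "(AE x in M. f x \<noteq> 0 \<longrightarrow> g x \<noteq> 0) \<longleftrightarrow> (\<forall>h\<in>psphere p M. disj M h g \<longrightarrow> disj M h f)"
proof (intro iffI ballI impI)
  fix h assume "AE x in M. f x \<noteq> 0 \<longrightarrow> g x \<noteq> 0" "disj M h g"
  then show "disj M h f" unfolding disj_def by eventually_elim auto
next
  assume *: "\<forall>h\<in>psphere p M. disj M h g \<longrightarrow> disj M h f"
  note F = psphereD[OF f] and G = psphereD[OF g]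
  note [measurable] = F(1) G(1)
  define A where "A = {x \<in> space M. g x = 0}"
  have A[measurable]: "A \<in> sets M" unfolding A_def by measurable
  obtain s where s: "0 \<le> s" "mass p M f A = ennreal s"
    using psphere_part[OF f A] by blast
  have fA: "(\<integral>\<^sup>+x. ennreal ((f x * indicator A x) powr p) \<partial>M) = ennreal s"
    unfolding s(2)[symmetric] using p by (intro nn_integral_cong) (auto simp: indicator_def)
  have "s = 0"
  proof (rule ccontr)
    assume "s \<noteq> 0"
    then have s0: "0 < s" using s by simp
    let ?h = "\<lambda>x. f x * indicator A x / s powr (1 / p)"
    have h: "?h \<in> psphere p M"
      by (rule psphere_normalize) (use F(2) fA s0 p in auto)
    have "disj M ?h g" unfolding disj_def by (rule AE_I2) (auto simp: A_def indicator_def)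
    then have "disj M ?h f" using * h by blast
    then have "AE x in M. f x * indicator A x = 0" unfolding disj_def
      by eventually_elim (use s0 in auto)
    note fA0 = this
    have "(\<integral>\<^sup>+x. ennreal ((f x * indicator A x) powr p) \<partial>M) = (\<integral>\<^sup>+x. 0 \<partial>M)"
      by (rule nn_integral_cong_AE) (use fA0 in \<open>eventually_elim, use p in simp\<close>)
    then show False using fA s0 by simp
  qed
  then have "(\<integral>\<^sup>+x. ennreal ((f x * indicator A x) powr p) \<partial>M) = 0" using fA by simp
  then have "AE x in M. ennreal ((f x * indicator A x) powr p) = 0"
    by (subst (asm) nn_integral_0_iff_AE) auto
  then show "AE x in M. f x \<noteq> 0 \<longrightarrow> g x \<noteq> 0"
    using AE_space by eventually_elim (auto simp: A_def indicator_def split: if_splits)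
qed

text \<open>A \<sigma>-finite measure admits a strictly positive integrable function; take its p-th
  root on \<open>E\<close> and normalise.\<close>

lemma psphere_full_support:
  assumes E: "E \<in> sigma_fin_sets M" and pos: "emeasure M E \<noteq> 0" and p: "0 < p"
  shows "\<exists>f\<in>psphere p M. \<forall>x\<in>space M. f x \<noteq> 0 \<longleftrightarrow> x \<in> E"
proof -
  have Es[measurable]: "E \<in> sets M" by (rule sigma_fin_sets_sets[OF E])
  have sp: "E \<subseteq> space M" by (rule sets.sets_into_space[OF Es])
  then have spR: "space (restrict_space M E) = E" by (auto simp: space_restrict_space)
  obtain F :: "nat \<Rightarrow> 'a set" where F: "E = (\<Union>n. F n)" "range F \<subseteq> fin_sets M"
    using E unfolding sigma_fin_sets_def by blast
  interpret R: sigma_finite_measure "restrict_space M E"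
  proof (standard, intro exI[of _ "range F"] conjI ballI)
    show "range F \<subseteq> sets (restrict_space M E)"
    proof
      fix A assume "A \<in> range F"
      then have "A \<in> sets M" "A \<subseteq> E" using F by (auto simp: fin_sets_def)
      then show "A \<in> sets (restrict_space M E)" using Es sp by (simp add: sets_restrict_space_iff)
    qed
    show "\<Union> (range F) = space (restrict_space M E)" using F(1) spR by simp
    fix A assume "A \<in> range F"
    then show "emeasure (restrict_space M E) A \<noteq> \<infinity>"
      using F by (subst emeasure_restrict_space) (auto simp: fin_sets_def)
  qed auto
  obtain h where h: "h \<in> borel_measurable (restrict_space M E)" "integral\<^sup>N (restrict_space M E) h \<noteq> \<infinity>"
    "\<forall>x\<in>space (restrict_space M E). 0 < h x \<and> h x < \<infinity>"
    using R.Ex_finite_integrable_function by blast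
  define u where "u x = (if x \<in> E then enn2real (h x) powr (1 / p) else 0)" for x
  have m: "(\<lambda>x. enn2real (h x) powr (1 / p)) \<in> borel_measurable (restrict_space M E)"
    using h(1) by measurable
  have [measurable]: "u \<in> borel_measurable M"
    using measurable_restrict_space_iff[of E M 0 borel "\<lambda>x. enn2real (h x) powr (1 / p)"] m Es sp
    by (simp add: u_def[abs_def] Int_absorb2)
  have "(\<integral>\<^sup>+x. ennreal (u x powr p) \<partial>M) = (\<integral>\<^sup>+x\<in>E. h x \<partial>M)"
  proof (rule nn_integral_cong)
    fix x
    show "ennreal (u x powr p) = h x * indicator E x"
    proof (cases "x \<in> E")
      case True
      then have "h x < \<infinity>" using h(3) spR by auto
      then show ?thesis using True p by (simp add: u_def powr_powr)
    qed (simp add: u_def)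
  qed
  also have "\<dots> = integral\<^sup>N (restrict_space M E) h"
    using sp by (subst nn_integral_restrict_space) (auto simp: Int_absorb2)
  finally have "(\<integral>\<^sup>+x. ennreal (u x powr p) \<partial>M) < \<infinity>" using h(2) by (simp add: less_top)
  then obtain c where c: "(\<integral>\<^sup>+x. ennreal (u x powr p) \<partial>M) = ennreal c" "0 \<le> c"
    by (cases "\<integral>\<^sup>+x. ennreal (u x powr p) \<partial>M") auto
  have unn: "0 \<le> u x" for x by (simp add: u_def)
  have u0: "u x \<noteq> 0 \<longleftrightarrow> x \<in> E" for x
  proof (cases "x \<in> E")
    case True
    then have "0 < enn2real (h x)" using h(3) spR by (simp add: enn2real_positive_iff)
    then show ?thesis using True by (simp add: u_def)
  qed (simp add: u_def)
  have "c \<noteq> 0"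
  proof
    assume "c = 0"
    then have "(\<integral>\<^sup>+x. ennreal (u x powr p) \<partial>M) = 0" using c(1) by simp
    then have "AE x in M. ennreal (u x powr p) = 0" by (subst (asm) nn_integral_0_iff_AE) auto
    then have "AE x in M. x \<notin> E" by eventually_elim (use u0 in auto)
    then show False using pos Es by (simp add: AE_iff_null_sets[symmetric] null_sets_def)
  qed
  then have c0: "0 < c" using c(2) by simp
  show ?thesis
  proof (rule bexI)
    show "\<forall>x\<in>space M. u x / c powr (1 / p) \<noteq> 0 \<longleftrightarrow> x \<in> E" using u0 c0 by simp
    show "(\<lambda>x. u x / c powr (1 / p)) \<in> psphere p M"
      by (rule psphere_normalize) (use c c0 p unn in auto)
  qed
qed

text \<open>The \<open>p\<close>-th power of the distance from a point of the sphere to the part of the sphere supported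
  in \<open>A\<close>, as a function of its mass \<open>s\<close> on \<open>A\<close>.\<close>

definition gap :: "real \<Rightarrow> real \<Rightarrow> real" where
  "gap p s = (1 - s powr (1 / p)) powr p + (1 - s)"

lemma gap_strict_anti:
  assumes "0 \<le> s" "s < t" "t \<le> 1" "0 < p"
  shows "gap p t < gap p s"
proof -
  have "s powr (1 / p) \<le> t powr (1 / p)" "t powr (1 / p) \<le> 1 powr (1 / p)"
    using assms by (intro powr_mono2; simp)+
  then have "(1 - t powr (1 / p)) powr p \<le> (1 - s powr (1 / p)) powr p"
    using assms by (intro powr_mono2) auto
  then show ?thesis using assms by (simp add: gap_def)
qed

lemma pdist_split:
  assumes f: "f \<in> psphere p M" and u: "u \<in> psphere p M" and A: "A \<in> sets M" and p: "0 < p"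
    and uA: "AE x in M. u x \<noteq> 0 \<longrightarrow> x \<in> A"
  shows "pdist p M f u = (\<integral>\<^sup>+x\<in>A. ennreal (\<bar>f x - u x\<bar> powr p) \<partial>M) + mass p M f (space M - A)"
    "mass p M u A = 1"
proof -
  note F = psphereD[OF f] and U = psphereD[OF u]
  note [measurable] = F(1) U(1) A
  show "pdist p M f u = (\<integral>\<^sup>+x\<in>A. ennreal (\<bar>f x - u x\<bar> powr p) \<partial>M) + mass p M f (space M - A)"
    unfolding pdist_def
  proof (subst nn_integral_add[symmetric], measurable, rule nn_integral_cong_AE)
    show "AE x in M. ennreal (\<bar>f x - u x\<bar> powr p) =
        ennreal (\<bar>f x - u x\<bar> powr p) * indicator A x + ennreal (f x powr p) * indicator (space M - A) x"
      using uA AE_space by eventually_elim (use F(2) in \<open>auto simp: indicator_def\<close>)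
  qed
  have "mass p M u A = (\<integral>\<^sup>+x. ennreal (u x powr p) \<partial>M)"
    by (rule nn_integral_cong_AE) (use uA in \<open>eventually_elim, use p in \<open>auto simp: indicator_def\<close>\<close>)
  then show "mass p M u A = 1" using U(3) by simp
qed

lemma pdist_zero_mass:
  assumes f: "f \<in> psphere p M" and u: "u \<in> psphere p M" and A: "A \<in> sets M" and p: "0 < p"
    and uA: "AE x in M. u x \<noteq> 0 \<longrightarrow> x \<in> A" and s: "mass p M f A = 0"
  shows "pdist p M f u = ennreal (gap p 0)"
proof -
  note F = psphereD[OF f] and U = psphereD[OF u]
  note [measurable] = F(1) U(1) A
  have "AE x in M. ennreal (f x powr p) * indicator A x = 0"
    using s by (subst (asm) nn_integral_0_iff_AE) auto
  then have "disj M f u" unfolding disj_def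
    using uA by eventually_elim (auto simp: indicator_def split: if_splits)
  then show ?thesis using pdist_eq_2_iff[OF f u p] by (simp add: gap_def)
qed

text \<open>On \<open>A\<close> this is the triangle inequality: \<open>u\<close> has norm 1,
  \<open>f\<close> has norm t = s^(1/p), so the difference has norm at least 1 - t. The part of
  \<open>f\<close> off \<open>A\<close> contributes 1 - s.\<close>

lemma pdist_ge_gap:
  assumes f: "f \<in> psphere p M" and u: "u \<in> psphere p M" and A: "A \<in> sets M" and p: "1 \<le> p"
    and uA: "AE x in M. u x \<noteq> 0 \<longrightarrow> x \<in> A"
    and s: "mass p M f A = ennreal s" "0 \<le> s" "s \<le> 1"
  shows "ennreal (gap p s) \<le> pdist p M f u"
proof -
  have p0: "0 < p" using p by simp
  note F = psphereD[OF f] and U = psphereD[OF u]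
  note [measurable] = F(1) U(1) A
  note split = pdist_split[OF f u A p0 uA]
  have co: "mass p M f (space M - A) = ennreal (1 - s)"
    using psphere_part[OF f A] s by auto
  define t where "t = s powr (1 / p)"
  define I where "I = (\<integral>\<^sup>+x\<in>A. ennreal (\<bar>f x - u x\<bar> powr p) \<partial>M)"
  have t: "0 \<le> t" "t \<le> 1" and tp: "t powr p = s"
    using s p0 powr_mono2[of "1 / p" s 1] by (auto simp: t_def powr_powr)
  \<comment> \<open>The convexity estimate needs \<open>t\<close> strictly between 0 and 1. At 0 the
    functions are disjoint; at 1 the gap is 0.\<close>
  consider "t = 0" | "t = 1" | "0 < t" "t < 1" using t by linarith
  then show ?thesis
  proof cases
    case 1
    then have "s = 0" using tp p0 by simp
    then show ?thesis using pdist_zero_mass[OF f u A p0 uA] s by simp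
  next
    case 2
    then have "s = 1" using tp by simp
    then show ?thesis using p0 by (simp add: gap_def)
  next
    case 3
    have "1 = mass p M u A" using split(2) by simp
    also have "\<dots> \<le> (\<integral>\<^sup>+x. ennreal (t powr (1 - p)) * (ennreal (f x powr p) * indicator A x)
        + ennreal ((1 - t) powr (1 - p)) * (ennreal (\<bar>f x - u x\<bar> powr p) * indicator A x) \<partial>M)"
    proof (rule nn_integral_mono)
      fix x
      have "u x powr p \<le> (f x + \<bar>f x - u x\<bar>) powr p" using U(2)[of x] p0 by (intro powr_mono2) auto
      also have "\<dots> \<le> t powr (1 - p) * f x powr p + (1 - t) powr (1 - p) * \<bar>f x - u x\<bar> powr p"
        by (rule powr_add_le_convex) (use F(2) 3 p in auto)
      finally show "ennreal (u x powr p) * indicator A x \<le> ennreal (t powr (1 - p)) * (ennreal (f x powr p) * indicator A x)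
        + ennreal ((1 - t) powr (1 - p)) * (ennreal (\<bar>f x - u x\<bar> powr p) * indicator A x)"
        by (auto simp: indicator_def ennreal_mult'[symmetric] ennreal_plus[symmetric] ennreal_leI simp del: ennreal_plus)
    qed
    also have "\<dots> = ennreal (t powr (1 - p)) * ennreal s + ennreal ((1 - t) powr (1 - p)) * I"
      unfolding I_def s(1)[symmetric] by (subst nn_integral_add) (auto simp: nn_integral_cmult)
    also have "ennreal (t powr (1 - p)) * ennreal s = ennreal t"
    proof -
      have "t powr (1 - p) * s = t" using 3 by (simp add: tp[symmetric] powr_add[symmetric])
      then show ?thesis by (simp add: ennreal_mult'[symmetric])
    qed
    finally have le: "1 \<le> ennreal t + ennreal ((1 - t) powr (1 - p)) * I" .
    have "ennreal ((1 - t) powr p) \<le> I"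
    proof (cases I)
      case (real i)
      then have "1 \<le> t + (1 - t) powr (1 - p) * i"
        using le t by (simp add: ennreal_mult'[symmetric] ennreal_plus[symmetric] del: ennreal_plus)
      \<comment> \<open>With \<open>l = t\<close> the first term of the estimate is exactly
        \<open>t\<close>; multiplying by \<open>(1 - t) powr (p - 1)\<close> isolates
        \<open>i\<close>.\<close>
      then have "(1 - t) powr (p - 1) * (1 - t) \<le> (1 - t) powr (p - 1) * ((1 - t) powr (1 - p) * i)"
        by (intro mult_left_mono) auto
      also have "\<dots> = i" using 3 by (simp add: powr_add[symmetric] mult.assoc[symmetric])
      also have "(1 - t) powr (p - 1) * (1 - t) = (1 - t) powr p" using 3 by (simp add: powr_diff)
      finally show ?thesis using real by (simp add: ennreal_leI)
    qed simp
    then have "ennreal ((1 - t) powr p) + ennreal (1 - s) \<le> pdist p M f u"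
      unfolding split(1) co I_def[symmetric] by (rule add_right_mono)
    then show ?thesis using s by (simp add: gap_def t_def)
  qed
qed

text \<open>The normalised restriction of \<open>f\<close> to \<open>A\<close> is optimal. For
  \<open>s = 0\<close> there is nothing to normalise and every unit vector supported in
  \<open>A\<close> will do, which is why \<open>A\<close> must be non-null and
  \<sigma>-finite.\<close>

lemma pdist_attains_gap:
  assumes f: "f \<in> psphere p M" and A: "A \<in> sigma_fin_sets M" and A0: "emeasure M A \<noteq> 0" and p: "1 \<le> p"
    and s: "mass p M f A = ennreal s" "0 \<le> s" "s \<le> 1"
  shows "\<exists>u\<in>psphere p M. (AE x in M. u x \<noteq> 0 \<longrightarrow> x \<in> A) \<and> pdist p M f u = ennreal (gap p s)"
proof -
  have p0: "0 < p" using p by simp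
  note F = psphereD[OF f]
  note As[measurable] = sigma_fin_sets_sets[OF A]
  note [measurable] = F(1)
  show ?thesis
  proof (cases "s = 0")
    case True
    obtain u where u: "u \<in> psphere p M" "\<forall>x\<in>space M. u x \<noteq> 0 \<longleftrightarrow> x \<in> A"
      using psphere_full_support[OF A A0 p0] by blast
    have "AE x in M. u x \<noteq> 0 \<longrightarrow> x \<in> A" by (rule AE_I2) (use u(2) in auto)
    then show ?thesis using pdist_zero_mass[OF f u(1) As p0] s True u(1) by auto
  next
    case False
    then have s0: "0 < s" using s by simp
    define t where "t = s powr (1 / p)"
    \<comment> \<open>On \<open>A\<close> the difference from \<open>f\<close> is
      \<open>1 / t - 1\<close> times \<open>f\<close>, whose norm there is \<open>t\<close>; the
      product is 1 - t.\<close>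
    define u where "u x = f x * indicator A x / t" for x
    have t: "0 < t" "t \<le> 1" and tp: "t powr p = s"
      using s s0 p0 powr_mono2[of "1 / p" s 1] by (auto simp: t_def powr_powr)
    have u: "u \<in> psphere p M" unfolding u_def t_def
    proof (rule psphere_normalize)
      show "(\<integral>\<^sup>+x. ennreal ((f x * indicator A x) powr p) \<partial>M) = ennreal s"
        unfolding s(1)[symmetric] using p0 by (intro nn_integral_cong) (auto simp: indicator_def)
    qed (use F(2) s0 p0 in auto)
    have uA: "AE x in M. u x \<noteq> 0 \<longrightarrow> x \<in> A" by (rule AE_I2) (auto simp: u_def indicator_def)
    have "(\<integral>\<^sup>+x\<in>A. ennreal (\<bar>f x - u x\<bar> powr p) \<partial>M) = (\<integral>\<^sup>+x. ennreal ((1 / t - 1) powr p) * (ennreal (f x powr p) * indicator A x) \<partial>M)"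
    proof (rule nn_integral_cong)
      fix x
      have "\<bar>f x - f x / t\<bar> = (1 / t - 1) * f x"
      proof -
        have "f x - f x / t = - ((1 / t - 1) * f x)" by (simp add: algebra_simps)
        moreover have "0 \<le> (1 / t - 1) * f x" using t F(2)[of x] by (intro mult_nonneg_nonneg) auto
        ultimately show ?thesis by linarith
      qed
      then have "\<bar>f x - f x / t\<bar> powr p = (1 / t - 1) powr p * f x powr p"
        using t F(2)[of x] by (simp add: powr_mult)
      then show "ennreal (\<bar>f x - u x\<bar> powr p) * indicator A x = ennreal ((1 / t - 1) powr p) * (ennreal (f x powr p) * indicator A x)"
        by (auto simp: indicator_def u_def ennreal_mult'[symmetric])
    qed
    also have "\<dots> = ennreal ((1 / t - 1) powr p) * ennreal s" unfolding s(1)[symmetric] by (simp add: nn_integral_cmult)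
    also have "\<dots> = ennreal (((1 / t - 1) * t) powr p)"
      using t by (simp add: ennreal_mult'[symmetric] powr_mult tp)
    also have "(1 / t - 1) * t = 1 - t" using t by (simp add: field_simps)
    finally have "(\<integral>\<^sup>+x\<in>A. ennreal (\<bar>f x - u x\<bar> powr p) \<partial>M) = ennreal ((1 - t) powr p)" .
    moreover have "mass p M f (space M - A) = ennreal (1 - s)"
      using psphere_part[OF f As] s by auto
    ultimately have "pdist p M f u = ennreal (gap p s)"
      using pdist_split(1)[OF f u As p0 uA] s by (simp add: gap_def t_def)
    then show ?thesis using u uA by blast
  qed
qed

section \<open>Construction of the set isomorphism from an isometry of the sphere\<close>

locale sphere_isometry =
  fixes p :: real and M :: "'a measure" and N :: "'b measure" and \<phi> :: "('a \<Rightarrow> real) \<Rightarrow> 'b \<Rightarrow> real"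
  assumes p1: "1 \<le> p"
    and maps: "\<And>f. f \<in> psphere p M \<Longrightarrow> \<phi> f \<in> psphere p N"
    and isometry: "\<And>f g. f \<in> psphere p M \<Longrightarrow> g \<in> psphere p M \<Longrightarrow> pdist p N (\<phi> f) (\<phi> g) = pdist p M f g"
    and onto: "\<And>g. g \<in> psphere p N \<Longrightarrow> \<exists>f\<in>psphere p M. AE y in N. \<phi> f y = g y"
begin

lemma p0: "0 < p" using p1 by simp

lemma disj_iff:
  assumes "f \<in> psphere p M" "g \<in> psphere p M"
  shows "disj N (\<phi> f) (\<phi> g) \<longleftrightarrow> disj M f g"
  using pdist_eq_2_iff[OF assms p0] pdist_eq_2_iff[OF maps[OF assms(1)] maps[OF assms(2)] p0] isometry[OF assms]
  by simp

text \<open>By \<open>support_le_iff\<close> both inclusions are statements about disjointness from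
  all sphere elements; surjectivity up to null sets lets \<phi> exchange the two ranges of
  quantification.\<close>

lemma support_iff:
  assumes f: "f \<in> psphere p M" and g: "g \<in> psphere p M"
  shows "(AE y in N. \<phi> f y \<noteq> 0 \<longrightarrow> \<phi> g y \<noteq> 0) \<longleftrightarrow> (AE x in M. f x \<noteq> 0 \<longrightarrow> g x \<noteq> 0)"
proof -
  have cong: "disj N k (\<phi> f) \<longleftrightarrow> disj M h f" if h: "h \<in> psphere p M" "AE y in N. \<phi> h y = k y" and f: "f \<in> psphere p M" for h k f
  proof -
    have "disj N k (\<phi> f) \<longleftrightarrow> disj N (\<phi> h) (\<phi> f)"
      unfolding disj_def by (rule AE_iff_AE) (use h(2) in \<open>eventually_elim, auto\<close>)
    then show ?thesis using disj_iff[OF h(1) f] by simp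
  qed
  have "(\<forall>k\<in>psphere p N. disj N k (\<phi> g) \<longrightarrow> disj N k (\<phi> f)) \<longleftrightarrow> (\<forall>h\<in>psphere p M. disj M h g \<longrightarrow> disj M h f)"
  proof (intro iffI ballI impI)
    fix h assume "\<forall>k\<in>psphere p N. disj N k (\<phi> g) \<longrightarrow> disj N k (\<phi> f)" "h \<in> psphere p M" "disj M h g"
    then show "disj M h f" using maps disj_iff f g by blast
  next
    fix k assume *: "\<forall>h\<in>psphere p M. disj M h g \<longrightarrow> disj M h f" and k: "k \<in> psphere p N" "disj N k (\<phi> g)"
    obtain h where h: "h \<in> psphere p M" "AE y in N. \<phi> h y = k y" using onto[OF k(1)] by blast
    show "disj N k (\<phi> f)" using * k(2) h(1) cong[OF h f] cong[OF h g] by blast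
  qed
  then show ?thesis using support_le_iff[OF f g p0] support_le_iff[OF maps[OF f] maps[OF g] p0] by simp
qed

definition full :: "'a set \<Rightarrow> 'a \<Rightarrow> real" where
  "full E = (SOME f. f \<in> psphere p M \<and> (\<forall>x\<in>space M. f x \<noteq> 0 \<longleftrightarrow> x \<in> E))"

lemma full:
  assumes "E \<in> sigma_fin_sets M" "emeasure M E \<noteq> 0"
  shows "full E \<in> psphere p M" "x \<in> space M \<Longrightarrow> full E x \<noteq> 0 \<longleftrightarrow> x \<in> E"
proof -
  have "\<exists>f. f \<in> psphere p M \<and> (\<forall>x\<in>space M. f x \<noteq> 0 \<longleftrightarrow> x \<in> E)"
    using psphere_full_support[OF assms p0] by blast
  then have "full E \<in> psphere p M \<and> (\<forall>x\<in>space M. full E x \<noteq> 0 \<longleftrightarrow> x \<in> E)"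
    unfolding full_def by (rule someI_ex)
  then show "full E \<in> psphere p M" "x \<in> space M \<Longrightarrow> full E x \<noteq> 0 \<longleftrightarrow> x \<in> E" by auto
qed

text \<open>Null sets need their own clause because no unit vector has null support. For other sets,
  \<open>support_iff\<close> makes the choice of \<open>full E\<close> matter only up to a null
  set.\<close>

definition \<Lambda> :: "'a set \<Rightarrow> 'b set" where
  "\<Lambda> E = (if emeasure M E = 0 then {} else {y \<in> space N. \<phi> (full E) y \<noteq> 0})"

lemma psphere_support:
  assumes "f \<in> psphere q L" "0 < q"
  shows "{x \<in> space L. f x \<noteq> 0} \<in> sigma_fin_sets L"
  using psphereD[OF assms(1)] assms(2) by (intro support_sigma_fin[of _ _ q]) auto

lemma \<Lambda>_in: "E \<in> sigma_fin_sets M \<Longrightarrow> \<Lambda> E \<in> sigma_fin_sets N"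
  using psphere_support[OF maps[OF full(1)] p0] by (auto simp: \<Lambda>_def sigma_fin_sets_empty)

lemma \<Lambda>_iff:
  assumes "E \<in> sigma_fin_sets M" "emeasure M E \<noteq> 0" "y \<in> space N"
  shows "y \<in> \<Lambda> E \<longleftrightarrow> \<phi> (full E) y \<noteq> 0"
  using assms by (simp add: \<Lambda>_def)

lemma support_\<Lambda>:
  assumes f: "f \<in> psphere p M" and E: "E \<in> sigma_fin_sets M"
  shows "(AE y in N. \<phi> f y \<noteq> 0 \<longrightarrow> y \<in> \<Lambda> E) \<longleftrightarrow> (AE x in M. f x \<noteq> 0 \<longrightarrow> x \<in> E)"
proof (cases "emeasure M E = 0")
  case True
  \<comment> \<open>A unit vector is not a.e. zero, so both sides are false when \<open>E\<close> is
    null.\<close>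
  have nz: "\<not> (AE x in L. f x = 0)" if "f \<in> psphere p L" for f and L :: "'c measure"
  proof
    assume z: "AE x in L. f x = 0"
    have "(\<integral>\<^sup>+x. ennreal (f x powr p) \<partial>L) = (\<integral>\<^sup>+x. 0 \<partial>L)"
      by (rule nn_integral_cong_AE) (use z in \<open>eventually_elim, use p0 in simp\<close>)
    then show False using psphereD(3)[OF that] by simp
  qed
  have E0: "AE x in M. x \<notin> E" by (rule AE_notin[OF True sigma_fin_sets_sets[OF E]])
  have "(AE x in M. f x \<noteq> 0 \<longrightarrow> x \<in> E) \<longleftrightarrow> (AE x in M. f x = 0)"
    by (rule AE_iff_AE) (use E0 in \<open>eventually_elim, auto\<close>)
  then show ?thesis using nz[OF f] nz[OF maps[OF f]] True by (simp add: \<Lambda>_def)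
next
  case False
  note g = full[OF E False]
  have "(AE y in N. \<phi> f y \<noteq> 0 \<longrightarrow> y \<in> \<Lambda> E) \<longleftrightarrow> (AE y in N. \<phi> f y \<noteq> 0 \<longrightarrow> \<phi> (full E) y \<noteq> 0)"
    by (rule AE_iff_AE) (rule AE_I2, simp add: \<Lambda>_iff[OF E False])
  also have "\<dots> \<longleftrightarrow> (AE x in M. f x \<noteq> 0 \<longrightarrow> full E x \<noteq> 0)" by (rule support_iff[OF f g(1)])
  also have "\<dots> \<longleftrightarrow> (AE x in M. f x \<noteq> 0 \<longrightarrow> x \<in> E)"
    by (rule AE_iff_AE) (rule AE_I2, simp add: g(2))
  finally show ?thesis .
qed

lemma \<Lambda>_le_iff:
  assumes A: "A \<in> sigma_fin_sets M" and B: "B \<in> sigma_fin_sets M"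
  shows "(AE y in N. y \<in> \<Lambda> A \<longrightarrow> y \<in> \<Lambda> B) \<longleftrightarrow> (AE x in M. x \<in> A \<longrightarrow> x \<in> B)"
proof (cases "emeasure M A = 0")
  case True
  then have "AE x in M. x \<notin> A" by (rule AE_notin[OF _ sigma_fin_sets_sets[OF A]])
  then have "AE x in M. x \<in> A \<longrightarrow> x \<in> B" by eventually_elim auto
  then show ?thesis using True by (simp add: \<Lambda>_def)
next
  case False
  note g = full[OF A False]
  have "(AE y in N. y \<in> \<Lambda> A \<longrightarrow> y \<in> \<Lambda> B) \<longleftrightarrow> (AE y in N. \<phi> (full A) y \<noteq> 0 \<longrightarrow> y \<in> \<Lambda> B)"
    by (rule AE_iff_AE) (rule AE_I2, simp add: \<Lambda>_iff[OF A False])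
  also have "\<dots> \<longleftrightarrow> (AE x in M. full A x \<noteq> 0 \<longrightarrow> x \<in> B)" by (rule support_\<Lambda>[OF g(1) B])
  also have "\<dots> \<longleftrightarrow> (AE x in M. x \<in> A \<longrightarrow> x \<in> B)"
    by (rule AE_iff_AE) (rule AE_I2, simp add: g(2))
  finally show ?thesis .
qed

text \<open>Take a vector with support \<open>B\<close> and pull it back along \<phi>; the support
  of the preimage is the required set.\<close>

lemma \<Lambda>_surj:
  assumes B: "B \<in> sigma_fin_sets N"
  shows "\<exists>A\<in>sigma_fin_sets M. AE y in N. y \<in> \<Lambda> A \<longleftrightarrow> y \<in> B"
proof (cases "emeasure N B = 0")
  case True
  then have "AE y in N. y \<notin> B" by (rule AE_notin[OF _ sigma_fin_sets_sets[OF B]])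
  then have "AE y in N. y \<in> \<Lambda> {} \<longleftrightarrow> y \<in> B" by eventually_elim (simp add: \<Lambda>_def)
  then show ?thesis using sigma_fin_sets_empty by blast
next
  case False
  obtain k where k: "k \<in> psphere p N" "\<forall>y\<in>space N. k y \<noteq> 0 \<longleftrightarrow> y \<in> B"
    using psphere_full_support[OF B False p0] by blast
  obtain f where f: "f \<in> psphere p M" "AE y in N. \<phi> f y = k y" using onto[OF k(1)] by blast
  define A where "A = {x \<in> space M. f x \<noteq> 0}"
  have A: "A \<in> sigma_fin_sets M" unfolding A_def by (rule psphere_support[OF f(1) p0])
  have "emeasure M A \<noteq> 0"
  proof
    assume "emeasure M A = 0"
    from AE_notin[OF this sigma_fin_sets_sets[OF A]] have z: "AE x in M. f x = 0" using AE_space by eventually_elim (simp add: A_def)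
    have "(\<integral>\<^sup>+x. ennreal (f x powr p) \<partial>M) = (\<integral>\<^sup>+x. 0 \<partial>M)"
      by (rule nn_integral_cong_AE) (use z in \<open>eventually_elim, use p0 in simp\<close>)
    then show False using psphereD(3)[OF f(1)] by simp
  qed
  note g = full[OF A this]
  have "AE x in M. f x \<noteq> 0 \<longrightarrow> full A x \<noteq> 0" "AE x in M. full A x \<noteq> 0 \<longrightarrow> f x \<noteq> 0"
    by (rule AE_I2, simp add: g(2), simp add: A_def)+
  then have "AE y in N. \<phi> f y \<noteq> 0 \<longrightarrow> \<phi> (full A) y \<noteq> 0" "AE y in N. \<phi> (full A) y \<noteq> 0 \<longrightarrow> \<phi> f y \<noteq> 0"
    using support_iff f(1) g(1) by blast+
  then have "AE y in N. y \<in> \<Lambda> A \<longleftrightarrow> y \<in> B"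
    using f(2) AE_space
  proof eventually_elim
    case (elim y)
    then show ?case using k(2) \<Lambda>_iff[OF A \<open>emeasure M A \<noteq> 0\<close>, of y] by auto
  qed
  then show ?thesis using A by blast
qed

lemma \<Lambda>_disjoint:
  assumes A: "A \<in> sigma_fin_sets M" and B: "B \<in> sigma_fin_sets M"
  shows "(AE y in N. \<not> (y \<in> \<Lambda> A \<and> y \<in> \<Lambda> B)) \<longleftrightarrow> (AE x in M. \<not> (x \<in> A \<and> x \<in> B))"
proof -
  have null: "AE x in M. x \<notin> E" if "emeasure M E = 0" "E \<in> sigma_fin_sets M" for E
    using that(1) by (rule AE_notin[OF _ sigma_fin_sets_sets[OF that(2)]])
  show ?thesis
  proof (cases "emeasure M A = 0 \<or> emeasure M B = 0")
    case True
    then have "AE x in M. \<not> (x \<in> A \<and> x \<in> B)"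
    proof
      assume "emeasure M A = 0" from null[OF this A] show ?thesis by eventually_elim auto
    next
      assume "emeasure M B = 0" from null[OF this B] show ?thesis by eventually_elim auto
    qed
    moreover have "\<Lambda> A = {} \<or> \<Lambda> B = {}" using True by (auto simp: \<Lambda>_def)
    ultimately show ?thesis by auto
  next
    case False
    then have A0: "emeasure M A \<noteq> 0" and B0: "emeasure M B \<noteq> 0" by auto
    note a = full[OF A A0] and b = full[OF B B0]
    have "(AE y in N. \<not> (y \<in> \<Lambda> A \<and> y \<in> \<Lambda> B)) \<longleftrightarrow> disj N (\<phi> (full A)) (\<phi> (full B))"
      unfolding disj_def
      by (rule AE_iff_AE) (rule AE_I2, simp add: \<Lambda>_iff[OF A A0] \<Lambda>_iff[OF B B0])
    also have "\<dots> \<longleftrightarrow> disj M (full A) (full B)" by (rule disj_iff[OF a(1) b(1)])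
    also have "\<dots> \<longleftrightarrow> (AE x in M. \<not> (x \<in> A \<and> x \<in> B))"
      unfolding disj_def
    proof (rule AE_iff_AE, rule AE_I2)
      fix x assume "x \<in> space M"
      then show "(full A x = 0 \<or> full B x = 0) = (\<not> (x \<in> A \<and> x \<in> B))" using a(2)[of x] b(2)[of x] by blast
    qed
    finally show ?thesis .
  qed
qed

text \<open>Both sides are the largest set below \<open>\<Lambda> A\<close> and disjoint from
  \<open>\<Lambda> B\<close>. For the inclusion from right to left, surjectivity writes the
  difference as an image \<open>\<Lambda> C\<close>, and order and disjointness are reflected to
  \<open>C\<close>.\<close>

lemma \<Lambda>_diff:
  assumes A: "A \<in> sigma_fin_sets M" and B: "B \<in> sigma_fin_sets M"
  shows "AE y in N. y \<in> \<Lambda> (A - B) \<longleftrightarrow> y \<in> \<Lambda> A - \<Lambda> B"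
proof -
  have D: "A - B \<in> sigma_fin_sets M" using A B by (rule sigma_fin_sets_Diff')
  have D': "\<Lambda> A - \<Lambda> B \<in> sigma_fin_sets N"
    using \<Lambda>_in[OF A] \<Lambda>_in[OF B] by (rule sigma_fin_sets_Diff')
  obtain C where C: "C \<in> sigma_fin_sets M" "AE y in N. y \<in> \<Lambda> C \<longleftrightarrow> y \<in> \<Lambda> A - \<Lambda> B"
    using \<Lambda>_surj[OF D'] by blast
  have "AE y in N. y \<in> \<Lambda> C \<longrightarrow> y \<in> \<Lambda> A" using C(2) by eventually_elim auto
  then have 1: "AE x in M. x \<in> C \<longrightarrow> x \<in> A" using \<Lambda>_le_iff[OF C(1) A] by blast
  have "AE y in N. \<not> (y \<in> \<Lambda> C \<and> y \<in> \<Lambda> B)" using C(2) by eventually_elim auto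
  then have 2: "AE x in M. \<not> (x \<in> C \<and> x \<in> B)" using \<Lambda>_disjoint[OF C(1) B] by blast
  from 1 2 have "AE x in M. x \<in> C \<longrightarrow> x \<in> A - B" by eventually_elim auto
  then have 3: "AE y in N. y \<in> \<Lambda> C \<longrightarrow> y \<in> \<Lambda> (A - B)" using \<Lambda>_le_iff[OF C(1) D] by blast
  have "AE y in N. y \<in> \<Lambda> (A - B) \<longrightarrow> y \<in> \<Lambda> A" unfolding \<Lambda>_le_iff[OF D A] by (rule AE_I2) auto
  moreover have "AE y in N. \<not> (y \<in> \<Lambda> (A - B) \<and> y \<in> \<Lambda> B)" unfolding \<Lambda>_disjoint[OF D B] by (rule AE_I2) auto
  ultimately show ?thesis using 3 C(2) by eventually_elim blast
qed

lemma set_iso_\<Lambda>: "set_iso M N \<Lambda>"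
proof
  show "regular_set_iso M N (sigma_fin_sets M) (sigma_fin_sets N) \<Lambda>"
    unfolding regular_set_iso_def
  proof (intro conjI ballI)
    show "ring_of_sets (space N) (sigma_fin_sets N)" "ring_of_sets (space M) (sigma_fin_sets M)"
      by (rule ring_of_sets_sigma_fin_sets)+
    show "sigma_fin_sets N \<subseteq> sets N" "sigma_fin_sets M \<subseteq> sets M" by (auto dest: sigma_fin_sets_sets)
    show "\<Lambda> \<in> sigma_fin_sets M \<rightarrow> sigma_fin_sets N" using \<Lambda>_in by auto
  next
    fix A assume A: "A \<in> sigma_fin_sets M"
    have "\<Lambda> {} = {}" by (simp add: \<Lambda>_def)
    then show "ess_eq N (\<Lambda> A) {} \<longleftrightarrow> ess_eq M A {}"
      using \<Lambda>_le_iff[OF A sigma_fin_sets_empty] sigma_fin_sets_sets[OF A] sigma_fin_sets_sets[OF \<Lambda>_in[OF A]]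
      by (simp add: ess_eq_iff_AE)
  next
    fix A B assume A: "A \<in> sigma_fin_sets M" and B: "B \<in> sigma_fin_sets M"
    have D: "A - B \<in> sigma_fin_sets M" using A B by (rule sigma_fin_sets_Diff')
    note s = \<Lambda>_in[THEN sigma_fin_sets_sets]
    show "ess_eq N (\<Lambda> (A - B)) (\<Lambda> A - \<Lambda> B)"
      unfolding ess_eq_iff_AE[OF s[OF D] sets.Diff[OF s[OF A] s[OF B]]] by (rule \<Lambda>_diff[OF A B])
  next
    fix B assume B: "B \<in> sigma_fin_sets N"
    obtain A where A: "A \<in> sigma_fin_sets M" "AE y in N. y \<in> \<Lambda> A \<longleftrightarrow> y \<in> B" using \<Lambda>_surj[OF B] by blast
    then show "\<exists>A\<in>sigma_fin_sets M. ess_eq N (\<Lambda> A) B"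
      using \<Lambda>_in[OF A(1), THEN sigma_fin_sets_sets] sigma_fin_sets_sets[OF B]
      by (intro bexI[of _ A]) (simp_all add: ess_eq_iff_AE)
  qed
qed

text \<open>\<phi> matches unit vectors supported in \<open>A\<close> with those supported in
  \<open>\<Lambda> A\<close>, so the least distances from \<open>f\<close> and from
  \<open>\<phi> f\<close> agree. Each is \<open>gap\<close> of the respective mass, and
  \<open>gap\<close> is injective.\<close>

lemma mass_eq:
  assumes f: "f \<in> psphere p M" and A: "A \<in> sigma_fin_sets M"
  shows "mass p N (\<phi> f) (\<Lambda> A) = mass p M f A"
proof (cases "emeasure M A = 0")
  case True
  note z = AE_notin[OF True sigma_fin_sets_sets[OF A]]
  have "mass p M f A = (\<integral>\<^sup>+x. 0 \<partial>M)"
    by (rule nn_integral_cong_AE) (use z in \<open>eventually_elim, simp\<close>)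
  then show ?thesis using True by (simp add: \<Lambda>_def)
next
  case A0: False
  note As = sigma_fin_sets_sets[OF A] and Ls = sigma_fin_sets_sets[OF \<Lambda>_in[OF A]]
  have L0: "emeasure N (\<Lambda> A) \<noteq> 0"
  proof
    assume "emeasure N (\<Lambda> A) = 0"
    from AE_notin[OF this Ls] have "AE y in N. y \<in> \<Lambda> A \<longrightarrow> y \<in> \<Lambda> {}" by eventually_elim auto
    then have "AE x in M. x \<notin> A" using \<Lambda>_le_iff[OF A sigma_fin_sets_empty] by simp
    then show False using A0 As AE_iff_null_sets[OF As] by (simp add: null_sets_def)
  qed
  obtain s where s: "0 \<le> s" "s \<le> 1" "mass p M f A = ennreal s"
    using psphere_part[OF f As] by blast
  obtain s' where s': "0 \<le> s'" "s' \<le> 1" "mass p N (\<phi> f) (\<Lambda> A) = ennreal s'"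
    using psphere_part[OF maps[OF f] Ls] by blast
  have gap0: "0 \<le> gap p r" if "r \<le> 1" for r using that by (simp add: gap_def)
  have "gap p s' \<le> gap p s"
  proof -
    obtain u where u: "u \<in> psphere p M" "AE x in M. u x \<noteq> 0 \<longrightarrow> x \<in> A" "pdist p M f u = ennreal (gap p s)"
      using pdist_attains_gap[OF f A A0 p1 s(3,1,2)] by blast
    have "AE y in N. \<phi> u y \<noteq> 0 \<longrightarrow> y \<in> \<Lambda> A" using support_\<Lambda>[OF u(1) A] u(2) by blast
    from pdist_ge_gap[OF maps[OF f] maps[OF u(1)] Ls p1 this s'(3,1,2)]
    show ?thesis using isometry[OF f u(1)] u(3) gap0[OF s(2)] by simp
  qed
  moreover have "gap p s \<le> gap p s'"
  proof -
    obtain k where k: "k \<in> psphere p N" "AE y in N. k y \<noteq> 0 \<longrightarrow> y \<in> \<Lambda> A" "pdist p N (\<phi> f) k = ennreal (gap p s')"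
      using pdist_attains_gap[OF maps[OF f] \<Lambda>_in[OF A] L0 p1 s'(3,1,2)] by blast
    \<comment> \<open>The nearest vector on the side of \<open>N\<close> is only a.e. an image under
      \<phi>, which does not change distances or supports modulo null sets.\<close>
    obtain u where u: "u \<in> psphere p M" "AE y in N. \<phi> u y = k y" using onto[OF k(1)] by blast
    have "AE y in N. \<phi> u y \<noteq> 0 \<longrightarrow> y \<in> \<Lambda> A" using k(2) u(2) by eventually_elim auto
    then have uA: "AE x in M. u x \<noteq> 0 \<longrightarrow> x \<in> A" using support_\<Lambda>[OF u(1) A] by blast
    have "pdist p N (\<phi> f) (\<phi> u) = pdist p N (\<phi> f) k"
      unfolding pdist_def by (rule nn_integral_cong_AE) (use u(2) in \<open>eventually_elim, simp\<close>)
    then show ?thesis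
      using pdist_ge_gap[OF f u(1) As p1 uA s(3,1,2)] isometry[OF f u(1)] k(3) gap0[OF s'(2)] by simp
  qed
  ultimately have "s = s'"
    using gap_strict_anti[of s s' p] gap_strict_anti[of s' s p] s s' p0 by (cases s s' rule: linorder_cases) auto
  then show ?thesis using s s' by simp
qed

end

section \<open>Local densities from the mass identity\<close>

lemma pint_of_real: "(\<And>x. 0 \<le> f x) \<Longrightarrow> pint p M (\<lambda>x. complex_of_real (f x)) = (\<integral>\<^sup>+x. ennreal (f x powr p) \<partial>M)"
  by (simp add: pint_def)

context sphere_isometry begin

sublocale L: set_iso M N \<Lambda> by (rule set_iso_\<Lambda>)

definition full_image :: "'a set \<Rightarrow> 'b \<Rightarrow> complex" where
  "full_image E = (SOME g. \<exists>f. L.carried E f g \<and> (AE x in M. f x = complex_of_real (full E x)))"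

text \<open>If \<open>f\<close> has support \<open>E\<close> and \<open>g\<close> is its image under the point-free transformation given by
  \<open>\<Lambda>\<close>, then the measure transported by \<open>\<Lambda>\<close> has density \<open>(\<phi> f / g) powr p\<close> on \<open>\<Lambda> E\<close>.\<close>

definition weight :: "'a set \<Rightarrow> 'b \<Rightarrow> real" where
  "weight E y = (if emeasure M E = 0 then 0 else cmod (full_image E y) powr (- p) * \<phi> (full E) y powr p)"

lemma full_image:
  assumes E: "E \<in> sigma_fin_sets M" "emeasure M E \<noteq> 0"
  shows "\<exists>f. L.carried E f (full_image E) \<and> (AE x in M. f x = complex_of_real (full E x))"
proof -
  have [measurable]: "full E \<in> borel_measurable M" using full(1)[OF E] psphereD by blast
  have "AE x in M. x \<notin> E \<longrightarrow> complex_of_real (full E x) = 0"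
    by (rule AE_I2) (use full(2)[OF E] in auto)
  then have "\<exists>f g. L.carried E f g \<and> (AE x in M. f x = complex_of_real (full E x))"
    by (intro L.carried_exists E) measurable
  then have "\<exists>g f. L.carried E f g \<and> (AE x in M. f x = complex_of_real (full E x))" by blast
  then show ?thesis unfolding full_image_def by (rule someI_ex)
qed

text \<open>By \<open>mass_eq\<close> the densities \<open>full E\<close> and
  \<open>\<phi> (full E)\<close>, each to the power \<open>p\<close>, define corresponding measures.
  Transporting the modulus to the power \<open>- p\<close> cancels the density on the side of
  \<open>M\<close> and leaves \<mu>.\<close>

lemma weighted_iso_weight: "weighted_iso M N \<Lambda> p weight"
proof (intro weighted_iso.intro set_iso_\<Lambda> weighted_iso_axioms.intro p0)
  fix E assume E: "E \<in> sigma_fin_sets M"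
  show "weight E \<in> borel_measurable N"
  proof (cases "emeasure M E = 0")
    case True
    then show ?thesis by (simp add: weight_def[abs_def])
  next
    case False
    obtain f where "L.carried E f (full_image E)" using full_image[OF E False] by blast
    then have [measurable]: "full_image E \<in> borel_measurable N" by (rule L.carriedD)
    have [measurable]: "\<phi> (full E) \<in> borel_measurable N" using psphereD(1)[OF maps[OF full(1)[OF E False]]] .
    show ?thesis using False by (simp add: weight_def[abs_def])
  qed
next
  fix E y show "0 \<le> weight E y" by (simp add: weight_def)
next
  fix E A assume E: "E \<in> sigma_fin_sets M" and A: "A \<in> sigma_fin_sets M" "A \<subseteq> E"
  note As[measurable] = sigma_fin_sets_sets[OF A(1)]
  show "(\<integral>\<^sup>+y\<in>\<Lambda> A. ennreal (weight E y) \<partial>N) = emeasure M A"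
  proof (cases "emeasure M E = 0")
    case True
    have "emeasure M A \<le> emeasure M E" by (rule emeasure_mono[OF A(2) sigma_fin_sets_sets[OF E]])
    then have "emeasure M A = 0" using True by simp
    then show ?thesis by (simp add: \<Lambda>_def)
  next
    case False
    obtain f where f: "L.carried E f (full_image E)" "AE x in M. f x = complex_of_real (full E x)"
      using full_image[OF E False] by blast
    note S = full(1)[OF E False]
    note [measurable] = psphereD(1)[OF S] psphereD(1)[OF maps[OF S]]
    have "(\<integral>\<^sup>+y\<in>\<Lambda> A. ennreal (weight E y) \<partial>N)
        = (\<integral>\<^sup>+y\<in>\<Lambda> A. ennreal (cmod (full_image E y) powr (- p)) * ennreal (\<phi> (full E) y powr p) \<partial>N)"
      using False by (intro nn_integral_cong) (simp add: weight_def ennreal_mult')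
    also have "\<dots> = (\<integral>\<^sup>+x\<in>A. ennreal (cmod (f x) powr (- p)) * ennreal (full E x powr p) \<partial>M)"
      by (rule L.nn_integral_transport[symmetric, OF L.carriedD(2)[OF f(1)] A(1),
            where F = "\<lambda>z. ennreal (cmod z powr (- p))"])
        (auto simp: mass_eq[OF S])
    also have "\<dots> = (\<integral>\<^sup>+x. indicator A x \<partial>M)"
    proof (rule nn_integral_cong_AE)
      show "AE x in M. ennreal (cmod (f x) powr (- p)) * ennreal (full E x powr p) * indicator A x = indicator A x"
        using f(2) AE_space
      proof eventually_elim
        case (elim x)
        have "full E x \<noteq> 0" "0 \<le> full E x" if "x \<in> A"
          using full(2)[OF E False elim(2)] that A(2) psphereD(2)[OF S] by auto
        then show ?case using elim(1)
          by (auto simp: indicator_def ennreal_mult'[symmetric] powr_add[symmetric])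
      qed
    qed
    also have "\<dots> = emeasure M A" by simp
    finally show ?thesis .
  qed
qed

sublocale W: weighted_iso M N \<Lambda> p weight by (rule weighted_iso_weight)

text \<open>The p-th powers of both sides have the same mass on every \<open>\<Lambda> A\<close>,
  namely that of \<open>f\<close> on \<open>A\<close>. As densities they agree, and non-negativity
  removes the modulus.\<close>

lemma wmult_eq_\<phi>:
  assumes f: "f \<in> psphere p M" and c: "L.carried E f' g" and f': "AE x in M. f' x = complex_of_real (f x)"
  shows "AE y in N. W.wmult E g y = complex_of_real (\<phi> f y)"
proof -
  note d = L.carriedD[OF c]
  note F = psphereD[OF f] and F' = psphereD[OF maps[OF f]]
  have [measurable]: "W.wmult E g \<in> borel_measurable N" using d(1,6) by (rule W.wmult_meas)
  note [measurable] = F(1) F'(1)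
  have fin: "pint p N (W.wmult E g) = 1"
    using W.pint_wmult[OF c] pint_cong_AE[OF f', of p] F(2,3) by (simp add: pint_of_real)
  \<comment> \<open>Joining both supports gives a \<sigma>-finite set, so each measurable subset is
    the image of some \<open>A\<close>; off \<open>B\<close> both functions vanish.\<close>
  define B where "B = {y \<in> space N. W.wmult E g y \<noteq> 0} \<union> {y \<in> space N. \<phi> f y \<noteq> 0}"
  have "{y \<in> space N. W.wmult E g y \<noteq> 0} \<in> sigma_fin_sets N"
    by (rule support_sigma_fin[of _ _ p]) (use fin p0 in \<open>auto simp: pint_def\<close>)
  then have B: "B \<in> sigma_fin_sets N"
    unfolding B_def using psphere_support[OF maps[OF f] p0] by (rule sigma_fin_sets_Un)
  have "AE y in N. y \<in> B \<longrightarrow> ennreal (cmod (W.wmult E g y) powr p) = ennreal (\<phi> f y powr p)"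
  proof (rule set_density_unique)
    show "B \<in> sets N" by (rule sigma_fin_sets_sets[OF B])
    have "(\<integral>\<^sup>+y\<in>B. ennreal (cmod (W.wmult E g y) powr p) \<partial>N) \<le> pint p N (W.wmult E g)"
      unfolding pint_def by (intro nn_integral_mono) (auto simp: indicator_def)
    then show "(\<integral>\<^sup>+y\<in>B. ennreal (cmod (W.wmult E g y) powr p) \<partial>N) < \<infinity>" using fin by (simp add: le_less_trans)
    fix C assume C: "C \<in> sets N" "C \<subseteq> B"
    have Cs: "C \<in> sigma_fin_sets N" by (rule sigma_fin_sets_subset[OF B C])
    obtain A where A: "A \<in> sigma_fin_sets M" "AE y in N. y \<in> \<Lambda> A \<longleftrightarrow> y \<in> C" using \<Lambda>_surj[OF Cs] by blast
    note cong = AE_mem_eq_cong[OF L.\<Lambda>_sets[OF A(1)] C(1) A(2)]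
    have "(\<integral>\<^sup>+x\<in>A. ennreal (cmod (f' x) powr p) \<partial>M) = mass p M f A"
      by (rule nn_integral_cong_AE) (use f' in \<open>eventually_elim, use F(2) in simp\<close>)
    then show "(\<integral>\<^sup>+y\<in>C. ennreal (cmod (W.wmult E g y) powr p) \<partial>N) = mass p N (\<phi> f) C"
      using W.nn_integral_wmult[OF c A(1)] mass_eq[OF f A(1)]
      by (simp add: cong[of "\<lambda>y. ennreal (cmod (W.wmult E g y) powr p)"] cong[of "\<lambda>y. ennreal (\<phi> f y powr p)"])
  qed measurable
  moreover have "AE y in N. W.wmult E g y \<in> \<real>\<^sub>\<ge>\<^sub>0"
    unfolding W.wmult_nonneg_iff[OF c] using f' by eventually_elim (use F(2) in simp)
  ultimately show ?thesis using AE_space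
  proof eventually_elim
    case (elim y)
    show ?case
    proof (cases "y \<in> B")
      case True
      then have "cmod (W.wmult E g y) powr p = \<phi> f y powr p" using elim by simp
      then have "(cmod (W.wmult E g y) powr p) powr (1 / p) = (\<phi> f y powr p) powr (1 / p)" by simp
      then have "cmod (W.wmult E g y) = \<phi> f y" using p0 F'(2) by (simp add: powr_powr)
      then show ?thesis using elim(2) by (auto simp: nonneg_Reals_def)
    next
      case False
      then show ?thesis using elim(3) by (auto simp: B_def)
    qed
  qed
qed

end

section \<open>From functions back to classes\<close>

lemma psphere_class:
  assumes "f \<in> psphere p M" "0 < p"
  shows "ae_class M (\<lambda>x. complex_of_real (f x)) \<in> Lp_pos_sphere p M"
proof -
  note [measurable] = psphereD(1)[OF assms(1)]
  show ?thesis using psphereD[OF assms(1)] assms(2)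
    by (subst ae_class_in_sphere_iff) (auto simp: pint_of_real)
qed

lemma sphere_psphere:
  assumes u: "u \<in> Lp_pos_sphere p M" and p: "0 < p"
  shows "(\<lambda>x. cmod (rep u x)) \<in> psphere p M" "AE x in M. rep u x = complex_of_real (cmod (rep u x))"
    "ae_class M (\<lambda>x. complex_of_real (cmod (rep u x))) = u"
proof -
  note U = sphereD[OF u p]
  note [measurable] = U(1)
  show "(\<lambda>x. cmod (rep u x)) \<in> psphere p M" using U(2) by (simp add: psphere_def pint_def)
  show *: "AE x in M. rep u x = complex_of_real (cmod (rep u x))"
    using U(3) by eventually_elim (auto simp: nonneg_Reals_def)
  have "ae_class M (rep u) = ae_class M (\<lambda>x. complex_of_real (cmod (rep u x)))"
    using * by (subst ae_class_eq_iff) auto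
  then show "ae_class M (\<lambda>x. complex_of_real (cmod (rep u x))) = u" using U(4) by simp
qed

lemma sphere_diff:
  assumes u: "u \<in> Lp_pos_sphere p M" and v: "v \<in> Lp_pos_sphere p M" and p: "0 < p"
  shows "Lp_diff M u v \<in> Lp p M"
    "pint p M (rep (Lp_diff M u v)) = pdist p M (\<lambda>x. cmod (rep u x)) (\<lambda>x. cmod (rep v x))"
proof -
  note U = sphereD[OF u p] and V = sphereD[OF v p]
  note [measurable] = U(1) V(1)
  have e: "Lp_diff M u v = ae_class M (\<lambda>x. rep u x - rep v x)" by (simp add: Lp_diff_def)
  have "pint p M (\<lambda>x. rep u x - rep v x) < \<infinity>"
    by (rule le_less_trans[OF pint_diff_le[OF U(1) V(1) p]]) (simp add: U(2) V(2) ennreal_mult_less_top)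
  then show "Lp_diff M u v \<in> Lp p M" unfolding e by (subst ae_class_in_Lp_iff) auto
  have "pint p M (\<lambda>x. rep u x - rep v x) = pdist p M (\<lambda>x. cmod (rep u x)) (\<lambda>x. cmod (rep v x))"
    unfolding pint_def pdist_def
  proof (rule nn_integral_cong_AE)
    show "AE x in M. ennreal (cmod (rep u x - rep v x) powr p) = ennreal (\<bar>cmod (rep u x) - cmod (rep v x)\<bar> powr p)"
      using sphere_psphere(2)[OF u p] sphere_psphere(2)[OF v p]
    proof eventually_elim
      case (elim x)
      have "rep u x - rep v x = complex_of_real (cmod (rep u x) - cmod (rep v x))"
        using elim by simp
      then show ?case by (metis norm_of_real)
    qed
  qed
  then show "pint p M (rep (Lp_diff M u v)) = pdist p M (\<lambda>x. cmod (rep u x)) (\<lambda>x. cmod (rep v x))"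
    unfolding e by simp
qed

lemma pdist_cong_AE:
  assumes "AE x in M. f x = f' x" "AE x in M. g x = g' x"
  shows "pdist p M f g = pdist p M f' g'"
  unfolding pdist_def by (rule nn_integral_cong_AE) (use assms in \<open>eventually_elim, simp\<close>)

lemma sphere_isometryI:
  assumes p: "1 \<le> p"
    and bij: "bij_betw \<Phi> (Lp_pos_sphere p M) (Lp_pos_sphere p N)"
    and metric: "\<And>f g. f \<in> Lp_pos_sphere p M \<Longrightarrow> g \<in> Lp_pos_sphere p M \<Longrightarrow>
      Lp_norm p N (Lp_diff N (\<Phi> f) (\<Phi> g)) = Lp_norm p M (Lp_diff M f g)"
  shows "sphere_isometry p M N (\<lambda>f y. cmod (rep (\<Phi> (ae_class M (\<lambda>x. complex_of_real (f x)))) y))"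
proof
  have p0: "0 < p" using p by simp
  let ?c = "\<lambda>f. ae_class M (\<lambda>x. complex_of_real (f x))"
  have mem: "\<Phi> u \<in> Lp_pos_sphere p N" if "u \<in> Lp_pos_sphere p M" for u
    using bij that by (auto simp: bij_betw_def)
  show "1 \<le> p" by (rule p)
  show "(\<lambda>y. cmod (rep (\<Phi> (?c f)) y)) \<in> psphere p N" if "f \<in> psphere p M" for f
    by (rule sphere_psphere(1)[OF mem[OF psphere_class[OF that p0]] p0])
  show "pdist p N (\<lambda>y. cmod (rep (\<Phi> (?c f)) y)) (\<lambda>y. cmod (rep (\<Phi> (?c g)) y)) = pdist p M f g"
    if f: "f \<in> psphere p M" and g: "g \<in> psphere p M" for f g
  proof -
    note F = psphere_class[OF f p0] and G = psphere_class[OF g p0]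
    note [measurable] = psphereD(1)[OF f] psphereD(1)[OF g]
    have r: "AE x in M. cmod (rep (?c f) x) = f x" if "f \<in> psphere p M" for f
    proof -
      have "(\<lambda>x. complex_of_real (f x)) \<in> borel_measurable M" using psphereD(1)[OF that] by measurable
      from rep_ae_class(2)[OF this] show ?thesis
        by eventually_elim (use psphereD(2)[OF that] in simp)
    qed
    have "pdist p N (\<lambda>y. cmod (rep (\<Phi> (?c f)) y)) (\<lambda>y. cmod (rep (\<Phi> (?c g)) y))
        = pint p N (rep (Lp_diff N (\<Phi> (?c f)) (\<Phi> (?c g))))"
      by (rule sphere_diff(2)[symmetric, OF mem[OF F] mem[OF G] p0])
    also have "\<dots> = pint p M (rep (Lp_diff M (?c f) (?c g)))"
      using metric[OF F G] Lp_norm_eq_iff[OF sphere_diff(1)[OF mem[OF F] mem[OF G] p0] sphere_diff(1)[OF F G p0] p0]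
      by simp
    also have "\<dots> = pdist p M (\<lambda>x. cmod (rep (?c f) x)) (\<lambda>x. cmod (rep (?c g) x))"
      by (rule sphere_diff(2)[OF F G p0])
    also have "\<dots> = pdist p M f g" by (rule pdist_cong_AE[OF r[OF f] r[OF g]])
    finally show ?thesis .
  qed
  show "\<exists>f\<in>psphere p M. AE y in N. cmod (rep (\<Phi> (?c f)) y) = g y" if g: "g \<in> psphere p N" for g
  proof -
    let ?v = "ae_class N (\<lambda>y. complex_of_real (g y))"
    obtain u where u: "u \<in> Lp_pos_sphere p M" "\<Phi> u = ?v"
      using psphere_class[OF g p0] bij by (metis bij_betw_imp_surj_on imageE)
    note U = sphere_psphere[OF u(1) p0]
    have "(\<lambda>y. complex_of_real (g y)) \<in> borel_measurable N" using psphereD(1)[OF g] by measurable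
    from rep_ae_class(2)[OF this] have "AE y in N. cmod (rep ?v y) = g y"
      by eventually_elim (use psphereD(2)[OF g] in simp)
    then show ?thesis using U(1,3) u(2) by (intro bexI[of _ "\<lambda>x. cmod (rep u x)"]) simp_all
  qed
qed

text \<open>Here \<open>c\<close> is the measure of \<open>A\<close> to the power -1/p. These
  vectors link the sphere with indicators, both for uniqueness of the extension and for recovering
  densities.\<close>

lemma ae_class_indicator_sphere:
  assumes A: "A \<in> fin_sets M" "emeasure M A \<noteq> 0" and p: "0 < p"
  shows "\<exists>c>0. emeasure M A = ennreal (1 / c powr p) \<and>
    ae_class M (\<lambda>x. complex_of_real c * indicator A x) \<in> Lp_pos_sphere p M"
proof -
  have As[measurable]: "A \<in> sets M" and "emeasure M A < \<infinity>" using A(1) by (auto simp: fin_sets_def)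
  then obtain m where m: "emeasure M A = ennreal m" "0 \<le> m" by (cases "emeasure M A") auto
  then have m0: "0 < m" using A(2) by (cases "m = 0") auto
  define c where "c = (1 / m) powr (1 / p)"
  have c: "0 < c" "c powr p = 1 / m" using m0 p by (simp_all add: c_def powr_powr)
  have "pint p M (\<lambda>x. complex_of_real c * indicator A x) = (\<integral>\<^sup>+x. ennreal (1 / m) * indicator A x \<partial>M)"
    unfolding pint_def c(2)[symmetric] using c(1) by (intro nn_integral_cong) (auto simp: indicator_def norm_mult)
  also have "\<dots> = 1" using m m0 by (simp add: nn_integral_cmult_indicator ennreal_mult'[symmetric])
  finally have "pint p M (\<lambda>x. complex_of_real c * indicator A x) = 1" .
  moreover have "AE x in M. complex_of_real c * indicator A x \<in> \<real>\<^sub>\<ge>\<^sub>0"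
    using c(1) by (intro AE_I2) (auto simp: indicator_def)
  ultimately have "ae_class M (\<lambda>x. complex_of_real c * indicator A x) \<in> Lp_pos_sphere p M"
    using p by (subst ae_class_in_sphere_iff) auto
  then show ?thesis using c m by (intro exI[of _ c]) simp
qed

lemma isometric_iso_eq_on_sphere:
  assumes T: "isometric_order_iso p M N T" "isometric_order_iso p M N T'" and p: "0 < p"
    and eq: "\<And>u. u \<in> Lp_pos_sphere p M \<Longrightarrow> T u = T' u" and u: "u \<in> Lp p M"
  shows "T u = T' u"
proof (rule isometric_iso_eqI[OF T p _ u])
  fix A assume A: "A \<in> fin_sets M"
  have As[measurable]: "A \<in> sets M" using A by (auto simp: fin_sets_def)
  note D = isometric_order_isoD(3)[OF T(1)] and D' = isometric_order_isoD(3)[OF T(2)]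
  show "T (ae_class M (indicator A)) = T' (ae_class M (indicator A))"
  proof (cases "emeasure M A = 0")
    case True
    from AE_notin[OF True As] have z: "AE x in M. indicator A x = (0 :: complex)" by eventually_elim simp
    have m: "ae_class M (indicator A :: 'a \<Rightarrow> complex) \<in> Lp p M"
      using pint_cong_AE[OF z, of p] p by (subst ae_class_in_Lp_iff) (auto simp: pint_def)
    have "ae_class M (indicator A :: 'a \<Rightarrow> complex) = ae_class M (\<lambda>x. 0 * indicator A x)"
      using z by (subst ae_class_eq_iff) auto
    \<comment> \<open>The class of a null set equals 0 times itself, so homogeneity alone sends it
      to zero under both maps.\<close>
    then have e: "ae_class M (indicator A :: 'a \<Rightarrow> complex) = Lp_scale M 0 (ae_class M (indicator A))"
      by (simp add: Lp_scale_ae_class)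
    show ?thesis
      using D[OF m, of 0, folded e] D'[OF m, of 0, folded e] by (simp add: Lp_scale_def)
  next
    case False
    obtain c where c: "0 < c" "ae_class M (\<lambda>x. complex_of_real c * indicator A x) \<in> Lp_pos_sphere p M"
      using ae_class_indicator_sphere[OF A False p] by blast
    let ?s = "ae_class M (\<lambda>x. complex_of_real c * indicator A x)"
    have s: "?s \<in> Lp p M" using c(2) sphere_subset_cone cone_subset_Lp by blast
    have e: "ae_class M (indicator A :: 'a \<Rightarrow> complex) = Lp_scale M (complex_of_real (1 / c)) ?s"
      using c(1) by (subst Lp_scale_ae_class) (auto simp: mult.assoc[symmetric])
    show ?thesis unfolding e D[OF s] D'[OF s] eq[OF c(2)] ..
  qed
qed

text \<open>Every measurable subset of a \<sigma>-finite set is \<sigma>-finite, so on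
  \<open>B\<close> the smaller \<sigma>-algebra loses nothing.\<close>

lemma borel_measurable_restrict_sigma_co:
  fixes f :: "'b \<Rightarrow> 'c :: topological_space"
  assumes f: "f \<in> borel_measurable N" and B: "B \<in> sigma_fin_sets N"
  shows "f \<in> borel_measurable (restrict_space (sigma (space N) (sigma_co_sets N)) B)"
proof (rule measurableI)
  interpret sigma_algebra "space N" "sigma_co_sets N" by (rule sigma_algebra_sigma_co_sets)
  have sp: "B \<subseteq> space N" using sigma_fin_sets_sets[OF B] by (rule sets.sets_into_space)
  have s: "sets (sigma (space N) (sigma_co_sets N)) = sigma_co_sets N" by simp
  have co: "A \<in> sigma_co_sets N" if "A \<in> sigma_fin_sets N" for A using that by (simp add: sigma_co_sets_def)
  fix C :: "'c set" assume C: "C \<in> sets borel"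
  have "B \<inter> f -` C \<in> sigma_fin_sets N" by (rule sigma_fin_vimage[OF B f C])
  moreover have "f -` C \<inter> space (restrict_space (sigma (space N) (sigma_co_sets N)) B) = B \<inter> f -` C"
    using sp by (auto simp: space_restrict_space)
  ultimately show "f -` C \<inter> space (restrict_space (sigma (space N) (sigma_co_sets N)) B)
      \<in> sets (restrict_space (sigma (space N) (sigma_co_sets N)) B)"
    using B sp co by (subst sets_restrict_space_iff) (auto simp: s Int_absorb2)
qed simp

context
  fixes p :: real and M :: "'a measure" and N :: "'b measure"
    and \<Phi> :: "('a \<Rightarrow> complex) set \<Rightarrow> ('b \<Rightarrow> complex) set"
  assumes p: "1 \<le> p"
    and bij: "bij_betw \<Phi> (Lp_pos_sphere p M) (Lp_pos_sphere p N)"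
    and metric: "\<And>f g. f \<in> Lp_pos_sphere p M \<Longrightarrow> g \<in> Lp_pos_sphere p M \<Longrightarrow>
      Lp_norm p N (Lp_diff N (\<Phi> f) (\<Phi> g)) = Lp_norm p M (Lp_diff M f g)"
begin

interpretation S: sphere_isometry p M N "\<lambda>f y. cmod (rep (\<Phi> (ae_class M (\<lambda>x. complex_of_real (f x)))) y)"
  by (rule sphere_isometryI[OF p bij metric])

lemma sphere_eq_wmult:
  assumes u: "u \<in> Lp_pos_sphere p M" and c: "S.L.carried E f g" and f: "u = ae_class M f"
  shows "\<Phi> u = ae_class N (S.W.wmult E g)"
proof -
  note U = sphere_psphere[OF u S.p0]
  have Pu: "\<Phi> u \<in> Lp_pos_sphere p N" using bij u by (auto simp: bij_betw_def)
  note V = sphere_psphere[OF Pu S.p0] and dV = sphereD[OF Pu S.p0] and dU = sphereD[OF u S.p0]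
  have "AE x in M. f x = rep u x"
    using f dU(4) ae_class_eq_iff[OF S.L.carriedD(5)[OF c] dU(1)] by simp
  then have "AE x in M. f x = complex_of_real (cmod (rep u x))" using U(2) by eventually_elim simp
  from S.wmult_eq_\<phi>[OF U(1) c this]
  have "AE y in N. S.W.wmult E g y = complex_of_real (cmod (rep (\<Phi> u) y))" unfolding U(3) .
  then have "AE y in N. S.W.wmult E g y = rep (\<Phi> u) y" using V(2) by eventually_elim simp
  then have "ae_class N (S.W.wmult E g) = ae_class N (rep (\<Phi> u))"
    using S.W.wmult_meas[OF S.L.carriedD(1,6)[OF c]] dV(1) by (subst ae_class_eq_iff) auto
  then show ?thesis using dV(4) by simp
qed

lemma lift_eq_on_sphere:
  assumes u: "u \<in> Lp_pos_sphere p M"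
  shows "S.W.lift u = \<Phi> u"
proof -
  obtain E f g where c: "S.L.carried E f g" "u = ae_class M f" "pint p M f < \<infinity>"
    using S.W.Lp_carried'[OF sphereD(5)[OF u S.p0]] by blast
  show ?thesis using sphere_eq_wmult[OF u c(1,2)] S.W.lift_eq[OF c(1,3)] c(2) by simp
qed

lemma sphere_isometry_extends:
  "\<exists>!T. T \<in> extensional (Lp p M) \<and> isometric_order_iso p M N T \<and> (\<forall>f\<in>Lp_pos_sphere p M. T f = \<Phi> f)"
proof (rule ex1I)
  show "S.W.lift \<in> extensional (Lp p M) \<and> isometric_order_iso p M N S.W.lift \<and>
      (\<forall>f\<in>Lp_pos_sphere p M. S.W.lift f = \<Phi> f)"
    using S.W.lift_extensional S.W.lift_iso lift_eq_on_sphere by blast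
next
  fix T assume T: "T \<in> extensional (Lp p M) \<and> isometric_order_iso p M N T \<and> (\<forall>f\<in>Lp_pos_sphere p M. T f = \<Phi> f)"
  show "T = S.W.lift"
  proof (rule extensionalityI)
    show "T \<in> extensional (Lp p M)" "S.W.lift \<in> extensional (Lp p M)" using T S.W.lift_extensional by auto
    fix u assume u: "u \<in> Lp p M"
    have iso: "isometric_order_iso p M N T" using T by blast
    have eq: "T v = S.W.lift v" if "v \<in> Lp_pos_sphere p M" for v using T lift_eq_on_sphere[OF that] that by simp
    show "T u = S.W.lift u" by (rule isometric_iso_eq_on_sphere[OF iso S.W.lift_iso S.p0 eq u])
  qed
qed

lemma sphere_isometry_represents: "\<exists>\<Lambda>. represents p M N \<Phi> \<Lambda>"
proof -
  \<comment> \<open>\<open>weight\<close> is a density for p-th powers, whereas \<open>h\<close>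
    multiplies the functions themselves; hence the root.\<close>
  define h where "h E y = S.weight E y powr (1 / p)" for E y
  have "local_weights M N S.\<Lambda> h"
    unfolding local_weights_def
  proof (intro conjI ballI impI)
    fix E assume E: "E \<in> sigma_fin_sets M"
    have "h E \<in> borel_measurable N" unfolding h_def using S.W.w_meas[OF E] by measurable
    then show "h E \<in> borel_measurable (restrict_space (sigma (space N) (sigma_co_sets N)) (S.\<Lambda> E))"
      using S.\<Lambda>_in[OF E] by (rule borel_measurable_restrict_sigma_co)
    show "0 \<le> h E y" for y by (simp add: h_def)
  next
    fix E F assume "E \<in> sigma_fin_sets M" "F \<in> sigma_fin_sets M"
    from S.W.w_cong[OF this] show "AE y in N. y \<in> S.\<Lambda> E \<inter> S.\<Lambda> F \<longrightarrow> h F y = h E y"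
      by eventually_elim (auto simp: h_def)
  qed
  moreover have "\<Phi> g = ae_class N (\<lambda>y. if y \<in> S.\<Lambda> E
      then rep (induced_iso p M N S.\<Lambda> g) y * complex_of_real (h E y) else 0)"
    if g: "g \<in> Lp_pos_sphere p M" and E: "E \<in> sigma_fin_sets M"
      and null: "emeasure M ({x \<in> space M. rep g x \<noteq> 0} - E) = 0" for g E
  proof -
    have [measurable]: "rep g \<in> borel_measurable M" by (rule sphereD(1)[OF g S.p0])
    have "{x \<in> space M. rep g x \<noteq> 0} - E \<in> sets M" using sigma_fin_sets_sets[OF E] by simp
    from AE_notin[OF null this] have g0: "AE x in M. x \<notin> E \<longrightarrow> rep g x = 0"
      using AE_space by eventually_elim auto
    obtain f k where c: "S.L.carried E f k" "g = ae_class M f"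
      and r: "rep (induced_iso p M N S.\<Lambda> g) \<in> borel_measurable N"
        "AE y in N. rep (induced_iso p M N S.\<Lambda> g) y = k y"
      using S.L.induced_iso_carried[OF S.p0 sphereD(5)[OF g S.p0] E g0] by blast
    note [measurable] = r(1) S.W.w_meas[OF E] S.L.\<Lambda>_sets[OF E]
    have [measurable]: "h E \<in> borel_measurable N" unfolding h_def by measurable
    have "AE y in N. S.W.wmult E k y = (if y \<in> S.\<Lambda> E
        then rep (induced_iso p M N S.\<Lambda> g) y * complex_of_real (h E y) else 0)"
      using r(2) S.L.carriedD(4)[OF c(1)] by eventually_elim (auto simp: S.W.wmult_def h_def)
    then have "ae_class N (S.W.wmult E k) = ae_class N (\<lambda>y. if y \<in> S.\<Lambda> E
        then rep (induced_iso p M N S.\<Lambda> g) y * complex_of_real (h E y) else 0)"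
      using S.W.wmult_meas[OF S.L.carriedD(1,6)[OF c(1)]]
      by (subst ae_class_eq_iff) (assumption, measurable)
    then show ?thesis using sphere_eq_wmult[OF g c] by simp
  qed
  ultimately have "represents p M N \<Phi> S.\<Lambda>" unfolding represents_def using S.L.iso by blast
  then show ?thesis by blast
qed

end

section \<open>Localizable measures\<close>

text \<open>For each threshold \<open>q n\<close>, the essential supremum of the local superlevel
  sets is a global one. By compatibility its trace on \<open>B j\<close> is the superlevel set of
  \<open>f j\<close>, so the supremum over thresholds restores \<open>f j\<close> there.\<close>

lemma localizable_glue:
  fixes f :: "'i \<Rightarrow> 'b \<Rightarrow> ennreal"
  assumes loc: "localizable N"
    and B: "\<And>i. i \<in> I \<Longrightarrow> B i \<in> sets N" and f: "\<And>i. i \<in> I \<Longrightarrow> f i \<in> borel_measurable N"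
    and compat: "\<And>i j. i \<in> I \<Longrightarrow> j \<in> I \<Longrightarrow> AE y in N. y \<in> B i \<and> y \<in> B j \<longrightarrow> f i y = f j y"
  shows "\<exists>k\<in>borel_measurable N. \<forall>i\<in>I. AE y in N. y \<in> B i \<longrightarrow> k y = f i y"
proof -
  obtain q :: "nat \<Rightarrow> ennreal" where q: "\<And>a b. a < b \<Longrightarrow> \<exists>n. a < q n \<and> q n < b"
    using ennreal_dense_sequence by blast
  define G where "G n i = {y \<in> space N. y \<in> B i \<and> q n < f i y}" for n i
  have G: "G n i \<in> sets N" if "i \<in> I" for n i
  proof -
    note [measurable] = B[OF that] f[OF that]
    show ?thesis unfolding G_def by measurable
  qed
  have "\<forall>n. \<exists>S. ess_supremum N (G n ` I) S"
  proof
    fix n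
    have "G n ` I \<subseteq> sets N" using G by auto
    then show "\<exists>S. ess_supremum N (G n ` I) S" using loc unfolding localizable_def by blast
  qed
  then obtain S where S: "\<And>n. ess_supremum N (G n ` I) (S n)" by metis
  have Ss[measurable]: "S n \<in> sets N" for n using S[of n] by (simp add: ess_supremum_def)
  define k where "k y = (SUP n. q n * indicator (S n) y)" for y
  have k: "k \<in> borel_measurable N" unfolding k_def by measurable
  have "AE y in N. y \<in> B j \<longrightarrow> k y = f j y" if j: "j \<in> I" for j
  proof -
    note [measurable] = B[OF j] f[OF j]
    have "AE y in N. y \<in> B j \<longrightarrow> (y \<in> S n \<longleftrightarrow> q n < f j y)" for n
    proof -
      \<comment> \<open>\<open>F\<close> contains everything outside \<open>B j\<close>, so using it
        as an upper bound tests the essential supremum inside \<open>B j\<close> only.\<close>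
      define F where "F = {y \<in> space N. y \<in> B j \<longrightarrow> q n < f j y}"
      have F: "F \<in> sets N" unfolding F_def by measurable
      have "ess_subset N (G n i) F" if i: "i \<in> I" for i
      proof -
        have "AE y in N. y \<in> G n i \<longrightarrow> y \<in> F"
          using compat[OF i j] by eventually_elim (auto simp: G_def F_def)
        then show ?thesis by (simp add: ess_subset_iff_AE[OF G[OF i] F])
      qed
      then have "ess_subset N (S n) F" using S[of n] F unfolding ess_supremum_def by blast
      then have 1: "AE y in N. y \<in> S n \<longrightarrow> y \<in> F" unfolding ess_subset_iff_AE[OF Ss F] .
      have "ess_subset N (G n j) (S n)" using S[of n] j unfolding ess_supremum_def by blast
      then have 2: "AE y in N. y \<in> G n j \<longrightarrow> y \<in> S n" unfolding ess_subset_iff_AE[OF G[OF j] Ss] .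
      from 1 2 AE_space show ?thesis by eventually_elim (auto simp: F_def G_def)
    qed
    then have "AE y in N. \<forall>n. y \<in> B j \<longrightarrow> (y \<in> S n \<longleftrightarrow> q n < f j y)" unfolding AE_all_countable by blast
    then show ?thesis
    proof eventually_elim
      case (elim y)
      show ?case
      proof
        assume y: "y \<in> B j"
        have mem: "y \<in> S n \<longleftrightarrow> q n < f j y" for n using elim y by blast
        show "k y = f j y"
        proof (rule antisym)
          show "k y \<le> f j y" unfolding k_def
            by (rule SUP_least) (simp add: indicator_def mem less_imp_le)
          show "f j y \<le> k y"
          proof (rule dense_le)
            fix b assume "b < f j y"
            then obtain n where n: "b < q n" "q n < f j y" using q by blast
            have "q n * indicator (S n) y \<le> k y" unfolding k_def by (rule SUP_upper) simp
            then show "b \<le> k y" using n mem[of n] by (simp add: indicator_def)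
          qed
        qed
      qed
    qed
  qed
  then show ?thesis using k by blast
qed

lemma semi_finite_null:
  assumes sf: "semi_finite M" and X: "X \<in> sets M"
    and null: "\<And>E. E \<in> sigma_fin_sets M \<Longrightarrow> AE x in M. x \<in> E \<longrightarrow> x \<notin> X"
  shows "AE x in M. x \<notin> X"
proof (rule ccontr)
  assume "\<not> (AE x in M. x \<notin> X)"
  then have "emeasure M X \<noteq> 0" using AE_notin[OF _ X] by blast
  then obtain A where A: "A \<in> fin_sets M" "A \<subseteq> X" "emeasure M A \<noteq> 0"
    using sf X unfolding semi_finite_def by blast
  have As: "A \<in> sets M" using A(1) by (simp add: fin_sets_def)
  have "AE x in M. x \<notin> A" using null[OF fin_sigma_fin[OF A(1)]] by eventually_elim (use A(2) in auto)
  then show False using A(3) As by (simp add: AE_iff_null_sets[symmetric] null_sets_def)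
qed

context set_iso begin

text \<open>Semi-finiteness reduces nullity to \<sigma>-finite sets, and these are images under
  \<Lambda> up to null sets.\<close>

lemma AE_by_images:
  assumes sf: "semi_finite N" and X: "{y \<in> space N. \<not> P y} \<in> sets N"
    and E: "\<And>E. E \<in> sigma_fin_sets M \<Longrightarrow> AE y in N. y \<in> \<Lambda> E \<longrightarrow> P y"
  shows "AE y in N. P y"
proof -
  have "AE y in N. y \<notin> {y \<in> space N. \<not> P y}"
  proof (rule semi_finite_null[OF sf X])
    fix B assume B: "B \<in> sigma_fin_sets N"
    obtain A where A: "A \<in> sigma_fin_sets M" "AE y in N. y \<in> \<Lambda> A \<longleftrightarrow> y \<in> B" using \<Lambda>_surj[OF B] by blast
    show "AE y in N. y \<in> B \<longrightarrow> y \<notin> {y \<in> space N. \<not> P y}" using E[OF A(1)] A(2) by eventually_elim auto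
  qed
  then show ?thesis using AE_space by eventually_elim auto
qed

text \<open>Localizability of \<open>N\<close> defines the image of \<open>A\<close> as the
  essential supremum of the images of its \<sigma>-finite subsets; localizability of
  \<open>M\<close> provides preimages in the same way.\<close>

lemma extends_to_sets:
  assumes M: "localizable M" and N: "localizable N"
  shows "\<exists>\<Lambda>'. regular_set_iso M N (sets M) (sets N) \<Lambda>' \<and> (\<forall>A\<in>sigma_fin_sets M. \<Lambda>' A = \<Lambda> A)"
proof -
  have sfM: "semi_finite M" and sfN: "semi_finite N" using M N by (auto simp: localizable_def)
  define \<A> where "\<A> A = \<Lambda> ` {B \<in> sigma_fin_sets M. B \<subseteq> A}" for A
  have sup: "\<exists>S. ess_supremum N (\<A> A) S" for A
  proof -
    have "\<A> A \<subseteq> sets N" using \<Lambda>_sets by (auto simp: \<A>_def)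
    then show ?thesis using N unfolding localizable_def by blast
  qed
  \<comment> \<open>Keeping \<Lambda> on \<sigma>-finite sets makes the extension literal rather
    than only up to null sets.\<close>
  define \<Lambda>' where "\<Lambda>' A = (if A \<in> sigma_fin_sets M then \<Lambda> A else SOME S. ess_supremum N (\<A> A) S)" for A
  have S: "ess_supremum N (\<A> A) (\<Lambda>' A)" if "A \<notin> sigma_fin_sets M" for A
    using someI_ex[OF sup[of A]] that by (simp add: \<Lambda>'_def)
  have \<Lambda>'_sets: "\<Lambda>' A \<in> sets N" for A
    using S[of A] \<Lambda>_sets[of A] by (cases "A \<in> sigma_fin_sets M") (auto simp: \<Lambda>'_def ess_supremum_def)
  have I: "A \<inter> E \<in> sigma_fin_sets M" if "E \<in> sigma_fin_sets M" "A \<in> sets M" for A E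
    using sigma_fin_sets_Int[OF that] by (simp add: Int_commute)
  \<comment> \<open>On \<open>\<sigma>\<close>-finite pieces \<open>\<Lambda>'\<close> is given by \<open>\<Lambda>\<close>; by semi-finiteness these pieces determine it.\<close>
  have key: "AE y in N. y \<in> \<Lambda> E \<longrightarrow> (y \<in> \<Lambda>' A \<longleftrightarrow> y \<in> \<Lambda> (A \<inter> E))"
    if A: "A \<in> sets M" and E: "E \<in> sigma_fin_sets M" for A E
  proof (cases "A \<in> sigma_fin_sets M")
    case True
    then have L: "\<Lambda>' A = \<Lambda> A" by (simp add: \<Lambda>'_def)
    show ?thesis using \<Lambda>_inter[OF True E] unfolding L by eventually_elim auto
  next
    case False
    note AE = I[OF E A]
    \<comment> \<open>An upper bound that is trivial off \<open>\<Lambda> E\<close> and sharp on it,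
      so it bounds the essential supremum within \<open>\<Lambda> E\<close>.\<close>
    define F where "F = (space N - \<Lambda> E) \<union> \<Lambda> (A \<inter> E)"
    have F: "F \<in> sets N" using \<Lambda>_sets[OF E] \<Lambda>_sets[OF AE] by (simp add: F_def sets.Un sets.compl_sets)
    have "ess_subset N D F" if "D \<in> \<A> A" for D
    proof -
      obtain B where B: "B \<in> sigma_fin_sets M" "B \<subseteq> A" "D = \<Lambda> B" using \<open>D \<in> \<A> A\<close> by (auto simp: \<A>_def)
      have "AE y in N. y \<in> \<Lambda> (B \<inter> E) \<longrightarrow> y \<in> \<Lambda> (A \<inter> E)"
        by (rule \<Lambda>_mono[OF I[OF E sigma_fin_sets_sets[OF B(1)]] AE]) (use B(2) in auto)
      then have "AE y in N. y \<in> D \<longrightarrow> y \<in> F"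
        using \<Lambda>_inter[OF B(1) E] AE_space by eventually_elim (auto simp: F_def B(3))
      then show ?thesis using ess_subset_iff_AE[OF _ F, of D] \<Lambda>_sets[OF B(1)] B(3) by simp
    qed
    then have "ess_subset N (\<Lambda>' A) F" using S[OF False] F unfolding ess_supremum_def by blast
    then have 1: "AE y in N. y \<in> \<Lambda>' A \<longrightarrow> y \<in> F" unfolding ess_subset_iff_AE[OF \<Lambda>'_sets F] .
    have "\<Lambda> (A \<inter> E) \<in> \<A> A" using AE by (auto simp: \<A>_def)
    then have "ess_subset N (\<Lambda> (A \<inter> E)) (\<Lambda>' A)" using S[OF False] unfolding ess_supremum_def by blast
    then have 2: "AE y in N. y \<in> \<Lambda> (A \<inter> E) \<longrightarrow> y \<in> \<Lambda>' A" unfolding ess_subset_iff_AE[OF \<Lambda>_sets[OF AE] \<Lambda>'_sets] .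
    from 1 2 show ?thesis by eventually_elim (auto simp: F_def)
  qed
  have eqI: "AE y in N. y \<in> X \<longleftrightarrow> y \<in> Y"
    if "X \<in> sets N" "Y \<in> sets N" "\<And>E. E \<in> sigma_fin_sets M \<Longrightarrow> AE y in N. y \<in> \<Lambda> E \<longrightarrow> (y \<in> X \<longleftrightarrow> y \<in> Y)" for X Y
  proof (rule AE_by_images[OF sfN _ that(3)])
    note [measurable] = that(1,2)
    show "{y \<in> space N. (y \<in> X) \<noteq> (y \<in> Y)} \<in> sets N" by measurable
  qed
  have "regular_set_iso M N (sets M) (sets N) \<Lambda>'"
    unfolding regular_set_iso_def
  proof (intro conjI ballI)
    show "ring_of_sets (space M) (sets M)" "ring_of_sets (space N) (sets N)" by (rule sets.ring_of_sets_axioms)+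
    show "\<Lambda>' \<in> sets M \<rightarrow> sets N" using \<Lambda>'_sets by auto
  next
    fix A assume A: "A \<in> sets M"
    show "ess_eq N (\<Lambda>' A) {} \<longleftrightarrow> ess_eq M A {}"
    proof
      assume "ess_eq N (\<Lambda>' A) {}"
      then have z: "AE y in N. y \<notin> \<Lambda>' A" using \<Lambda>'_sets by (simp add: ess_eq_iff_AE)
      have "AE x in M. x \<notin> A"
      proof (rule semi_finite_null[OF sfM A])
        fix E assume E: "E \<in> sigma_fin_sets M"
        note AE = I[OF E A]
        have "AE y in N. y \<notin> \<Lambda> (A \<inter> E)"
          using key[OF A E] z \<Lambda>_mono[OF AE E Int_lower2] by eventually_elim auto
        then have "AE x in M. x \<notin> A \<inter> E" unfolding \<Lambda>_null_iff[OF AE] .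
        then show "AE x in M. x \<in> E \<longrightarrow> x \<notin> A" by eventually_elim auto
      qed
      then show "ess_eq M A {}" using A by (simp add: ess_eq_iff_AE)
    next
      assume "ess_eq M A {}"
      then have z: "AE x in M. x \<notin> A" using A by (simp add: ess_eq_iff_AE)
      then have "A \<in> null_sets M" using A by (simp add: AE_iff_null_sets)
      then have As: "A \<in> sigma_fin_sets M" by (rule null_sigma_fin)
      have "AE y in N. y \<notin> \<Lambda> A" using z unfolding \<Lambda>_null_iff[OF As] .
      then show "ess_eq N (\<Lambda>' A) {}" using \<Lambda>_sets[OF As] As by (simp add: ess_eq_iff_AE \<Lambda>'_def)
    qed
  next
    fix A B assume A: "A \<in> sets M" and B: "B \<in> sets M"
    have D: "A - B \<in> sets M" using A B by (rule sets.Diff)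
    have D': "\<Lambda>' A - \<Lambda>' B \<in> sets N" using \<Lambda>'_sets \<Lambda>'_sets by (rule sets.Diff)
    have "AE y in N. y \<in> \<Lambda>' (A - B) \<longleftrightarrow> y \<in> \<Lambda>' A - \<Lambda>' B"
    proof (rule eqI[OF \<Lambda>'_sets D'])
      fix E assume E: "E \<in> sigma_fin_sets M"
      have eq: "(A - B) \<inter> E = A \<inter> E - B \<inter> E" by auto
      show "AE y in N. y \<in> \<Lambda> E \<longrightarrow> (y \<in> \<Lambda>' (A - B) \<longleftrightarrow> y \<in> \<Lambda>' A - \<Lambda>' B)"
        using key[OF D E, unfolded eq] key[OF A E] key[OF B E] \<Lambda>_diff[OF I[OF E A] I[OF E B]]
        by eventually_elim blast
    qed
    then show "ess_eq N (\<Lambda>' (A - B)) (\<Lambda>' A - \<Lambda>' B)" unfolding ess_eq_iff_AE[OF \<Lambda>'_sets D'] .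
  next
    fix B assume B: "B \<in> sets N"
    \<comment> \<open>A preimage of \<open>B\<close> has to contain every \<sigma>-finite set whose
      image lies in \<open>B\<close>; the candidate is the essential supremum of these sets.\<close>
    define \<C> where "\<C> = {C \<in> sigma_fin_sets M. AE y in N. y \<in> \<Lambda> C \<longrightarrow> y \<in> B}"
    have "\<C> \<subseteq> sets M" using sigma_fin_sets_sets by (auto simp: \<C>_def)
    then obtain A where A: "ess_supremum M \<C> A" using M unfolding localizable_def by blast
    have As: "A \<in> sets M" using A by (simp add: ess_supremum_def)
    have "AE y in N. y \<in> \<Lambda>' A \<longleftrightarrow> y \<in> B"
    proof (rule eqI[OF \<Lambda>'_sets B])
      fix E assume E: "E \<in> sigma_fin_sets M"
      note AE = I[OF E As]
      have LB: "\<Lambda> E \<inter> B \<in> sigma_fin_sets N" by (rule sigma_fin_sets_Int[OF \<Lambda>_in[OF E] B])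
      obtain C where C: "C \<in> sigma_fin_sets M" "C \<subseteq> E" "AE y in N. y \<in> \<Lambda> C \<longleftrightarrow> y \<in> \<Lambda> E \<inter> B"
        using \<Lambda>_surj_sub[OF LB E] by blast
      have "AE y in N. y \<in> \<Lambda> C \<longrightarrow> y \<in> B" using C(3) by eventually_elim auto
      then have "C \<in> \<C>" using C(1) by (simp add: \<C>_def)
      then have "ess_subset M C A" using A unfolding ess_supremum_def by blast
      then have "AE x in M. x \<in> C \<longrightarrow> x \<in> A" unfolding ess_subset_iff_AE[OF sigma_fin_sets_sets[OF C(1)] As] .
      then have "AE x in M. x \<in> C \<longrightarrow> x \<in> A \<inter> E" by eventually_elim (use C(2) in auto)
      then have 1: "AE y in N. y \<in> \<Lambda> C \<longrightarrow> y \<in> \<Lambda> (A \<inter> E)" unfolding \<Lambda>_le_iff[OF C(1) AE] .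
      \<comment> \<open>The same localisation on the side of \<open>M\<close>: it shows that inside
        \<open>E\<close> the essential supremum does not exceed \<open>C\<close>.\<close>
      define F where "F = (space M - E) \<union> C"
      have F: "F \<in> sets M" using sigma_fin_sets_sets[OF E] sigma_fin_sets_sets[OF C(1)]
        by (simp add: F_def sets.Un sets.compl_sets)
      have "ess_subset M H F" if "H \<in> \<C>" for H
      proof -
        have H: "H \<in> sigma_fin_sets M" "AE y in N. y \<in> \<Lambda> H \<longrightarrow> y \<in> B" using that by (auto simp: \<C>_def)
        note HE = I[OF E sigma_fin_sets_sets[OF H(1)]]
        have "AE y in N. y \<in> \<Lambda> (H \<inter> E) \<longrightarrow> y \<in> \<Lambda> C"
          using H(2) C(3) \<Lambda>_inter[OF H(1) E] by eventually_elim auto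
        then have "AE x in M. x \<in> H \<inter> E \<longrightarrow> x \<in> C" unfolding \<Lambda>_le_iff[OF HE C(1)] .
        then have "AE x in M. x \<in> H \<longrightarrow> x \<in> F" using AE_space by eventually_elim (auto simp: F_def)
        then show ?thesis unfolding ess_subset_iff_AE[OF sigma_fin_sets_sets[OF H(1)] F] .
      qed
      then have "ess_subset M A F" using A F unfolding ess_supremum_def by blast
      then have "AE x in M. x \<in> A \<longrightarrow> x \<in> F" unfolding ess_subset_iff_AE[OF As F] .
      then have "AE x in M. x \<in> A \<inter> E \<longrightarrow> x \<in> C" by eventually_elim (auto simp: F_def)
      then have 2: "AE y in N. y \<in> \<Lambda> (A \<inter> E) \<longrightarrow> y \<in> \<Lambda> C" unfolding \<Lambda>_le_iff[OF AE C(1)] .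
      show "AE y in N. y \<in> \<Lambda> E \<longrightarrow> (y \<in> \<Lambda>' A \<longleftrightarrow> y \<in> B)"
        using key[OF As E] 1 2 C(3) by eventually_elim blast
    qed
    then have "ess_eq N (\<Lambda>' A) B" unfolding ess_eq_iff_AE[OF \<Lambda>'_sets B] .
    then show "\<exists>A\<in>sets M. ess_eq N (\<Lambda>' A) B" using As by blast
  qed auto
  then show ?thesis by (intro exI[of _ \<Lambda>']) (simp add: \<Lambda>'_def)
qed

text \<open>Monotone convergence along finite unions of pieces of finite measure. Their images
  increase only up to null sets, hence the a.e. form.\<close>

lemma weight_integral_extend:
  assumes E: "E \<in> sigma_fin_sets M" and [measurable]: "u \<in> borel_measurable N"
    and fin: "\<And>A. A \<in> fin_sets M \<Longrightarrow> A \<subseteq> E \<Longrightarrow> (\<integral>\<^sup>+y\<in>\<Lambda> A. u y \<partial>N) = emeasure M A"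
    and A: "A \<in> sigma_fin_sets M" "A \<subseteq> E"
  shows "(\<integral>\<^sup>+y\<in>\<Lambda> A. u y \<partial>N) = emeasure M A"
proof -
  obtain F :: "nat \<Rightarrow> 'a set" where F: "A = (\<Union>n. F n)" "range F \<subseteq> fin_sets M"
    using A(1) unfolding sigma_fin_sets_def by blast
  define G where "G n = (\<Union>i\<le>n. F i)" for n
  have Ff: "F i \<in> fin_sets M" for i using F(2) by auto
  have Gf: "G n \<in> fin_sets M" for n
  proof -
    have "emeasure M (G n) \<le> (\<Sum>i\<le>n. emeasure M (F i))"
      unfolding G_def using Ff by (intro emeasure_subadditive_finite) (auto simp: fin_sets_def)
    also have "\<dots> < \<infinity>" using Ff by (simp add: fin_sets_def)
    finally have "emeasure M (G n) < \<infinity>" .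
    moreover have "G n \<in> sets M" unfolding G_def using Ff by (intro sets.finite_UN) (auto simp: fin_sets_def)
    ultimately show ?thesis by (simp add: fin_sets_def)
  qed
  have Gs: "G n \<in> sigma_fin_sets M" for n by (rule fin_sigma_fin[OF Gf])
  have GA: "A = (\<Union>n. G n)" unfolding F(1) G_def by auto
  have inc: "incseq G" unfolding incseq_def G_def by force
  note [measurable] = \<Lambda>_sets[OF Gs]
  have mono: "AE y in N. y \<in> \<Lambda> (G i) \<longrightarrow> y \<in> \<Lambda> (G (Suc i))" for i
    by (rule \<Lambda>_mono[OF Gs Gs incseq_SucD[OF inc]])
  have "(\<integral>\<^sup>+y\<in>\<Lambda> A. u y \<partial>N) = (\<integral>\<^sup>+y. (SUP n. u y * indicator (\<Lambda> (G n)) y) \<partial>N)"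
  proof (rule nn_integral_cong_AE)
    show "AE y in N. u y * indicator (\<Lambda> A) y = (SUP n. u y * indicator (\<Lambda> (G n)) y)"
      using \<Lambda>_UN[of G, OF Gs, folded GA]
    proof eventually_elim
      case (elim y)
      show ?case
      proof (cases "y \<in> \<Lambda> A")
        case True
        then obtain n where n: "y \<in> \<Lambda> (G n)" using elim by blast
        have "u y \<le> (SUP n. u y * indicator (\<Lambda> (G n)) y)" by (rule SUP_upper2[of n]) (use n in auto)
        moreover have "(SUP n. u y * indicator (\<Lambda> (G n)) y) \<le> u y"
          by (rule SUP_least) (auto simp: indicator_def)
        ultimately show ?thesis using True by (simp add: antisym)
      next
        case False
        then have "y \<notin> \<Lambda> (G n)" for n using elim by blast
        then show ?thesis using False by simp
      qed
    qed
  qed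
  also have "\<dots> = (SUP n. \<integral>\<^sup>+y\<in>\<Lambda> (G n). u y \<partial>N)"
  proof (rule nn_integral_monotone_convergence_SUP_AE)
    show "AE y in N. u y * indicator (\<Lambda> (G i)) y \<le> u y * indicator (\<Lambda> (G (Suc i))) y" for i
      using mono[of i] by eventually_elim (auto simp: indicator_def)
  qed measurable
  also have "\<dots> = (SUP n. emeasure M (G n))"
  proof -
    have "(\<integral>\<^sup>+y\<in>\<Lambda> (G n). u y \<partial>N) = emeasure M (G n)" for n
      by (rule fin[OF Gf]) (use GA A(2) in blast)
    then show ?thesis by simp
  qed
  also have "\<dots> = emeasure M A" unfolding GA
    by (rule SUP_emeasure_incseq[OF _ inc]) (use sigma_fin_sets_sets[OF Gs] in blast)
  finally show ?thesis .
qed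

end

section \<open>Densities of an arbitrary representation\<close>

lemma borel_measurable_from_sigma_co:
  fixes h :: "'b \<Rightarrow> real"
  assumes h: "h \<in> borel_measurable (restrict_space (sigma (space N) (sigma_co_sets N)) B)" and B: "B \<in> sigma_fin_sets N"
  shows "(\<lambda>y. if y \<in> B then h y else 0) \<in> borel_measurable N"
proof -
  interpret sigma_algebra "space N" "sigma_co_sets N" by (rule sigma_algebra_sigma_co_sets)
  let ?S = "sigma (space N) (sigma_co_sets N)"
  have s: "sets ?S = sigma_co_sets N" by simp
  have co: "B \<in> sigma_co_sets N" using B by (simp add: sigma_co_sets_def)
  have sp: "B \<inter> space ?S = B" using sets.sets_into_space[OF sigma_fin_sets_sets[OF B]] by auto
  have "(\<lambda>y. if y \<in> B then h y else 0) \<in> borel_measurable ?S"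
    using measurable_restrict_space_iff[of B ?S 0 borel h] h co by (simp only: sp s) simp
  then show ?thesis using sigma_co_sets_sets unfolding measurable_def s by auto
qed

text \<open>Shows that the p-th power of \<open>h E\<close> is a local density. For \<open>A\<close>
  of finite non-zero measure in \<open>E\<close>, the unit vector \<open>c\<close> times the
  indicator of \<open>A\<close> goes to \<open>c * h E\<close> on \<open>\<Lambda> A\<close>. That
  image again has norm 1, so the p-th power of \<open>h E\<close> integrates over
  \<open>\<Lambda> A\<close> to 1/c^p, the measure of \<open>A\<close>.\<close>

lemma represents_weights:
  assumes rep: "represents p M N \<Phi> \<Lambda>" and p: "1 \<le> p"
    and sphere: "\<And>u. u \<in> Lp_pos_sphere p M \<Longrightarrow> \<Phi> u \<in> Lp_pos_sphere p N"
  shows "\<exists>w. weighted_iso M N \<Lambda> p w \<and>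
    (\<forall>g\<in>Lp_pos_sphere p M. \<forall>E\<in>sigma_fin_sets M. (AE x in M. x \<notin> E \<longrightarrow> rep g x = 0) \<longrightarrow>
      \<Phi> g = ae_class N (\<lambda>y. if y \<in> \<Lambda> E
          then rep (induced_iso p M N \<Lambda> g) y * complex_of_real (w E y powr (1 / p)) else 0))"
proof -
  have p0: "0 < p" using p by simp
  have iso: "regular_set_iso M N (sigma_fin_sets M) (sigma_fin_sets N) \<Lambda>" using rep by (simp add: represents_def)
  interpret set_iso M N \<Lambda> by standard (rule iso)
  obtain h where h: "local_weights M N \<Lambda> h" and \<Phi>: "\<forall>g\<in>Lp_pos_sphere p M. \<forall>E\<in>sigma_fin_sets M.
       emeasure M ({x \<in> space M. rep g x \<noteq> 0} - E) = 0 \<longrightarrow>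
       \<Phi> g = ae_class N (\<lambda>y. if y \<in> \<Lambda> E then rep (induced_iso p M N \<Lambda> g) y * complex_of_real (h E y) else 0)"
    using rep unfolding represents_def by blast
  \<comment> \<open>\<open>h E\<close> is unconstrained outside \<open>\<Lambda> E\<close>; the
    value 0 there makes the weight measurable on all of \<open>N\<close>.\<close>
  define w where "w E y = (if E \<in> sigma_fin_sets M \<and> y \<in> \<Lambda> E then h E y else 0) powr p" for E y
  have h0: "0 \<le> h E y" if "E \<in> sigma_fin_sets M" "y \<in> \<Lambda> E" for E y
    using h that unfolding local_weights_def by blast
  have wm: "w E \<in> borel_measurable N" if E: "E \<in> sigma_fin_sets M" for E
  proof -
    have "(\<lambda>y. if y \<in> \<Lambda> E then h E y else 0) \<in> borel_measurable N"
      by (rule borel_measurable_from_sigma_co[OF _ \<Lambda>_in[OF E]]) (use h E in \<open>auto simp: local_weights_def\<close>)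
    then show ?thesis unfolding w_def using E by simp
  qed
  have wh: "w E y powr (1 / p) = h E y" if "E \<in> sigma_fin_sets M" "y \<in> \<Lambda> E" for E y
    using h0[OF that] that p0 by (simp add: w_def powr_powr)
  have rep_w: "\<Phi> g = ae_class N (\<lambda>y. if y \<in> \<Lambda> E
          then rep (induced_iso p M N \<Lambda> g) y * complex_of_real (w E y powr (1 / p)) else 0)"
    if g: "g \<in> Lp_pos_sphere p M" and E: "E \<in> sigma_fin_sets M" and g0: "AE x in M. x \<notin> E \<longrightarrow> rep g x = 0" for g E
  proof -
    have [measurable]: "rep g \<in> borel_measurable M" by (rule sphereD(1)[OF g p0])
    note [measurable] = sigma_fin_sets_sets[OF E]
    have "AE x in M. x \<notin> {x \<in> space M. rep g x \<noteq> 0} - E" using g0 by eventually_elim auto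
    then have "{x \<in> space M. rep g x \<noteq> 0} - E \<in> null_sets M" by (subst (asm) AE_iff_null_sets[symmetric]) auto
    then have "emeasure M ({x \<in> space M. rep g x \<noteq> 0} - E) = 0" by (simp add: null_sets_def)
    then have "\<Phi> g = ae_class N (\<lambda>y. if y \<in> \<Lambda> E then rep (induced_iso p M N \<Lambda> g) y * complex_of_real (h E y) else 0)"
      using \<Phi> g E by blast
    then show ?thesis using wh[OF E] by (simp cong: if_cong)
  qed
  have "weighted_iso M N \<Lambda> p w"
  proof (intro weighted_iso.intro weighted_iso_axioms.intro p0 wm set_iso.intro iso)
    show "0 \<le> w E y" for E y by (simp add: w_def)
    fix E A assume E: "E \<in> sigma_fin_sets M" and A: "A \<in> sigma_fin_sets M" "A \<subseteq> E"
    note [measurable] = wm[OF E]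
    show "(\<integral>\<^sup>+y\<in>\<Lambda> A. ennreal (w E y) \<partial>N) = emeasure M A"
    proof (rule weight_integral_extend[OF E _ _ A])
      fix A assume A: "A \<in> fin_sets M" "A \<subseteq> E"
      have As: "A \<in> sigma_fin_sets M" by (rule fin_sigma_fin[OF A(1)])
      note [measurable] = sigma_fin_sets_sets[OF As] \<Lambda>_sets[OF As] \<Lambda>_sets[OF E]
      show "(\<integral>\<^sup>+y\<in>\<Lambda> A. ennreal (w E y) \<partial>N) = emeasure M A"
      proof (cases "emeasure M A = 0")
        case True
        from AE_notin[OF this sigma_fin_sets_sets[OF As]] have z: "AE y in N. y \<notin> \<Lambda> A" unfolding \<Lambda>_null_iff[OF As] .
        have "(\<integral>\<^sup>+y\<in>\<Lambda> A. ennreal (w E y) \<partial>N) = (\<integral>\<^sup>+y. 0 \<partial>N)"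
          by (rule nn_integral_cong_AE) (use z in \<open>eventually_elim, simp\<close>)
        then show ?thesis using True by simp
      next
        case False
        obtain c where c: "0 < c" "emeasure M A = ennreal (1 / c powr p)"
          "ae_class M (\<lambda>x. complex_of_real c * indicator A x) \<in> Lp_pos_sphere p M"
          using ae_class_indicator_sphere[OF A(1) False p0] by blast
        define g where "g = ae_class M (\<lambda>x. complex_of_real c * indicator A x)"
        have g: "g \<in> Lp_pos_sphere p M" using c(3) by (simp add: g_def)
        have "(\<lambda>x. complex_of_real c * indicator A x) \<in> borel_measurable M" by measurable
        from rep_ae_class(2)[OF this] have gr: "AE x in M. rep g x = complex_of_real c * indicator A x"
          by (simp add: g_def)
        have gA: "AE x in M. x \<notin> A \<longrightarrow> rep g x = 0" using gr by eventually_elim auto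
        have gE: "AE x in M. x \<notin> E \<longrightarrow> rep g x = 0" using gA by eventually_elim (use A(2) in auto)
        obtain f k where f: "carried A f k" "AE x in M. f x = rep g x"
          and r: "rep (induced_iso p M N \<Lambda> g) \<in> borel_measurable N" "AE y in N. rep (induced_iso p M N \<Lambda> g) y = k y"
          using induced_iso_carried[OF p0 sphereD(5)[OF g p0] As gA] by blast
        have ci: "carried A (\<lambda>x. complex_of_real c * indicator A x) (\<lambda>y. complex_of_real c * indicator (\<Lambda> A) y)"
          using carried_combine[OF carried_indicator[OF As] carried_indicator[OF As],
              where h = "\<lambda>z. complex_of_real c * fst z"]
          by simp
        have "AE x in M. f x = complex_of_real c * indicator A x" using f(2) gr by eventually_elim simp
        from carried_unique[OF f(1) ci this]
        have k: "AE y in N. k y = complex_of_real c * indicator (\<Lambda> A) y" .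
        define v where "v y = (if y \<in> \<Lambda> E then rep (induced_iso p M N \<Lambda> g) y * complex_of_real (w E y powr (1 / p)) else 0)" for y
        note [measurable] = r(1)
        have [measurable]: "v \<in> borel_measurable N" unfolding v_def by measurable
        have "ae_class N v \<in> Lp_pos_sphere p N" using sphere[OF g] rep_w[OF g E gE] by (simp add: v_def[abs_def])
        then have "pint p N v = 1" using p0 by (subst (asm) ae_class_in_sphere_iff) auto
        also have "pint p N v = (\<integral>\<^sup>+y. ennreal (c powr p) * (ennreal (w E y) * indicator (\<Lambda> A) y) \<partial>N)"
          unfolding pint_def
        proof (rule nn_integral_cong_AE)
          show "AE y in N. ennreal (cmod (v y) powr p) = ennreal (c powr p) * (ennreal (w E y) * indicator (\<Lambda> A) y)"
            using r(2) k \<Lambda>_mono[OF As E A(2)]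
          proof eventually_elim
            case (elim y)
            have w0: "0 \<le> w E y" by (simp add: w_def)
            show ?case
            proof (cases "y \<in> \<Lambda> A")
              case True
              then have "cmod (v y) powr p = c powr p * w E y"
                using elim c(1) w0 p0 by (simp add: v_def norm_mult powr_mult powr_powr)
              then show ?thesis using True by (simp add: ennreal_mult' w0)
            next
              case False
              then have "v y = 0" using elim by (simp add: v_def)
              then show ?thesis using False by simp
            qed
          qed
        qed
        also have "\<dots> = ennreal (c powr p) * (\<integral>\<^sup>+y\<in>\<Lambda> A. ennreal (w E y) \<partial>N)"
          by (rule nn_integral_cmult) measurable
        finally have *: "ennreal (c powr p) * (\<integral>\<^sup>+y\<in>\<Lambda> A. ennreal (w E y) \<partial>N) = 1" .
        have "(\<integral>\<^sup>+y\<in>\<Lambda> A. ennreal (w E y) \<partial>N)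
            = ennreal (1 / c powr p) * (ennreal (c powr p) * (\<integral>\<^sup>+y\<in>\<Lambda> A. ennreal (w E y) \<partial>N))"
          using c(1) by (simp add: mult.assoc[symmetric] ennreal_mult'[symmetric])
        then show ?thesis unfolding * c(2) by simp
      qed
    qed measurable
  qed
  then show ?thesis using rep_w by blast
qed

text \<open>Existence comes from gluing the local weights, uniqueness from uniqueness on each
  \<open>\<Lambda> E\<close> together with semi-finiteness.\<close>

lemma represents_RN:
  assumes rep: "represents p M N \<Phi> \<Lambda>" and p: "1 \<le> p" and loc: "localizable N"
    and sphere: "\<And>u. u \<in> Lp_pos_sphere p M \<Longrightarrow> \<Phi> u \<in> Lp_pos_sphere p N"
  shows "\<exists>k. is_RN_derivative N (transport M N \<Lambda>) k \<and>
     (\<forall>k'. is_RN_derivative N (transport M N \<Lambda>) k' \<longrightarrow> (AE y in N. k' y = k y)) \<and>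
     (\<forall>g\<in>Lp_pos_sphere p M. \<Phi> g = ae_class N (\<lambda>y. rep (induced_iso p M N \<Lambda> g) y
        * complex_of_real (k y powr (1 / p))))"
proof -
  have p0: "0 < p" using p by simp
  obtain w where w: "weighted_iso M N \<Lambda> p w" and \<Phi>: "\<forall>g\<in>Lp_pos_sphere p M. \<forall>E\<in>sigma_fin_sets M.
      (AE x in M. x \<notin> E \<longrightarrow> rep g x = 0) \<longrightarrow> \<Phi> g = ae_class N (\<lambda>y. if y \<in> \<Lambda> E
          then rep (induced_iso p M N \<Lambda> g) y * complex_of_real (w E y powr (1 / p)) else 0)"
    using represents_weights[OF rep p sphere] by blast
  interpret W: weighted_iso M N \<Lambda> p w by (rule w)
  have sf: "semi_finite N" using loc by (simp add: localizable_def)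
  obtain k0 where k0[measurable]: "k0 \<in> borel_measurable N"
    and k0w: "\<And>E. E \<in> sigma_fin_sets M \<Longrightarrow> AE y in N. y \<in> \<Lambda> E \<longrightarrow> k0 y = ennreal (w E y)"
  proof -
    have "\<exists>k\<in>borel_measurable N. \<forall>E\<in>sigma_fin_sets M. AE y in N. y \<in> \<Lambda> E \<longrightarrow> k y = ennreal (w E y)"
    proof (rule localizable_glue[OF loc])
      fix E assume E: "E \<in> sigma_fin_sets M"
      show "\<Lambda> E \<in> sets N" by (rule W.\<Lambda>_sets[OF E])
      show "(\<lambda>y. ennreal (w E y)) \<in> borel_measurable N" using W.w_meas[OF E] by measurable
    next
      fix E F assume "E \<in> sigma_fin_sets M" "F \<in> sigma_fin_sets M"
      from W.w_cong[OF this]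
      show "AE y in N. y \<in> \<Lambda> E \<and> y \<in> \<Lambda> F \<longrightarrow> ennreal (w E y) = ennreal (w F y)" by eventually_elim auto
    qed
    then show ?thesis using that by blast
  qed
  \<comment> \<open>On each \<open>\<Lambda> E\<close> the glued function is a.e. finite, so
    \<open>enn2real\<close>, which sends infinity to 0, changes nothing essential there.\<close>
  define k where "k y = enn2real (k0 y)" for y
  have k[measurable]: "k \<in> borel_measurable N" unfolding k_def by measurable
  have kw: "AE y in N. y \<in> \<Lambda> E \<longrightarrow> k y = w E y" if "E \<in> sigma_fin_sets M" for E
    using k0w[OF that] by eventually_elim (simp add: k_def W.w_nonneg)
  \<comment> \<open>Since \<open>K\<close> and \<open>N\<close> have the same \<sigma>-finite sets,
    and these are images up to null sets, the derivative may be tested on \<open>\<Lambda> A\<close>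
    alone.\<close>
  have RN_iff: "is_RN_derivative N W.K k' \<longleftrightarrow> k' \<in> borel_measurable N \<and> (\<forall>y\<in>space N. 0 \<le> k' y) \<and>
      (\<forall>A\<in>sigma_fin_sets M. (\<integral>\<^sup>+y\<in>\<Lambda> A. ennreal (k' y) \<partial>N) = emeasure M A)" for k'
    unfolding is_RN_derivative_def W.sigma_fin_sets_K
  proof (intro conj_cong refl iffI ballI)
    fix A assume *: "\<forall>E\<in>sigma_fin_sets N. emeasure W.K E = (\<integral>\<^sup>+y\<in>E. ennreal (k' y) \<partial>N)" and A: "A \<in> sigma_fin_sets M"
    show "(\<integral>\<^sup>+y\<in>\<Lambda> A. ennreal (k' y) \<partial>N) = emeasure M A"
      using * W.\<Lambda>_in[OF A] W.emeasure_K[OF A W.\<Lambda>_in[OF A]] by simp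
  next
    fix B assume *: "\<forall>A\<in>sigma_fin_sets M. (\<integral>\<^sup>+y\<in>\<Lambda> A. ennreal (k' y) \<partial>N) = emeasure M A" and B: "B \<in> sigma_fin_sets N"
    obtain A where A: "A \<in> sigma_fin_sets M" "AE y in N. y \<in> \<Lambda> A \<longleftrightarrow> y \<in> B" using W.\<Lambda>_surj[OF B] by blast
    show "emeasure W.K B = (\<integral>\<^sup>+y\<in>B. ennreal (k' y) \<partial>N)"
      using W.emeasure_K[OF A(1) B A(2)] *[rule_format, OF A(1)]
        AE_mem_eq_cong[OF W.\<Lambda>_sets[OF A(1)] sigma_fin_sets_sets[OF B] A(2), of "\<lambda>y. ennreal (k' y)"] by simp
  qed
  have kint: "(\<integral>\<^sup>+y\<in>\<Lambda> A. ennreal (k y) \<partial>N) = emeasure M A" if A: "A \<in> sigma_fin_sets M" for A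
  proof -
    have "(\<integral>\<^sup>+y\<in>\<Lambda> A. ennreal (k y) \<partial>N) = (\<integral>\<^sup>+y\<in>\<Lambda> A. ennreal (w A y) \<partial>N)"
      by (rule nn_integral_cong_AE) (use kw[OF A] in \<open>eventually_elim, simp add: indicator_def\<close>)
    then show ?thesis using W.w_int[OF A A] by simp
  qed
  have RN: "is_RN_derivative N W.K k" unfolding RN_iff using kint by (simp add: k_def k[unfolded k_def])
  have uniq: "AE y in N. k' y = k y" if k': "is_RN_derivative N W.K k'" for k'
  proof -
    have [measurable]: "k' \<in> borel_measurable N" and k'0: "\<forall>y\<in>space N. 0 \<le> k' y"
      and k'int: "\<And>A. A \<in> sigma_fin_sets M \<Longrightarrow> (\<integral>\<^sup>+y\<in>\<Lambda> A. ennreal (k' y) \<partial>N) = emeasure M A"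
      using k' unfolding RN_iff by auto
    show ?thesis
    proof (rule W.AE_by_images[OF sf])
      show "{y \<in> space N. k' y \<noteq> k y} \<in> sets N" by measurable
      fix E assume E: "E \<in> sigma_fin_sets M"
      have "AE y in N. y \<in> \<Lambda> E \<longrightarrow> ennreal (k' y) = ennreal (k y)"
        by (rule W.weights_unique[OF E]) (auto simp: kint k'int)
      then show "AE y in N. y \<in> \<Lambda> E \<longrightarrow> k' y = k y"
        using AE_space by eventually_elim (use k'0 in \<open>auto simp: k_def\<close>)
    qed
  qed
  have "\<Phi> g = ae_class N (\<lambda>y. rep (induced_iso p M N \<Lambda> g) y * complex_of_real (k y powr (1 / p)))"
    if g: "g \<in> Lp_pos_sphere p M" for g
  proof -
    note gL = sphereD(5)[OF g p0]
    define E where "E = {x \<in> space M. rep g x \<noteq> 0}"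
    have E: "E \<in> sigma_fin_sets M" unfolding E_def by (rule W.Lp_support[OF gL])
    have g0: "AE x in M. x \<notin> E \<longrightarrow> rep g x = 0" by (rule AE_I2) (simp add: E_def)
    obtain f v where c: "W.carried E f v"
      and r: "rep (induced_iso p M N \<Lambda> g) \<in> borel_measurable N" "AE y in N. rep (induced_iso p M N \<Lambda> g) y = v y"
      using W.induced_iso_carried[OF p0 gL E g0] by blast
    note [measurable] = r(1) W.w_meas[OF E] W.\<Lambda>_sets[OF E]
    have "AE y in N. (if y \<in> \<Lambda> E then rep (induced_iso p M N \<Lambda> g) y * complex_of_real (w E y powr (1 / p)) else 0)
        = rep (induced_iso p M N \<Lambda> g) y * complex_of_real (k y powr (1 / p))"
      using r(2) W.carriedD(4)[OF c] kw[OF E] by eventually_elim auto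
    then have "ae_class N (\<lambda>y. if y \<in> \<Lambda> E then rep (induced_iso p M N \<Lambda> g) y * complex_of_real (w E y powr (1 / p)) else 0)
        = ae_class N (\<lambda>y. rep (induced_iso p M N \<Lambda> g) y * complex_of_real (k y powr (1 / p)))"
      by (subst ae_class_eq_iff) measurable
    then show ?thesis using \<Phi> g E g0 by simp
  qed
  then show ?thesis using RN uniq by blast
qed

theorem theorem10:
  fixes p :: real and M :: "'a measure" and N :: "'b measure"
    and \<Phi> :: "('a \<Rightarrow> complex) set \<Rightarrow> ('b \<Rightarrow> complex) set"
  assumes p: "1 \<le> p"
    and bij: "bij_betw \<Phi> (Lp_pos_sphere p M) (Lp_pos_sphere p N)"
    and metric: "\<And>f g. f \<in> Lp_pos_sphere p M \<Longrightarrow> g \<in> Lp_pos_sphere p M \<Longrightarrow>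
      Lp_norm p N (Lp_diff N (\<Phi> f) (\<Phi> g)) = Lp_norm p M (Lp_diff M f g)"
  shows
    "(\<exists>!T. T \<in> extensional (Lp p M) \<and> isometric_order_iso p M N T \<and>
        (\<forall>f\<in>Lp_pos_sphere p M. T f = \<Phi> f)) \<and>
     (\<exists>\<Lambda>. represents p M N \<Phi> \<Lambda>) \<and>
     (\<forall>\<Lambda>. represents p M N \<Phi> \<Lambda> \<and> localizable N \<longrightarrow>
        (\<exists>k. is_RN_derivative N (transport M N \<Lambda>) k \<and>
           (\<forall>k'. is_RN_derivative N (transport M N \<Lambda>) k' \<longrightarrow> (AE y in N. k' y = k y)) \<and>
           (\<forall>g\<in>Lp_pos_sphere p M.
              \<Phi> g = ae_class N (\<lambda>y. rep (induced_iso p M N \<Lambda> g) y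
                      * complex_of_real (k y powr (1 / p))))) \<and>
        (localizable M \<longrightarrow>
           (\<exists>\<Lambda>'. regular_set_iso M N (sets M) (sets N) \<Lambda>' \<and>
              (\<forall>A\<in>sigma_fin_sets M. \<Lambda>' A = \<Lambda> A))))"
proof (intro conjI allI impI)
  show "\<exists>!T. T \<in> extensional (Lp p M) \<and> isometric_order_iso p M N T \<and> (\<forall>f\<in>Lp_pos_sphere p M. T f = \<Phi> f)"
    by (rule sphere_isometry_extends[OF p bij metric])
  show "\<exists>\<Lambda>. represents p M N \<Phi> \<Lambda>" by (rule sphere_isometry_represents[OF p bij metric])
  fix \<Lambda> assume \<Lambda>: "represents p M N \<Phi> \<Lambda> \<and> localizable N"
  have sphere: "\<Phi> u \<in> Lp_pos_sphere p N" if "u \<in> Lp_pos_sphere p M" for u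
    using bij that by (auto simp: bij_betw_def)
  show "\<exists>k. is_RN_derivative N (transport M N \<Lambda>) k \<and>
     (\<forall>k'. is_RN_derivative N (transport M N \<Lambda>) k' \<longrightarrow> (AE y in N. k' y = k y)) \<and>
     (\<forall>g\<in>Lp_pos_sphere p M. \<Phi> g = ae_class N (\<lambda>y. rep (induced_iso p M N \<Lambda> g) y
        * complex_of_real (k y powr (1 / p))))"
    by (rule represents_RN[OF conjunct1[OF \<Lambda>] p conjunct2[OF \<Lambda>] sphere])
  assume M: "localizable M"
  have "set_iso M N \<Lambda>" using \<Lambda> by (simp add: represents_def set_iso_def)
  from set_iso.extends_to_sets[OF this M]
  show "\<exists>\<Lambda>'. regular_set_iso M N (sets M) (sets N) \<Lambda>' \<and> (\<forall>A\<in>sigma_fin_sets M. \<Lambda>' A = \<Lambda> A)" using \<Lambda> by blast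
qed

end
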